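(* Let $\epsilon\ge0$ with $\epsilon\neq0$, and let $$R_c=\epsilon^{-1/4}\sqrt{\frac{\lambda_{3,1}}{3}}\approx4.124\,\epsilon^{-1/4},$$ where $\lambda_{3,1}$ is the smallest positive root $\lambda$ of $I_3(\sqrt\lambda)J_3'(\sqrt\lambda)-J_3(\sqrt\lambda)I_3'(\sqrt\lambda)=0$. Let $\beta_{m,j}=\beta_{m,j}(R)$ denote the eigenvalues of the linearized problem described in the context. Then $$\beta_{3,1}(R)=\beta_{-3,1}(R)\begin{cases}<0&\text{if }R<R_c,\\=0&\text{if }R=R_c,\\>0&\text{if }R>R_c,\end{cases}$$ and $$\beta_{m,j}(R_c)<0\qquad\text{if }(m,j)\neq(\pm3,1).$$
   Context: $\Omega$ is the unit disk in $\mathbb{R}^2$ with polar coordinates $(r,\theta)$, $R>0$ is the Reynolds number, $\epsilon\ge 0$ a material constant. $J_k$ and $I_k$ are the Bessel and modified Bessel functions of the first kind of order $k$. The eigenvalue problem is: find $\beta$ and nonzero (complex-valued, sufficiently smooth) $(w,\psi)$ on $\Omega$ with $$\tfrac1R\Delta w+R\,\psi_\theta=\beta(1-\epsilon\Delta)w,\qquad \tfrac1R\Delta^2\psi-\epsilon R\,\Delta w_\theta=\beta(1-\epsilon\Delta)\Delta\psi\quad\text{in }\Omega,$$ $$w=\psi=\partial_r\psi=0\quad\text{at }r=1.$$ All eigenvalues are real. Eigenvectors are taken of the form $e^{im\theta}(w_{m,j}(r),\psi_{m,j}(r))^T$, $m\in\mathbb{Z}$, $j\in\mathbb{Z}_+=\{1,2,\dots\}$,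 with corresponding eigenvalue $\beta_{m,j}$ ($m$ is the azimuthal wavenumber); for each $m\ne0$ the eigenvalues are ordered so that $\beta_{m,1}\ge\beta_{m,2}\ge\cdots$. For $m=0$, $\beta_{0,j}$ ranges over all eigenvalues with $\theta$-independent eigenvectors. *)

theory Defs
  imports "HOL-Analysis.Analysis"
begin

definition bessel_J :: "nat \<Rightarrow> real \<Rightarrow> real" where
  "bessel_J k x = (\<Sum>n. (- 1) ^ n / (fact n * fact (n + k)) * (x / 2) ^ (2 * n + k))"

definition bessel_I :: "nat \<Rightarrow> real \<Rightarrow> real" where
  "bessel_I k x = (\<Sum>n. 1 / (fact n * fact (n + k)) * (x / 2) ^ (2 * n + k))"

definition lambda_31 :: real where
  "lambda_31 = (LEAST l::real. l > 0 \<and>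
     bessel_I 3 (sqrt l) * deriv (bessel_J 3) (sqrt l)
       - bessel_J 3 (sqrt l) * deriv (bessel_I 3) (sqrt l) = 0)"

definition critical_R :: "real \<Rightarrow> real" where
  "critical_R \<epsilon> = \<epsilon> powr (- 1 / 4) * sqrt (lambda_31 / 3)"

abbreviation disc :: "(real \<times> real) set" where
  "disc \<equiv> ball 0 1"

abbreviation closed_disc :: "(real \<times> real) set" where
  "closed_disc \<equiv> cball 0 1"

definition polar :: "real \<Rightarrow> real \<Rightarrow> real \<times> real" where
  "polar r \<theta> = (r * cos \<theta>, r * sin \<theta>)"

text \<open>Functions of class \<open>C\<^sup>k\<close> up to the boundary. The derivative within the closed disc
  is unique, because the disc is convex with nonempty interior. The values of the functions
  outside the closed disc play no role here or below.\<close>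

fun Ck_disc :: "nat \<Rightarrow> (real \<times> real \<Rightarrow> complex) \<Rightarrow> bool" where
  "Ck_disc 0 f \<longleftrightarrow> continuous_on closed_disc f"
| "Ck_disc (Suc k) f \<longleftrightarrow> (\<exists>fx fy.
     (\<forall>p\<in>closed_disc.
        (f has_derivative (\<lambda>h. fst h *\<^sub>R fx p + snd h *\<^sub>R fy p)) (at p within closed_disc)) \<and>
     Ck_disc k fx \<and> Ck_disc k fy)"

definition dir_deriv :: "real \<times> real \<Rightarrow> (real \<times> real \<Rightarrow> complex) \<Rightarrow> real \<times> real \<Rightarrow> complex" where
  "dir_deriv v f p = vector_derivative (\<lambda>t. f (p + t *\<^sub>R v)) (at 0)"

definition laplacian :: "(real \<times> real \<Rightarrow> complex) \<Rightarrow> real \<times> real \<Rightarrow> complex" where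
  "laplacian f p = (\<Sum>v\<in>Basis. dir_deriv v (dir_deriv v f) p)"

text \<open>The derivative with respect to the polar angle: for \<open>(x, y) = polar r \<theta>\<close> the
  argument of \<open>f\<close> below is \<open>polar r (\<theta> + t)\<close>.\<close>

definition theta_deriv :: "(real \<times> real \<Rightarrow> complex) \<Rightarrow> real \<times> real \<Rightarrow> complex" where
  "theta_deriv f = (\<lambda>(x, y).
     vector_derivative (\<lambda>t. f (x * cos t - y * sin t, x * sin t + y * cos t)) (at 0))"

text \<open>\<open>(w, \<psi>)\<close> is an eigenvector for \<open>\<beta>\<close>. The radial derivative at the boundary is
  the one-sided derivative from inside the disc.\<close>

definition eigenvector ::
  "real \<Rightarrow> real \<Rightarrow> complex \<Rightarrow> (real \<times> real \<Rightarrow> complex) \<Rightarrow> (real \<times> real \<Rightarrow> complex) \<Rightarrow> bool" where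
  "eigenvector \<epsilon> R \<beta> w \<psi> \<longleftrightarrow>
     Ck_disc 3 w \<and> Ck_disc 4 \<psi> \<and>
     (\<exists>p\<in>disc. w p \<noteq> 0 \<or> \<psi> p \<noteq> 0) \<and>
     (\<forall>p\<in>disc.
        (1 / R) *\<^sub>R laplacian w p + R *\<^sub>R theta_deriv \<psi> p
          = \<beta> * (w p - \<epsilon> *\<^sub>R laplacian w p)) \<and>
     (\<forall>p\<in>disc.
        (1 / R) *\<^sub>R laplacian (laplacian \<psi>) p - (\<epsilon> * R) *\<^sub>R laplacian (theta_deriv w) p
          = \<beta> * (laplacian \<psi> p - \<epsilon> *\<^sub>R laplacian (laplacian \<psi>) p)) \<and>
     (\<forall>\<theta>. w (polar 1 \<theta>) = 0 \<and> \<psi> (polar 1 \<theta>) = 0 \<and>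
        ((\<lambda>r. \<psi> (polar r \<theta>)) has_vector_derivative 0) (at 1 within {0..1}))"

definition azimuthal :: "int \<Rightarrow> (real \<times> real \<Rightarrow> complex) \<Rightarrow> bool" where
  "azimuthal m f \<longleftrightarrow>
     (\<exists>g. \<forall>r\<in>{0..1}. \<forall>\<theta>. f (polar r \<theta>) = cis (of_int m * \<theta>) * g r)"

definition mode_eigenvector ::
  "real \<Rightarrow> real \<Rightarrow> int \<Rightarrow> complex \<Rightarrow> (real \<times> real \<Rightarrow> complex) \<Rightarrow> (real \<times> real \<Rightarrow> complex) \<Rightarrow> bool" where
  "mode_eigenvector \<epsilon> R m \<beta> w \<psi> \<longleftrightarrow>
     eigenvector \<epsilon> R \<beta> w \<psi> \<and> azimuthal m w \<and> azimuthal m \<psi>"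

text \<open>\<open>b 1 \<ge> b 2 \<ge> \<dots>\<close> are the eigenvalues of wavenumber \<open>m\<close>, counted from the largest one
  with multiplicity, \<open>(W j, \<Psi> j)\<close> being linearly independent eigenvectors for \<open>b j\<close>.

  The eigenvalues of a fixed wavenumber accumulate at \<open>- 1 / (\<epsilon> * R)\<close> and nowhere else.
  For \<open>\<epsilon> ^ 3 * R ^ 4 * m\<^sup>2 > 1\<close> they do so from both sides, so that no decreasing sequence
  contains all of them. Hence the last clause: an eigenvalue is listed with its full
  eigenspace, or it lies below every listed eigenvalue. Since infinitely many eigenvalues are
  greater than \<open>- 1 / (\<epsilon> * R)\<close>, this determines \<open>b\<close> on the positive integers.\<close>

definition ordered_eigenvalues :: "real \<Rightarrow> real \<Rightarrow> int \<Rightarrow> (nat \<Rightarrow> real) \<Rightarrow> bool" where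
  "ordered_eigenvalues \<epsilon> R m b \<longleftrightarrow>
     (\<forall>i\<ge>1. \<forall>j\<ge>i. b j \<le> b i) \<and>
     (\<exists>W \<Psi>.
        (\<forall>j\<ge>1. mode_eigenvector \<epsilon> R m (of_real (b j)) (W j) (\<Psi> j)) \<and>
        (\<forall>S (c :: nat \<Rightarrow> complex). finite S \<and> S \<subseteq> {1..} \<and>
           (\<forall>p\<in>closed_disc. (\<Sum>j\<in>S. c j * W j p) = 0 \<and> (\<Sum>j\<in>S. c j * \<Psi> j p) = 0)
           \<longrightarrow> (\<forall>j\<in>S. c j = 0)) \<and>
        (\<forall>\<mu> w \<psi>. mode_eigenvector \<epsilon> R m \<mu> w \<psi> \<longrightarrow>
           (\<exists>S (c :: nat \<Rightarrow> complex). finite S \<and> S \<subseteq> {j. 1 \<le> j \<and> of_real (b j) = \<mu>} \<and>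
              (\<forall>p\<in>closed_disc. w p = (\<Sum>j\<in>S. c j * W j p) \<and> \<psi> p = (\<Sum>j\<in>S. c j * \<Psi> j p))) \<or>
           (\<mu> \<in> \<real> \<and> (\<forall>j\<ge>1. Re \<mu> < b j))))"

definition eigenvalue_family :: "real \<Rightarrow> real \<Rightarrow> (int \<Rightarrow> nat \<Rightarrow> real) \<Rightarrow> bool" where
  "eigenvalue_family \<epsilon> R \<beta> \<longleftrightarrow>
     (\<forall>m. m \<noteq> 0 \<longrightarrow> ordered_eigenvalues \<epsilon> R m (\<beta> m)) \<and>
     of_real ` \<beta> 0 ` {1..} = {\<mu>. \<exists>w \<psi>. mode_eigenvector \<epsilon> R 0 \<mu> w \<psi>}"

end

theory Submission
  imports Defs
begin

text \<open>Everything is explicit in one wavenumber. Put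
\<open>C\<^sub>n(s) = \<Sum>k. s\<^sup>k / (k! (k + n)!)\<close> (the Bessel-Clifford function) and
\<open>U\<^sub>s(z) = z\<^sup>n C\<^sub>n(s |z|\<^sup>2)\<close> for \<open>z = x + i y\<close>; then \<open>\<Delta> U\<^sub>s = 4 s U\<^sub>s\<close>, so that up to
constants \<open>U\<^sub>s\<close> is \<open>J\<^sub>n\<close> for \<open>s < 0\<close>, \<open>I\<^sub>n\<close> for \<open>s > 0\<close> and \<open>z\<^sup>n\<close> for \<open>s = 0\<close>.
For a wavenumber \<open>n \<ge> 0\<close> and real \<open>\<beta> \<ge> 0\<close> write \<open>a = 1/R + \<beta> \<epsilon>\<close>, \<open>M = n R \<surd>\<epsilon>\<close>,
\<open>p = (M - \<beta>) / (4 a)\<close> and \<open>q = (M + \<beta>) / (4 a)\<close>.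

If \<open>(w, \<psi>)\<close> solves the equations, then \<open>\<Delta>\<psi> \<plusminus> i \<surd>\<epsilon> \<Delta>w\<close> are eigenfunctions of the Laplacian with
eigenvalues \<open>4 q\<close> and \<open>- 4 p\<close>. A solution that is bounded at the centre is a multiple of
\<open>U\<^sub>q\<close>, respectively \<open>U\<^sub>-\<^sub>p\<close> (lemma \<open>radial_eigenfunction\<close>). The first equation read on the circle gives
\<open>\<Delta>w = 0\<close> there, and \<open>\<psi> = \<partial>\<^sub>r \<psi> = 0\<close> says that \<open>\<Delta>\<psi>\<close> is orthogonal to \<open>z\<^sup>n\<close>. These are two linear
equations for the two coefficients, with determinant
\<open>freq n p q = C\<^sub>n\<^sub>+\<^sub>1(-p) C\<^sub>n(q) + C\<^sub>n(-p) C\<^sub>n\<^sub>+\<^sub>1(q)\<close>.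
If it does not vanish, the solution is zero (\<open>mode_solution_trivial\<close>);
if it vanishes and \<open>p > 0\<close>, there is an eigenvector (\<open>mode_eigenvector_exists\<close>).

The sign of the determinant is governed by the ratios \<open>r\<^sub>n = C\<^sub>n\<^sub>+\<^sub>1 / C\<^sub>n\<close>. The recurrence
\<open>C\<^sub>n = (n+1) C\<^sub>n\<^sub>+\<^sub>1 + s C\<^sub>n\<^sub>+\<^sub>2\<close> shows that \<open>freq n p q\<close> is a positive multiple of
\<open>2 (n+1) - p r\<^sub>n\<^sub>+\<^sub>1(-p) + q r\<^sub>n\<^sub>+\<^sub>1(q)\<close> as long as \<open>C\<^sub>n\<^sub>+\<^sub>1(-p) > 0\<close>, and a Turan inequality makes
\<open>r\<^sub>n\<close> nonincreasing where \<open>C\<^sub>n > 0\<close>. For \<open>p \<le> 0 \<le> q\<close> the determinant is clearly positive;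
for \<open>q \<ge> p \<ge> 0\<close> it stays positive until
\<open>gap n p = p (r\<^sub>n\<^sub>+\<^sub>1(-p) - r\<^sub>n\<^sub>+\<^sub>1(p))\<close>, which grows at least linearly, reaches \<open>2 (n+1)\<close>.
For \<open>n = 3\<close> this happens at \<open>tcrit = \<lambda>\<^sub>3\<^sub>1 / 4\<close>; for the other \<open>n\<close> it does not happen for
\<open>p \<le> 4.253 n\<close>. The continued fraction of \<open>r\<^sub>n\<close> provides the numerical bounds.

Now \<open>p \<le> n R\<^sup>2 \<surd>\<epsilon> / 4\<close>, with equality only for \<open>\<beta> = 0\<close> when \<open>n > 0\<close>, and \<open>R \<le> R\<^sub>c\<close> means that this is at most
\<open>n tcrit / 3 < 4.253 n\<close> for \<open>n > 0\<close>. So no eigenvalue is nonnegative for \<open>R \<le> R\<^sub>c\<close>, except \<open>\<beta> = 0\<close> for \<open>n = 3\<close> and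
\<open>R = R\<^sub>c\<close>, where \<open>p = q = tcrit\<close>, the determinant vanishes and the solutions form a line.
For \<open>R > R\<^sub>c\<close> and \<open>n = 3\<close> the determinant changes sign on \<open>0 \<le> \<beta> \<le> M\<close>, which gives a positive eigenvalue.
Complex conjugation exchanges the wavenumbers \<open>m\<close> and \<open>-m\<close>.\<close>

section \<open>Bessel-Clifford functions\<close>

definition clifford :: "nat \<Rightarrow> real \<Rightarrow> real" where
  "clifford n s = (\<Sum>k. s ^ k / (fact k * fact (k + n)))"

definition clifford_coeff :: "nat \<Rightarrow> nat \<Rightarrow> real" where
  "clifford_coeff n k = 1 / (fact k * fact (k + n))"

lemma clifford_alt: "clifford n s = (\<Sum>k. clifford_coeff n k * s ^ k)"
  by (simp add: clifford_def clifford_coeff_def)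

lemma clifford_coeff_pos: "clifford_coeff n k > 0"
  by (simp add: clifford_coeff_def)

lemma clifford_coeff_Suc: "diffs (clifford_coeff n) k = clifford_coeff (Suc n) k"
  unfolding diffs_def clifford_coeff_def fact_Suc[of k] add_Suc add_Suc_right
  by (simp del: fact_Suc of_nat_Suc)

lemma summable_clifford: "summable (\<lambda>k. clifford_coeff n k * s ^ k)"
proof (rule summable_comparison_test')
  show "summable (\<lambda>k. inverse (fact k) * \<bar>s\<bar> ^ k)"
    using summable_exp by blast
  fix k :: nat
  have "(1::real) \<le> fact (k + n)" by (rule fact_ge_1)
  hence "clifford_coeff n k \<le> inverse (fact k)"
    by (simp add: clifford_coeff_def field_simps)
  thus "norm (clifford_coeff n k * s ^ k) \<le> inverse (fact k) * \<bar>s\<bar> ^ k"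
    using clifford_coeff_pos[of n k]
    by (simp add: abs_mult power_abs mult_right_mono)
qed

lemma clifford_has_derivative:
  "(clifford n has_real_derivative clifford (Suc n) s) (at s within X)"
proof -
  have "((\<lambda>s. \<Sum>k. clifford_coeff n k * s ^ k) has_real_derivative
      (\<Sum>k. diffs (clifford_coeff n) k * s ^ k)) (at s)"
    by (rule termdiffs_strong_converges_everywhere) (rule summable_clifford)
  thus ?thesis
    unfolding clifford_coeff_Suc clifford_alt[symmetric, abs_def]
    by (rule has_field_derivative_at_within)
qed

lemma continuous_on_clifford [continuous_intros]:
  "continuous_on X f \<Longrightarrow> continuous_on X (\<lambda>x. clifford n (f x))"
  using DERIV_continuous_on[OF clifford_has_derivative, of UNIV n]
  by (rule continuous_on_compose2) auto

lemma clifford_0 [simp]: "clifford n 0 = 1 / fact n"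
  unfolding clifford_alt powser_zero by (simp add: clifford_coeff_def)

lemma clifford_recurrence:
  "clifford n s = (n + 1) * clifford (Suc n) s + s * clifford (Suc (Suc n)) s"
proof -
  have sm: "summable (\<lambda>k. clifford_coeff n k * s ^ k)" for n by (rule summable_clifford)
  have "(\<lambda>k. (n + 1) * (clifford_coeff (Suc n) k * s ^ k)) sums ((n + 1) * clifford (Suc n) s)"
    unfolding clifford_alt by (intro sums_mult summable_sums sm)
  moreover have "(\<lambda>k. s * (clifford_coeff (Suc (Suc n)) k * s ^ k)) sums (s * clifford (Suc (Suc n)) s)"
    unfolding clifford_alt by (intro sums_mult summable_sums sm)
  hence "(\<lambda>k. if k = 0 then 0 else s * (clifford_coeff (Suc (Suc n)) (k - 1) * s ^ (k - 1)))
      sums (s * clifford (Suc (Suc n)) s)"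
    using sums_Suc_iff[of "\<lambda>k. if k = 0 then 0 else s * (clifford_coeff (Suc (Suc n)) (k - 1) * s ^ (k - 1))"]
    by simp
  ultimately have "(\<lambda>k. (n + 1) * (clifford_coeff (Suc n) k * s ^ k)
      + (if k = 0 then 0 else s * (clifford_coeff (Suc (Suc n)) (k - 1) * s ^ (k - 1))))
    sums ((n + 1) * clifford (Suc n) s + s * clifford (Suc (Suc n)) s)"
    by (rule sums_add)
  moreover have "(n + 1) * (clifford_coeff (Suc n) k * s ^ k)
      + (if k = 0 then 0 else s * (clifford_coeff (Suc (Suc n)) (k - 1) * s ^ (k - 1)))
      = clifford_coeff n k * s ^ k" for k
  proof (cases k)
    case 0
    thus ?thesis by (simp add: clifford_coeff_def divide_simps)
  next
    case (Suc j)
    have "(n + 1) * clifford_coeff (Suc n) (Suc j) + clifford_coeff (Suc (Suc n)) j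
        = clifford_coeff n (Suc j)"
      by (simp add: clifford_coeff_def divide_simps)
    hence "((n + 1) * clifford_coeff (Suc n) (Suc j) + clifford_coeff (Suc (Suc n)) j) * s ^ Suc j
        = clifford_coeff n (Suc j) * s ^ Suc j" by simp
    thus ?thesis using Suc by (simp add: algebra_simps)
  qed
  ultimately show ?thesis
    unfolding clifford_alt[of n s] by (simp add: sums_iff)
qed

lemma clifford_pos_of_nonneg:
  assumes "s \<ge> 0" shows "clifford n s > 0"
proof -
  have "clifford n s \<ge> (\<Sum>k<1. clifford_coeff n k * s ^ k)"
    unfolding clifford_alt using assms clifford_coeff_pos[of n]
    by (intro sum_le_suminf summable_clifford) (auto simp: less_imp_le)
  thus ?thesis using clifford_coeff_pos[of n 0] by simp
qed

text \<open>For an order that is large compared with \<open>|s|\<close> the constant term dominates: the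
\<open>k\<close>-th term of \<open>n! C\<^sub>n(s)\<close> is at most \<open>(|s| / (n + 1))\<^sup>k \<le> 4\<^sup>-\<^sup>k\<close>. This starts the downward
induction below.\<close>

lemma clifford_near_0:
  assumes "4 * \<bar>s\<bar> \<le> n + 1"
  shows "\<bar>fact n * clifford n s - 1\<bar> \<le> 1 / 3"
proof -
  have fct: "fact n * (n + 1) ^ k \<le> (fact (k + n) :: real)" for k
  proof (induction k)
    case (Suc k)
    have "fact n * (n + 1) ^ Suc k = (n + 1) * (fact n * (n + 1) ^ k :: real)" by (simp add: algebra_simps)
    also have "\<dots> \<le> real (Suc (k + n)) * fact (k + n)"
      using Suc by (intro mult_mono) auto
    finally show ?case by simp
  qed simp
  define a where "a = (\<lambda>k. fact n * (clifford_coeff n (Suc k) * s ^ Suc k))"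
  have "(\<lambda>k. clifford_coeff n (Suc k) * s ^ Suc k) sums (clifford n s - 1 / fact n)"
    using summable_sums[OF summable_clifford[of n s]]
    by (subst sums_Suc_iff) (simp add: clifford_alt clifford_coeff_def)
  hence "a sums (fact n * (clifford n s - 1 / fact n))"
    unfolding a_def by (rule sums_mult)
  hence a: "a sums (fact n * clifford n s - 1)" by (simp add: algebra_simps)
  have bound: "norm (a k) \<le> (1 / 4) ^ Suc k" for k
  proof -
    have "\<bar>s\<bar> ^ Suc k \<le> ((n + 1) / 4) ^ Suc k"
      using assms by (intro power_mono) auto
    have "fact n * clifford_coeff n (Suc k) \<le> 1 / (n + 1) ^ Suc k"
    proof -
      have "fact n * clifford_coeff n (Suc k) \<le> fact n * (1 / fact (Suc k + n))"
        unfolding clifford_coeff_def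
        by (intro mult_left_mono frac_le) (use fact_ge_1[of "Suc k", where 'a = real] in \<open>auto simp del: fact_Suc\<close>)
      also have "\<dots> \<le> 1 / (n + 1) ^ Suc k"
        using fct[of "Suc k"] by (simp add: divide_simps del: fact_Suc power_Suc add_Suc)
      finally show ?thesis .
    qed
    hence "fact n * clifford_coeff n (Suc k) * \<bar>s\<bar> ^ Suc k
        \<le> 1 / (n + 1) ^ Suc k * ((n + 1) / 4) ^ Suc k"
      using \<open>\<bar>s\<bar> ^ Suc k \<le> _\<close> by (intro mult_mono) auto
    also have "\<dots> = (1 / 4) ^ Suc k"
      by (simp add: power_divide del: power_Suc)
    finally show ?thesis using clifford_coeff_pos[of n "Suc k"]
      by (simp add: a_def abs_mult power_abs algebra_simps del: power_Suc)
  qed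
  have g: "(\<lambda>k. (1 / 4 :: real) ^ Suc k) sums (1 / 3)"
    using sums_mult[OF geometric_sums[of "1/4 :: real"], of "1/4"] by simp
  have "norm (suminf a) \<le> (\<Sum>k. (1 / 4) ^ Suc k)"
    using bound g by (intro norm_suminf_le) (auto simp: sums_iff)
  thus ?thesis using a g by (simp add: sums_iff)
qed

text \<open>The bound \<open>C\<^sub>k\<^sub>+\<^sub>1 / C\<^sub>k \<le> 2 / (k + 1)\<close> passes from \<open>k + 1\<close> to \<open>k\<close> in the recurrence
\<open>C\<^sub>k = (k + 1) C\<^sub>k\<^sub>+\<^sub>1 - t C\<^sub>k\<^sub>+\<^sub>2\<close> because \<open>4 t \<le> (k + 1)\<^sup>2\<close>. In terms of Bessel functions:
\<open>J\<^sub>n\<close> has no zero in \<open>(0, n + 1]\<close>.\<close>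

lemma clifford_pos_ratio:
  assumes "0 \<le> t" "4 * t \<le> (real n + 1)\<^sup>2"
  shows "clifford n (- t) > 0 \<and> (n + 1) * clifford (Suc n) (- t) \<le> 2 * clifford n (- t)"
proof -
  \<comment> \<open>From this order on, \<open>C\<^sub>N(-t)\<close> is within a third of \<open>1 / N!\<close>, relatively.\<close>
  define N where "N = n + nat \<lceil>4 * t\<rceil>"
  have "n \<le> N" and N: "4 * t \<le> N" unfolding N_def by linarith+
  have "clifford N (- t) > 0 \<and> (N + 1) * clifford (Suc N) (- t) \<le> 2 * clifford N (- t)"
  proof -
    have "\<bar>fact N * clifford N (- t) - 1\<bar> \<le> 1 / 3" "\<bar>fact (Suc N) * clifford (Suc N) (- t) - 1\<bar> \<le> 1 / 3"
      using N assms by (intro clifford_near_0; simp)+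
    hence *: "fact N * clifford N (- t) \<ge> 2 / 3" "fact N * ((N + 1) * clifford (Suc N) (- t)) \<le> 4 / 3"
      by (simp_all only: abs_le_iff fact_Suc of_nat_mult of_nat_Suc, simp_all add: algebra_simps)
    hence "fact N * ((N + 1) * clifford (Suc N) (- t)) \<le> fact N * (2 * clifford N (- t))"
      by linarith
    moreover have "fact N * clifford N (- t) > 0" using * by linarith
    ultimately show ?thesis
      by (simp add: zero_less_mult_iff)
  qed
  note large = this
  show ?thesis using \<open>n \<le> N\<close>
  proof (induction rule: inc_induct)
    case base
    show ?case using large by (simp add: add_ac)
  next
    case (step k)
    have "4 * t \<le> (real k + 1)\<^sup>2"
      using assms(2) power_mono[of "real n + 1" "real k + 1" 2] \<open>n \<le> k\<close> by linarith
    define x where "x = clifford (Suc k) (- t)"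
    define y where "y = clifford (Suc (Suc k)) (- t)"
    have "x > 0" and y: "(k + 2) * y \<le> 2 * x"
      using step.IH by (auto simp: x_def y_def add_ac)
    have "t * y * (k + 2) \<le> 2 * t * x" using y \<open>t \<ge> 0\<close>
      using mult_left_mono[OF y \<open>t \<ge> 0\<close>] by (simp add: algebra_simps)
    also have "\<dots> \<le> (real k + 1)\<^sup>2 / 2 * x"
      using \<open>4 * t \<le> (real k + 1)\<^sup>2\<close> \<open>x > 0\<close> by (intro mult_right_mono) auto
    also have "\<dots> \<le> (k + 1) / 2 * x * (k + 2)"
      using \<open>x > 0\<close> by (simp add: power2_eq_square algebra_simps)
    finally have "t * y \<le> (k + 1) / 2 * x" by simp
    moreover have "clifford k (- t) = (k + 1) * x - t * y"
      using clifford_recurrence[of k "- t"] by (simp add: x_def y_def)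
    ultimately have "clifford k (- t) \<ge> (k + 1) / 2 * x" by (simp add: field_simps)
    moreover have "(k + 1) / 2 * x > 0" using \<open>x > 0\<close> by simp
    ultimately show ?case unfolding x_def by (auto simp: field_simps)
  qed
qed

text \<open>By the recurrence, \<open>D = C\<^sub>n\<^sub>+\<^sub>1\<^sup>2 - C\<^sub>n C\<^sub>n\<^sub>+\<^sub>2\<close> satisfies
\<open>(s\<^sup>n\<^sup>+\<^sup>2 D(s))' = s\<^sup>n\<^sup>+\<^sup>1 C\<^sub>n\<^sub>+\<^sub>1(s)\<^sup>2\<close>. Moving along \<open>x \<mapsto> x s\<close> for
\<open>0 \<le> x \<le> 1\<close> treats both signs of \<open>s\<close> at once.\<close>

lemma clifford_turan: "clifford n s * clifford (Suc (Suc n)) s \<le> (clifford (Suc n) s)\<^sup>2"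
proof -
  define C where "C = (\<lambda>k x. clifford k (x * s))"
  define K where "K = (\<lambda>x. x ^ (n + 2) * ((C (Suc n) x)\<^sup>2 - C n x * C (Suc (Suc n)) x))"
  have C: "(C k has_real_derivative s * C (Suc k) x) (at x)" for k x
    unfolding C_def
    by (rule DERIV_chain2[OF clifford_has_derivative, THEN DERIV_cong])
       (auto intro!: derivative_eq_intros)
  have "\<exists>y. (K has_real_derivative y) (at x) \<and> y \<ge> 0" if "x \<ge> 0" for x
  proof -
    define c0 c1 c2 c3 where
      "c0 = C n x" "c1 = C (Suc n) x" "c2 = C (Suc (Suc n)) x" "c3 = C (Suc (Suc (Suc n))) x"
    have 0: "c0 = (real n + 1) * c1 + x * s * c2"
      using clifford_recurrence[of n "x * s"] by (simp add: C_def c0_c1_c2_c3_def)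
    have 1: "x * s * c3 = c1 - (real n + 2) * c2"
      using clifford_recurrence[of "Suc n" "x * s"] by (simp add: C_def c0_c1_c2_c3_def)
    have "((\<lambda>x. x ^ (n + 2)) has_real_derivative (n + 2) * x ^ (n + 1)) (at x)"
      using DERIV_pow[of "n + 2" x] by simp
    moreover have "((\<lambda>x. (C (Suc n) x)\<^sup>2 - C n x * C (Suc (Suc n)) x) has_real_derivative
        2 * c1 * (s * c2) - (s * c1 * c2 + c0 * (s * c3))) (at x)"
      unfolding c0_c1_c2_c3_def
      by (rule DERIV_diff[OF DERIV_power[OF C] DERIV_mult[OF C C], THEN DERIV_cong])
         (simp add: algebra_simps)
    ultimately have "(K has_real_derivative (n + 2) * x ^ (n + 1) * (c1\<^sup>2 - c0 * c2)
        + (2 * c1 * (s * c2) - (s * c1 * c2 + c0 * (s * c3))) * x ^ (n + 2)) (at x)"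
      unfolding K_def c0_c1_c2_c3_def by (rule DERIV_mult)
    also have "(n + 2) * x ^ (n + 1) * (c1\<^sup>2 - c0 * c2)
        + (2 * c1 * (s * c2) - (s * c1 * c2 + c0 * (s * c3))) * x ^ (n + 2)
        = x ^ (n + 1) * ((real n + 2) * (c1\<^sup>2 - c0 * c2) + (x * s * c1 * c2 - c0 * (x * s * c3)))"
      by (simp add: algebra_simps)
    also have "(real n + 2) * (c1\<^sup>2 - c0 * c2) + (x * s * c1 * c2 - c0 * (x * s * c3)) = c1\<^sup>2"
      unfolding 1 unfolding 0 by (simp add: algebra_simps power2_eq_square)
    finally show ?thesis using that by auto
  qed
  note K_increasing = this
  have "K 0 \<le> K 1"
  proof (rule DERIV_nonneg_imp_nondecreasing[of 0 1 K])
    show "\<exists>y. (K has_real_derivative y) (at x) \<and> y \<ge> 0" if "0 \<le> x" "x \<le> 1" for x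
      using that(1) by (rule K_increasing)
  qed simp
  thus ?thesis by (simp add: K_def C_def)
qed

section \<open>Ratios of consecutive orders\<close>

definition cratio :: "nat \<Rightarrow> real \<Rightarrow> real" where
  "cratio n s = clifford (Suc n) s / clifford n s"

lemma cratio_recurrence:
  assumes "clifford (Suc n) s > 0"
  shows "clifford n s = clifford (Suc n) s * (real n + 1 + s * cratio (Suc n) s)"
  using clifford_recurrence[of n s] assms by (simp add: cratio_def field_simps)

lemma cratio_eq:
  assumes "clifford (Suc n) s > 0" "clifford n s > 0"
  shows "real n + 1 + s * cratio (Suc n) s > 0" "cratio n s = 1 / (real n + 1 + s * cratio (Suc n) s)"
proof -
  show "real n + 1 + s * cratio (Suc n) s > 0"
    using cratio_recurrence[OF assms(1)] assms by (metis zero_less_mult_pos)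
  thus "cratio n s = 1 / (real n + 1 + s * cratio (Suc n) s)"
    using assms unfolding cratio_def[of n] by (subst cratio_recurrence[OF assms(1)]) simp
qed

lemma clifford_quotient_mono:
  assumes "x \<le> y" and "\<And>s. s \<in> {x..y} \<Longrightarrow> clifford (Suc n) s > 0"
  shows "clifford n x / clifford (Suc n) x \<le> clifford n y / clifford (Suc n) y"
proof (rule DERIV_nonneg_imp_nondecreasing[of x y "\<lambda>s. clifford n s / clifford (Suc n) s"])
  fix s assume "x \<le> s" "s \<le> y"
  hence pos: "clifford (Suc n) s > 0" using assms by simp
  have "((\<lambda>s. clifford n s / clifford (Suc n) s) has_real_derivative
     (clifford (Suc n) s * clifford (Suc n) s - clifford n s * clifford (Suc (Suc n)) s)
       / (clifford (Suc n) s * clifford (Suc n) s)) (at s)"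
    using pos by (intro DERIV_divide clifford_has_derivative) simp
  moreover have "(clifford (Suc n) s * clifford (Suc n) s - clifford n s * clifford (Suc (Suc n)) s)
       / (clifford (Suc n) s * clifford (Suc n) s) \<ge> 0"
    using clifford_turan[of n s] by (intro divide_nonneg_nonneg) (auto simp: power2_eq_square)
  ultimately show "\<exists>y. ((\<lambda>s. clifford n s / clifford (Suc n) s) has_real_derivative y) (at s) \<and> 0 \<le> y"
    by blast
qed (use assms in simp)

lemma cratio_antimono:
  assumes "x \<le> y" and "\<And>s. s \<in> {x..y} \<Longrightarrow> clifford n s > 0"
  shows "cratio n y \<le> cratio n x"
proof (rule DERIV_nonpos_imp_nonincreasing[of x y "cratio n"])
  fix s assume "x \<le> s" "s \<le> y"
  hence pos: "clifford n s > 0" using assms by simp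
  have "((\<lambda>s. clifford (Suc n) s / clifford n s) has_real_derivative
     (clifford (Suc (Suc n)) s * clifford n s - clifford (Suc n) s * clifford (Suc n) s)
       / (clifford n s * clifford n s)) (at s)"
    using pos by (intro DERIV_divide clifford_has_derivative) simp
  moreover have "(clifford (Suc (Suc n)) s * clifford n s - clifford (Suc n) s * clifford (Suc n) s)
       / (clifford n s * clifford n s) \<le> 0"
    using clifford_turan[of n s]
    by (intro divide_nonpos_nonneg) (auto simp: power2_eq_square mult.commute)
  ultimately show "\<exists>y. (cratio n has_real_derivative y) (at s) \<and> y \<le> 0"
    unfolding cratio_def[abs_def] by blast
qed (use assms in simp)

text \<open>The product \<open>s r\<^sub>n\<^sub>+\<^sub>1(s)\<close> is \<open>C\<^sub>n(s) / C\<^sub>n\<^sub>+\<^sub>1(s) - (n + 1)\<close>, and that quotient is nondecreasing.\<close>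

lemma cratio_mult_mono:
  assumes "0 \<le> p" "p \<le> q"
  shows "p * cratio (Suc n) p \<le> q * cratio (Suc n) q"
proof -
  have *: "clifford n s / clifford (Suc n) s = real n + 1 + s * cratio (Suc n) s" if "s \<ge> 0" for s
    using cratio_recurrence[of n s] clifford_pos_of_nonneg[OF that, of "Suc n"]
    by (simp add: field_simps)
  have "clifford n p / clifford (Suc n) p \<le> clifford n q / clifford (Suc n) q"
    using assms by (intro clifford_quotient_mono clifford_pos_of_nonneg) auto
  thus ?thesis using assms by (simp add: *)
qed

section \<open>The frequency function\<close>

text \<open>Up to a positive factor, \<open>freq 3 p p\<close> at \<open>p = x\<^sup>2 / 4\<close> is the cross product
\<open>J\<^sub>3 I\<^sub>3' - I\<^sub>3 J\<^sub>3'\<close> at \<open>x\<close> that defines \<open>\<lambda>\<^sub>3\<^sub>1\<close>. Off the diagonal it is the determinant whose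
zeros are the eigenvalues; see \<open>mode_solution_trivial\<close>.\<close>

definition freq :: "nat \<Rightarrow> real \<Rightarrow> real \<Rightarrow> real" where
  "freq n p q = clifford (Suc n) (- p) * clifford n q + clifford n (- p) * clifford (Suc n) q"

text \<open>The diagonal value \<open>freq n p p\<close> has the sign of \<open>2 (n + 1) - gap n p\<close>.\<close>

definition gap :: "nat \<Rightarrow> real \<Rightarrow> real" where
  "gap n p = p * (cratio (Suc n) (- p) - cratio (Suc n) p)"

lemma freq_eq:
  assumes "clifford (Suc n) (- p) > 0" "q \<ge> 0"
  shows "freq n p q = clifford (Suc n) (- p) * clifford (Suc n) q *
    (2 * (real n + 1) - p * cratio (Suc n) (- p) + q * cratio (Suc n) q)"
proof -
  have "clifford n (- p) = clifford (Suc n) (- p) * (real n + 1 + (- p) * cratio (Suc n) (- p))"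
    using assms by (intro cratio_recurrence) auto
  moreover have "clifford n q = clifford (Suc n) q * (real n + 1 + q * cratio (Suc n) q)"
    using assms clifford_pos_of_nonneg by (intro cratio_recurrence) auto
  ultimately have "freq n p q =
      clifford (Suc n) (- p) * (clifford (Suc n) q * (real n + 1 + q * cratio (Suc n) q))
      + clifford (Suc n) (- p) * (real n + 1 + (- p) * cratio (Suc n) (- p)) * clifford (Suc n) q"
    unfolding freq_def by simp
  thus ?thesis by (simp add: algebra_simps)
qed

lemma freq_diagonal_eq:
  assumes "clifford (Suc n) (- p) > 0" "p \<ge> 0"
  shows "freq n p p = clifford (Suc n) (- p) * clifford (Suc n) p * (2 * (real n + 1) - gap n p)"
  using assms by (simp add: freq_eq gap_def algebra_simps)

text \<open>Increasing \<open>q\<close> above \<open>p\<close> only helps, since \<open>q r\<^sub>n\<^sub>+\<^sub>1(q)\<close> is nondecreasing; so the diagonal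
condition suffices.\<close>

lemma freq_pos:
  assumes "clifford (Suc n) (- p) > 0" "0 \<le> p" "p \<le> q" "gap n p < 2 * (real n + 1)"
  shows "freq n p q > 0"
proof -
  have "2 * (real n + 1) - p * cratio (Suc n) (- p) + q * cratio (Suc n) q > 0"
    using cratio_mult_mono[OF assms(2,3), of n] assms(4) by (simp add: gap_def algebra_simps)
  thus ?thesis
    using assms clifford_pos_of_nonneg[of q "Suc n"] by (subst freq_eq) auto
qed

lemma freq_pos_of_nonpos:
  assumes "p \<le> 0" "q \<ge> 0"
  shows "freq n p q > 0"
  using assms clifford_pos_of_nonneg unfolding freq_def
  by (intro add_pos_pos mult_pos_pos) auto

text \<open>The factor \<open>r\<^sub>n\<^sub>+\<^sub>1(-x) - r\<^sub>n\<^sub>+\<^sub>1(x)\<close> of \<open>x\<close> in the gap is nondecreasing, as \<open>r\<^sub>n\<^sub>+\<^sub>1\<close> is nonincreasing.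
The gap therefore crosses a positive level at most once.\<close>

lemma gap_superlinear:
  assumes "0 \<le> x" "x \<le> y" and "\<And>s. s \<ge> - y \<Longrightarrow> clifford (Suc n) s > 0"
  shows "y * gap n x \<le> x * gap n y"
proof -
  have "cratio (Suc n) (- x) \<le> cratio (Suc n) (- y)"
    using assms by (intro cratio_antimono) auto
  moreover have "cratio (Suc n) y \<le> cratio (Suc n) x"
    using assms by (intro cratio_antimono) auto
  ultimately have "cratio (Suc n) (- x) - cratio (Suc n) x \<le> cratio (Suc n) (- y) - cratio (Suc n) y"
    by linarith
  hence "x * y * (cratio (Suc n) (- x) - cratio (Suc n) x) \<le> x * y * (cratio (Suc n) (- y) - cratio (Suc n) y)"
    using assms by (intro mult_left_mono) auto
  thus ?thesis by (simp add: gap_def mult_ac)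
qed

section \<open>Continued fraction bounds\<close>

text \<open>Iterating \<open>r\<^sub>n(s) = 1 / (n + 1 + s r\<^sub>n\<^sub>+\<^sub>1(s))\<close> \<open>k\<close> times, with \<open>x\<close> in place of
\<open>r\<^sub>n\<^sub>+\<^sub>k(s)\<close>.\<close>

fun cfrac :: "nat \<Rightarrow> real \<Rightarrow> real \<Rightarrow> nat \<Rightarrow> real" where
  "cfrac n s x 0 = x"
| "cfrac n s x (Suc k) = 1 / (real n + 1 + s * cfrac (Suc n) s x k)"

lemma cfrac_numeral [simp]:
  "cfrac n s x (numeral k) = 1 / (real n + 1 + s * cfrac (Suc n) s x (pred_numeral k))"
  by (simp add: numeral_eq_Suc)

fun cfrac_pos :: "nat \<Rightarrow> real \<Rightarrow> real \<Rightarrow> nat \<Rightarrow> bool" where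
  "cfrac_pos n s x 0 \<longleftrightarrow> True"
| "cfrac_pos n s x (Suc k) \<longleftrightarrow> real n + 1 + s * cfrac (Suc n) s x k > 0 \<and> cfrac_pos (Suc n) s x k"

lemma cfrac_pos_numeral [simp]:
  "cfrac_pos n s x (numeral k) \<longleftrightarrow>
     real n + 1 + s * cfrac (Suc n) s x (pred_numeral k) > 0 \<and> cfrac_pos (Suc n) s x (pred_numeral k)"
  by (simp add: numeral_eq_Suc)

text \<open>One evaluation of the continued fraction at the right end point \<open>T\<close> serves all
\<open>t \<le> T\<close>: the iteration is monotone in \<open>t\<close> as well as in the tail, and the tail
\<open>2 / (n + k + 1)\<close> is admissible by \<open>clifford_pos_ratio\<close>. The positive denominators
carry the positivity of \<open>C\<^sub>j\<close> down to \<open>j = n\<close>.\<close>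

lemma cratio_upper:
  assumes "4 * T \<le> (real (n + k) + 1)\<^sup>2" "x = 2 / (real (n + k) + 1)" "cfrac_pos n (- T) x k"
    and "0 \<le> t" "t \<le> T"
  shows "(\<forall>j\<ge>n. clifford j (- t) > 0) \<and> cratio n (- t) \<le> cfrac n (- T) x k"
  using assms
proof (induction k arbitrary: n)
  case 0
  have *: "4 * t \<le> (real j + 1)\<^sup>2" if "j \<ge> n" for j
  proof -
    have "(real n + 1)\<^sup>2 \<le> (real j + 1)\<^sup>2" using that by (intro power_mono) auto
    moreover have "4 * T \<le> (real n + 1)\<^sup>2" "t \<le> T" using 0 by simp_all
    ultimately show ?thesis by linarith
  qed
  have pos: "clifford j (- t) > 0" if "j \<ge> n" for j
    using clifford_pos_ratio[of t j] *[OF that] 0 by simp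
  have "(real n + 1) * clifford (Suc n) (- t) \<le> 2 * clifford n (- t)"
    using clifford_pos_ratio[of t n] *[of n] 0 by simp
  hence "cratio n (- t) \<le> 2 / (real n + 1)"
    using pos[of n] by (simp add: cratio_def field_simps)
  thus ?case using pos 0 by simp
next
  case (Suc k)
  define u where "u = cfrac (Suc n) (- T) x k"
  have IH: "\<forall>j\<ge>Suc n. clifford j (- t) > 0" "cratio (Suc n) (- t) \<le> u" and u: "real n + 1 - T * u > 0"
    using Suc.IH[of "Suc n"] Suc.prems by (auto simp: u_def)
  hence pos': "clifford (Suc n) (- t) > 0" "cratio (Suc n) (- t) > 0" by (auto simp: cratio_def)
  hence "t * cratio (Suc n) (- t) \<le> T * u"
    using IH Suc.prems by (intro mult_mono) auto
  hence *: "real n + 1 - t * cratio (Suc n) (- t) \<ge> real n + 1 - T * u" by simp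
  have "clifford n (- t) = clifford (Suc n) (- t) * (real n + 1 + (- t) * cratio (Suc n) (- t))"
    by (rule cratio_recurrence) (use pos' in auto)
  also have "\<dots> > 0" using * u pos' by (intro mult_pos_pos) auto
  finally have pos: "clifford n (- t) > 0" .
  moreover have "clifford j (- t) > 0" if "j \<ge> n" for j
    using IH pos that by (cases "j = n") auto
  moreover have "cratio n (- t) \<le> 1 / (real n + 1 - T * u)"
    using cratio_eq(2)[OF pos'(1) pos] * u by (simp add: frac_le)
  ultimately show ?case by (simp add: u_def)
qed

text \<open>At a negative argument each step of the iteration is increasing in the tail, so the
tail \<open>0\<close> gives lower bounds.\<close>

lemma cratio_lower:
  assumes "\<forall>j\<ge>n. clifford j (- t) > 0" "0 \<le> t"
  shows "cfrac n (- t) 0 k \<le> cratio n (- t)"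
  using assms
proof (induction k arbitrary: n)
  case 0
  thus ?case by (simp add: cratio_def less_imp_le)
next
  case (Suc k)
  have IH: "cfrac (Suc n) (- t) 0 k \<le> cratio (Suc n) (- t)"
    using Suc.prems by (intro Suc.IH) auto
  have pos: "clifford (Suc n) (- t) > 0" "clifford n (- t) > 0" using Suc.prems by auto
  have "t * cfrac (Suc n) (- t) 0 k \<le> t * cratio (Suc n) (- t)"
    using IH Suc.prems by (intro mult_left_mono) auto
  thus ?case using cratio_eq[OF pos] by (simp add: frac_le)
qed

text \<open>At a nonnegative argument each step is decreasing in the tail, so the convergents
lie alternately below and above the ratio.\<close>

lemma cratio_convergents:
  assumes "s \<ge> 0"
  shows "cfrac n s 0 k \<ge> 0 \<and> (if even k then cfrac n s 0 k \<le> cratio n s else cratio n s \<le> cfrac n s 0 k)"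
proof (induction k arbitrary: n)
  case 0
  show ?case using clifford_pos_of_nonneg[OF assms] by (simp add: cratio_def less_imp_le)
next
  case (Suc k)
  define c r where "c = cfrac (Suc n) s 0 k" and "r = cratio (Suc n) s"
  have "r > 0" unfolding r_def cratio_def using clifford_pos_of_nonneg[OF assms] by simp
  have c: "c \<ge> 0" "if even k then c \<le> r else r \<le> c" using Suc[of "Suc n"] by (auto simp: c_def r_def)
  have "if even k then s * c \<le> s * r else s * r \<le> s * c"
    using c assms by (auto intro: mult_left_mono split: if_splits)
  moreover have "s * c \<ge> 0" "s * r \<ge> 0" using c assms \<open>r > 0\<close> by auto
  moreover have "cratio n s = 1 / (real n + 1 + s * r)"
    unfolding r_def using clifford_pos_of_nonneg[OF assms] by (intro cratio_eq)
  ultimately show ?case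
    by (auto simp: c_def[symmetric] intro!: divide_left_mono mult_pos_pos split: if_splits)
qed

lemma clifford_pos_above:
  assumes "\<And>t. 0 \<le> t \<Longrightarrow> t \<le> T \<Longrightarrow> clifford n (- t) > 0" "s \<ge> - T"
  shows "clifford n s > 0"
  using assms(1)[of "- s"] assms(2) clifford_pos_of_nonneg[of s n] by (cases "s \<ge> 0") auto

section \<open>The critical parameter of wavenumber 3\<close>

text \<open>The constant \<open>12.7585\<close> is an upper bound for \<open>tcrit\<close>, see \<open>gap3_hi\<close>. The first zero of
\<open>C\<^sub>4(-t)\<close> is \<open>t = j\<^sub>4\<^sub>,\<^sub>1\<^sup>2 / 4 \<approx> 14.39\<close>.\<close>

lemma clifford4_pos:
  assumes "s \<ge> - 12.7585" "j \<ge> 4"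
  shows "clifford j s > 0"
proof (rule clifford_pos_above)
  fix t :: real assume "0 \<le> t" "t \<le> 12.7585"
  thus "clifford j (- t) > 0"
    using cratio_upper[of "12.7585" 4 4 "2 / 9" t] \<open>j \<ge> 4\<close> by simp
qed (use assms in simp)

text \<open>The point \<open>15\<close> lies between the first zeros of \<open>C\<^sub>4(-t)\<close> and of \<open>C\<^sub>5(-t)\<close>, which are about
\<open>14.39\<close> and \<open>19.23\<close>. It is used as a point where \<open>freq 3\<close> is negative whatever \<open>q\<close> is.\<close>

lemma clifford5_pos:
  assumes "s \<ge> - 15" "j \<ge> 5"
  shows "clifford j s > 0"
proof (rule clifford_pos_above)
  fix t :: real assume "0 \<le> t" "t \<le> 15"
  thus "clifford j (- t) > 0"
    using cratio_upper[of 15 5 4 "2 / 10" t] \<open>j \<ge> 5\<close> by simp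
qed (use assms in simp)

lemma clifford4_neg: "clifford 4 (- 15) < 0"
proof -
  have "cfrac 5 (- 15) 0 8 \<le> cratio 5 (- 15)"
    using clifford5_pos by (intro cratio_lower) auto
  hence "5 - 15 * cratio 5 (- 15) < 0" by simp
  moreover have "clifford 4 (- 15) = clifford 5 (- 15) * (5 - 15 * cratio 5 (- 15))"
    using cratio_recurrence[of 4 "- 15"] clifford5_pos[of "- 15" 5] by simp
  ultimately show ?thesis using clifford5_pos[of "- 15" 5] by (simp add: mult_less_0_iff)
qed

text \<open>The root \<open>tcrit \<approx> 12.7575\<close> has to be located so well that \<open>sqrt (4 tcrit / 3)\<close> is
known up to \<open>0.0005\<close>; this is the reason for the end points \<open>12.753\<close> and \<open>12.7585\<close>.\<close>

lemma gap3_lo: "gap 3 12.753 < 8"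
proof -
  have "cratio 4 (- 12.753) \<le> cfrac 4 (- 12.753) (2 / 15) 10"
    by (rule cratio_upper[THEN conjunct2]) simp_all
  moreover have "cfrac 4 12.753 0 12 \<le> cratio 4 12.753"
    using cratio_convergents[of "12.753" 4 12] by simp
  moreover have "12.753 * (cfrac 4 (- 12.753) (2 / 15) 10 - cfrac 4 12.753 0 12) < 8"
    by simp
  ultimately show ?thesis by (simp add: gap_def del: cfrac_numeral)
qed

lemma gap3_hi: "gap 3 12.7585 > 8"
proof -
  have "cratio 4 (- 12.7585) \<ge> cfrac 4 (- 12.7585) 0 12"
    using clifford4_pos by (intro cratio_lower) auto
  moreover have "cratio 4 12.7585 \<le> cfrac 4 12.7585 0 13"
    using cratio_convergents[of "12.7585" 4 13] by simp
  moreover have "12.7585 * (cfrac 4 (- 12.7585) 0 12 - cfrac 4 12.7585 0 13) > 8"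
    by simp
  ultimately show ?thesis by (simp add: gap_def del: cfrac_numeral)
qed

lemma gap_continuous:
  assumes "0 \<le> x" "\<And>s. s \<ge> - y \<Longrightarrow> clifford (Suc n) s > 0"
  shows "continuous_on {x..y} (gap n)"
proof -
  have "clifford (Suc n) s \<noteq> 0" "clifford (Suc n) (- s) \<noteq> 0" if "s \<in> {x..y}" for s
    using assms(2)[of s] assms(2)[of "- s"] that assms(1) by auto
  thus ?thesis unfolding gap_def[abs_def] cratio_def
    by (intro continuous_intros) auto
qed

lemma gap3_root: "\<exists>t. 12.753 \<le> t \<and> t \<le> 12.7585 \<and> gap 3 t = 8"
proof -
  have "\<exists>t\<ge>12.753. t \<le> 12.7585 \<and> gap 3 t = 8"
    using gap3_lo gap3_hi clifford4_pos by (intro IVT' gap_continuous) auto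
  thus ?thesis by blast
qed

text \<open>By \<open>gap_superlinear\<close> the choice is unique; \<open>lambda_31_eq\<close> identifies it as \<open>\<lambda>\<^sub>3\<^sub>1 / 4\<close>.\<close>

definition tcrit :: real where "tcrit = (SOME t. 12.753 \<le> t \<and> t \<le> 12.7585 \<and> gap 3 t = 8)"

lemma tcrit_bounds: "12.753 \<le> tcrit" "tcrit \<le> 12.7585" and gap_tcrit: "gap 3 tcrit = 8"
  using someI_ex[OF gap3_root] unfolding tcrit_def[symmetric] by auto

lemma freq3_pos:
  assumes "0 \<le> p" "p < tcrit" "p \<le> q"
  shows "freq 3 p q > 0"
proof -
  have "tcrit * gap 3 p \<le> p * gap 3 tcrit"
    using assms tcrit_bounds clifford4_pos[of _ 4] by (intro gap_superlinear) auto
  also have "\<dots> < tcrit * 8" using assms gap_tcrit by simp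
  finally have "gap 3 p < 8" using tcrit_bounds by simp
  thus ?thesis using assms tcrit_bounds clifford4_pos[of _ 4] by (intro freq_pos) auto
qed

lemma freq3_tcrit: "freq 3 tcrit tcrit = 0"
  using gap_tcrit tcrit_bounds clifford4_pos[of _ 4] by (subst freq_diagonal_eq) auto

text \<open>Once \<open>C\<^sub>4(-p) \<le> 0\<close>, the recurrence \<open>C\<^sub>3(-p) = 4 C\<^sub>4(-p) - p C\<^sub>5(-p)\<close> makes both
terms of the determinant nonpositive.\<close>

lemma freq3_neg_of_clifford4_nonpos:
  assumes "0 < p" "p \<le> 15" "q \<ge> 0" "clifford 4 (- p) \<le> 0"
  shows "freq 3 p q < 0"
proof -
  have "clifford 3 (- p) = 4 * clifford 4 (- p) - p * clifford 5 (- p)"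
    using clifford_recurrence[of 3 "- p"] by simp
  moreover have "p * clifford 5 (- p) > 0" using assms clifford5_pos[of "- p" 5] by simp
  ultimately have "clifford 3 (- p) < 0" using assms by linarith
  hence "clifford 3 (- p) * clifford 4 q < 0"
    using assms clifford_pos_of_nonneg by (intro mult_neg_pos) auto
  moreover have "clifford 4 (- p) * clifford 3 q \<le> 0"
    using assms clifford_pos_of_nonneg[of q 3] by (intro mult_nonpos_nonneg) auto
  ultimately show ?thesis by (simp add: freq_def)
qed

lemma freq3_15_neg: "q \<ge> 0 \<Longrightarrow> freq 3 15 q < 0"
  using freq3_neg_of_clifford4_nonpos[of 15 q] clifford4_neg by simp

text \<open>Either \<open>C\<^sub>4(-p) \<le> 0\<close>, or \<open>C\<^sub>4\<close> is positive on all of \<open>[-p, \<infinity>)\<close> because \<open>C\<^sub>4 / C\<^sub>5\<close> is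
increasing there, and the gap has crossed the level \<open>8\<close> at \<open>tcrit\<close>.\<close>

lemma freq3_diagonal_neg:
  assumes "tcrit < p" "p \<le> 15"
  shows "freq 3 p p < 0"
proof (cases "clifford 4 (- p) > 0")
  case False
  thus ?thesis using assms tcrit_bounds by (intro freq3_neg_of_clifford4_nonpos) auto
next
  case True
  have pos: "clifford 4 s > 0" if "s \<ge> - p" for s
  proof (cases "s \<ge> 0")
    case s: False
    have "clifford 4 (- p) / clifford 5 (- p) \<le> clifford 4 s / clifford 5 s"
      using clifford_quotient_mono[of "- p" s 4] that s assms clifford5_pos[of _ 5] by simp
    moreover have "clifford 5 (- p) > 0" "clifford 5 s > 0"
      using that s assms clifford5_pos[of _ 5] by auto
    moreover have "0 < clifford 4 (- p) / clifford 5 (- p)"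
      using True calculation(2) by simp
    ultimately have "0 < clifford 4 s / clifford 5 s" by linarith
    thus ?thesis using \<open>clifford 5 s > 0\<close> by (simp add: zero_less_divide_iff)
  qed (rule clifford_pos_of_nonneg)
  have "p * gap 3 tcrit \<le> tcrit * gap 3 p"
    using assms tcrit_bounds pos by (intro gap_superlinear) auto
  moreover have "tcrit * 8 < p * 8" using assms by simp
  ultimately have "tcrit * 8 < tcrit * gap 3 p" by (simp add: gap_tcrit)
  hence "gap 3 p > 8" using tcrit_bounds by simp
  moreover have "clifford 4 (- p) * clifford 4 p > 0"
    using pos[of "- p"] pos[of p] assms tcrit_bounds by simp
  ultimately show ?thesis using True assms tcrit_bounds
    by (subst freq_diagonal_eq) (auto simp: mult_less_0_iff)
qed

section \<open>The other wavenumbers\<close>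

lemma gap_less_of_bounds:
  assumes pos: "\<And>t. 0 \<le> t \<Longrightarrow> t \<le> T \<Longrightarrow> clifford (Suc n) (- t) > 0 \<and> cratio (Suc n) (- t) \<le> u"
    and l: "l \<le> cratio (Suc n) T" and c: "T * (u - l) < c" and "0 \<le> p" "p \<le> T" "l \<le> u"
  shows "gap n p < c"
proof -
  have "cratio (Suc n) T \<le> cratio (Suc n) p"
    using \<open>0 \<le> p\<close> \<open>p \<le> T\<close> clifford_pos_of_nonneg by (intro cratio_antimono) auto
  hence "gap n p \<le> p * (u - l)" unfolding gap_def
    using pos[OF \<open>0 \<le> p\<close> \<open>p \<le> T\<close>] l \<open>0 \<le> p\<close> by (intro mult_left_mono) auto
  also have "\<dots> \<le> T * (u - l)" using \<open>p \<le> T\<close> \<open>l \<le> u\<close> by (intro mult_right_mono) auto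
  finally show ?thesis using c by simp
qed

text \<open>The constant \<open>4.253\<close> is just above \<open>tcrit / 3 \<le> 12.7585 / 3\<close>. The sharpest cases are \<open>n = 2\<close>
and \<open>n = 4\<close>, whose own thresholds are roughly \<open>8.72\<close> and \<open>17.42\<close>, compared with
\<open>4.253 n = 8.506\<close> and \<open>17.012\<close>.\<close>

lemma clifford_gap_other:
  assumes "n \<noteq> 3" "0 \<le> p" "p \<le> 4.253 * real n"
  shows "clifford (Suc n) (- p) > 0 \<and> gap n p < 2 * (real n + 1)"
proof (cases "n \<ge> 13")
  case True
  \<comment> \<open>For \<open>n \<ge> 13\<close> the bound \<open>r\<^sub>n\<^sub>+\<^sub>1(-p) \<le> 2 / (n + 2)\<close> is enough, together with \<open>r\<^sub>n\<^sub>+\<^sub>1(p) \<ge> 0\<close>.\<close>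
  have T: "4 * (4.253 * real n) \<le> (real (Suc n) + 1)\<^sup>2"
  proof -
    have "(real n - 13) * (real n - 1/2) \<ge> 0" using True by simp
    thus ?thesis using True by (simp add: power2_eq_square algebra_simps)
  qed
  have "clifford (Suc n) (- t) > 0 \<and> cratio (Suc n) (- t) \<le> 2 / (real n + 2)"
    if "0 \<le> t" "t \<le> 4.253 * real n" for t
    using cratio_upper[of "4.253 * real n" "Suc n" 0 "2 / (real n + 2)" t] T that by simp
  moreover have "0 \<le> cratio (Suc n) (4.253 * real n)"
    using clifford_pos_of_nonneg by (simp add: cratio_def less_imp_le)
  moreover have "4.253 * real n * (2 / (real n + 2) - 0) < 2 * (real n + 1)"
  proof -
    have "4.253 * real n < (real n + 1) * (real n + 2)"
      using mult_mono[OF True[folded of_nat_le_iff[where 'a = real]], of "real n" "real n"]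
      by (simp add: algebra_simps)
    thus ?thesis by (simp add: field_simps)
  qed
  ultimately show ?thesis
    using assms gap_less_of_bounds[of "4.253 * real n" n "2 / (real n + 2)" 0 "2 * (real n + 1)" p] by auto
next
  case False
  show ?thesis
  proof (cases "n = 0")
    case True
    thus ?thesis using assms by (simp add: gap_def)
  next
    case n0: False
    \<comment> \<open>Ten steps from above and eight from below decide all remaining cases.\<close>
    define T where "T = 4.253 * real n"
    define u where "u = cfrac (Suc n) (- T) (2 / (real (Suc n + 10) + 1)) 10"
    define l where "l = cfrac (Suc n) T 0 8"
    have "n \<in> {1,2,4,5,6,7,8,9,10,11,12}"
      using False n0 \<open>n \<noteq> 3\<close> by simp presburger
    hence *: "T * (u - l) < 2 * (real n + 1) \<and> l \<le> u \<and> cfrac_pos (Suc n) (- T) (2 / (real (Suc n + 10) + 1)) 10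
         \<and> 4 * T \<le> (real (Suc n + 10) + 1)\<^sup>2"
      unfolding T_def u_def l_def by (elim insertE) simp_all
    have "clifford (Suc n) (- t) > 0 \<and> cratio (Suc n) (- t) \<le> u" if "0 \<le> t" "t \<le> T" for t
      using cratio_upper[of T "Suc n" 10 "2 / (real (Suc n + 10) + 1)" t] * that
      unfolding u_def by blast
    moreover have "l \<le> cratio (Suc n) T"
      using cratio_convergents[of T "Suc n" 8] unfolding l_def T_def by simp
    ultimately show ?thesis
      using gap_less_of_bounds[of T n u l "2 * (real n + 1)" p] assms * unfolding T_def by blast
  qed
qed

section \<open>Bessel functions and the constant \<open>\<lambda>\<^sub>3\<^sub>1\<close>\<close>

lemma bessel_J_eq: "bessel_J k x = (x / 2) ^ k * clifford k (- (x\<^sup>2 / 4))"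
proof -
  have "(- 1) ^ n / (fact n * fact (n + k)) * (x / 2) ^ (2 * n + k)
      = (x / 2) ^ k * (clifford_coeff k n * (- (x\<^sup>2 / 4)) ^ n)" for n
  proof -
    have "(- (x\<^sup>2 / 4)) ^ n = (- 1) ^ n * (x / 2) ^ (2 * n)"
      by (subst power_mult, subst power_mult_distrib[symmetric]) (simp add: power_divide)
    thus ?thesis by (simp add: clifford_coeff_def power_add)
  qed
  thus ?thesis unfolding bessel_J_def clifford_alt
    by (simp add: suminf_mult[OF summable_clifford])
qed

lemma bessel_I_eq: "bessel_I k x = (x / 2) ^ k * clifford k (x\<^sup>2 / 4)"
proof -
  have "1 / (fact n * fact (n + k)) * (x / 2) ^ (2 * n + k)
      = (x / 2) ^ k * (clifford_coeff k n * (x\<^sup>2 / 4) ^ n)" for n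
  proof -
    have "(x\<^sup>2 / 4) ^ n = (x / 2) ^ (2 * n)"
      by (subst power_mult) (simp add: power_divide)
    thus ?thesis by (simp add: clifford_coeff_def power_add)
  qed
  thus ?thesis unfolding bessel_I_def clifford_alt
    by (simp add: suminf_mult[OF summable_clifford])
qed

lemma half_power_deriv:
  "((\<lambda>x::real. (x / 2) ^ Suc k) has_real_derivative (real k + 1) / 2 * (x / 2) ^ k) (at x)"
proof -
  have "((\<lambda>x::real. x / 2) has_real_derivative 1 / 2) (at x)"
    by (auto intro!: derivative_eq_intros)
  from DERIV_power_Suc[OF this, of k] show ?thesis by (simp add: algebra_simps)
qed

lemma bessel_J_deriv:
  "deriv (bessel_J (Suc k)) x =
     (real k + 1) / 2 * (x / 2) ^ k * clifford (Suc k) (- (x\<^sup>2 / 4))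
      - (x / 2) ^ (k + 2) * clifford (Suc (Suc k)) (- (x\<^sup>2 / 4))"
proof (rule DERIV_imp_deriv)
  have "((\<lambda>x. (x / 2) ^ Suc k * clifford (Suc k) (- (x\<^sup>2 / 4))) has_real_derivative
      (real k + 1) / 2 * (x / 2) ^ k * clifford (Suc k) (- (x\<^sup>2 / 4))
      - (x / 2) ^ (k + 2) * clifford (Suc (Suc k)) (- (x\<^sup>2 / 4))) (at x)"
    by (rule DERIV_mult[OF half_power_deriv DERIV_chain2[OF clifford_has_derivative], THEN DERIV_cong])
       (auto intro!: derivative_eq_intros simp: field_simps power2_eq_square)
  thus "(bessel_J (Suc k) has_real_derivative
      (real k + 1) / 2 * (x / 2) ^ k * clifford (Suc k) (- (x\<^sup>2 / 4))
      - (x / 2) ^ (k + 2) * clifford (Suc (Suc k)) (- (x\<^sup>2 / 4))) (at x)"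
    unfolding bessel_J_eq[abs_def] .
qed

lemma bessel_I_deriv:
  "deriv (bessel_I (Suc k)) x =
     (real k + 1) / 2 * (x / 2) ^ k * clifford (Suc k) (x\<^sup>2 / 4)
      + (x / 2) ^ (k + 2) * clifford (Suc (Suc k)) (x\<^sup>2 / 4)"
proof (rule DERIV_imp_deriv)
  have "((\<lambda>x. (x / 2) ^ Suc k * clifford (Suc k) (x\<^sup>2 / 4)) has_real_derivative
      (real k + 1) / 2 * (x / 2) ^ k * clifford (Suc k) (x\<^sup>2 / 4)
      + (x / 2) ^ (k + 2) * clifford (Suc (Suc k)) (x\<^sup>2 / 4)) (at x)"
    by (rule DERIV_mult[OF half_power_deriv DERIV_chain2[OF clifford_has_derivative], THEN DERIV_cong])
       (auto intro!: derivative_eq_intros simp: field_simps power2_eq_square)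
  thus "(bessel_I (Suc k) has_real_derivative
      (real k + 1) / 2 * (x / 2) ^ k * clifford (Suc k) (x\<^sup>2 / 4)
      + (x / 2) ^ (k + 2) * clifford (Suc (Suc k)) (x\<^sup>2 / 4)) (at x)"
    unfolding bessel_I_eq[abs_def] .
qed

text \<open>The terms without a shift of the order cancel in the cross product.\<close>

lemma bessel_cross_product_eq_freq:
  assumes "l > 0"
  shows "bessel_I 3 (sqrt l) * deriv (bessel_J 3) (sqrt l)
       - bessel_J 3 (sqrt l) * deriv (bessel_I 3) (sqrt l) = - ((sqrt l / 2) ^ 7 * freq 3 (l / 4) (l / 4))"
proof -
  have "(sqrt l)\<^sup>2 = l" using assms by simp
  note J = bessel_J_deriv[of 2 "sqrt l", unfolded this] bessel_J_eq[of 3 "sqrt l", unfolded this]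
  note I = bessel_I_deriv[of 2 "sqrt l", unfolded \<open>(sqrt l)\<^sup>2 = l\<close>]
    bessel_I_eq[of 3 "sqrt l", unfolded \<open>(sqrt l)\<^sup>2 = l\<close>]
  define y a b c d where "y = sqrt l / 2" "a = clifford 3 (- (l / 4))" "b = clifford 4 (- (l / 4))"
    "c = clifford 3 (l / 4)" "d = clifford 4 (l / 4)"
  note defs = this
  have "bessel_I 3 (sqrt l) = y ^ 3 * c" "bessel_J 3 (sqrt l) = y ^ 3 * a"
    "deriv (bessel_J 3) (sqrt l) = 3 / 2 * y ^ 2 * a - y ^ 4 * b"
    "deriv (bessel_I 3) (sqrt l) = 3 / 2 * y ^ 2 * c + y ^ 4 * d"
    using J I unfolding defs by (simp_all add: eval_nat_numeral)
  note eqs = this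
  have "bessel_I 3 (sqrt l) * deriv (bessel_J 3) (sqrt l)
       - bessel_J 3 (sqrt l) * deriv (bessel_I 3) (sqrt l)
       = - (y ^ 7) * (b * c + a * d)"
    unfolding eqs by (simp add: algebra_simps eval_nat_numeral)
  thus ?thesis by (simp add: freq_def defs eval_nat_numeral)
qed

lemma lambda_31_eq: "lambda_31 = 4 * tcrit"
  unfolding lambda_31_def
proof (rule Least_equality)
  show "4 * tcrit > 0 \<and> bessel_I 3 (sqrt (4 * tcrit)) * deriv (bessel_J 3) (sqrt (4 * tcrit))
       - bessel_J 3 (sqrt (4 * tcrit)) * deriv (bessel_I 3) (sqrt (4 * tcrit)) = 0"
    using tcrit_bounds freq3_tcrit by (subst bessel_cross_product_eq_freq) auto
next
  fix l :: real
  assume l: "l > 0 \<and> bessel_I 3 (sqrt l) * deriv (bessel_J 3) (sqrt l)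
       - bessel_J 3 (sqrt l) * deriv (bessel_I 3) (sqrt l) = 0"
  hence "freq 3 (l / 4) (l / 4) = 0" using bessel_cross_product_eq_freq[of l] by simp
  hence "\<not> l / 4 < tcrit" using freq3_pos[of "l / 4" "l / 4"] l by auto
  thus "4 * tcrit \<le> l" by simp
qed

section \<open>Differential calculus on the disc\<close>

abbreviation has_partials :: "(real \<times> real \<Rightarrow> complex) \<Rightarrow> complex \<Rightarrow> complex \<Rightarrow> (real \<times> real) filter \<Rightarrow> bool" where
  "has_partials f a b F \<equiv> (f has_derivative (\<lambda>h. fst h *\<^sub>R a + snd h *\<^sub>R b)) F"

lemma has_partials_add:
  assumes "has_partials f a b F" "has_partials g c d F"
  shows "has_partials (\<lambda>p. f p + g p) (a + c) (b + d) F"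
  by (rule has_derivative_eq_rhs[OF has_derivative_add[OF assms]]) (simp add: fun_eq_iff algebra_simps)

lemma has_partials_mult:
  assumes "has_partials f a b (at p within X)" "has_partials g c d (at p within X)"
  shows "has_partials (\<lambda>p. f p * g p) (a * g p + f p * c) (b * g p + f p * d) (at p within X)"
  by (rule has_derivative_eq_rhs[OF has_derivative_mult[OF assms]]) (simp add: fun_eq_iff algebra_simps)

lemma has_partials_const: "has_partials (\<lambda>_. c) 0 0 F"
  by simp

lemma has_partials_cnj:
  assumes "has_partials f a b F"
  shows "has_partials (\<lambda>p. cnj (f p)) (cnj a) (cnj b) F"
  by (rule has_derivative_eq_rhs[OF bounded_linear.has_derivative[OF bounded_linear_cnj assms]])
     (simp add: fun_eq_iff scaleR_conv_of_real)

lemma Ck_disc_SucI: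
  assumes "\<And>p. p \<in> closed_disc \<Longrightarrow> has_partials f (fx p) (fy p) (at p within closed_disc)"
    and "Ck_disc k fx" "Ck_disc k fy"
  shows "Ck_disc (Suc k) f"
  unfolding Ck_disc.simps using assms by blast

lemma Ck_disc_SucE:
  assumes "Ck_disc (Suc k) f"
  obtains fx fy where
    "\<And>p. p \<in> closed_disc \<Longrightarrow> has_partials f (fx p) (fy p) (at p within closed_disc)"
    "Ck_disc k fx" "Ck_disc k fy"
  using assms unfolding Ck_disc.simps by blast

text \<open>From here on, \<open>C\<^sup>k\<^sup>+\<^sup>1\<close> functions are handled through the two rules above; unfolding the
recursion would expose an existential statement about partial derivatives.\<close>

declare Ck_disc.simps(2) [simp del]

lemma Ck_disc_continuous:
  assumes "Ck_disc k f"
  shows "continuous_on closed_disc f"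
proof (cases k)
  case (Suc j)
  with assms have "Ck_disc (Suc j) f" by simp
  then obtain fx fy where
    "\<And>p. p \<in> closed_disc \<Longrightarrow> has_partials f (fx p) (fy p) (at p within closed_disc)"
    "Ck_disc j fx" "Ck_disc j fy"
    by (rule Ck_disc_SucE) (rule that)
  thus ?thesis
    unfolding continuous_on_eq_continuous_within by (blast intro: has_derivative_continuous)
qed (use assms in simp)

lemma Ck_disc_Suc: "Ck_disc (Suc k) f \<Longrightarrow> Ck_disc k f"
proof (induction k arbitrary: f)
  case 0
  thus ?case using Ck_disc_continuous[of "Suc 0" f] by simp
next
  case (Suc k)
  from Suc.prems obtain fx fy where
    "\<And>p. p \<in> closed_disc \<Longrightarrow> has_partials f (fx p) (fy p) (at p within closed_disc)"
    "Ck_disc (Suc k) fx" "Ck_disc (Suc k) fy"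
    by (rule Ck_disc_SucE) (rule that)
  thus ?case using Suc.IH by (intro Ck_disc_SucI)
qed

lemma Ck_disc_le: "Ck_disc k f \<Longrightarrow> j \<le> k \<Longrightarrow> Ck_disc j f"
  by (induction k) (auto simp: le_Suc_eq dest: Ck_disc_Suc)

lemma Ck_disc_const: "Ck_disc k (\<lambda>_. c)"
proof (induction k arbitrary: c)
  case (Suc k)
  show ?case by (rule Ck_disc_SucI[OF has_partials_const]) (rule Suc)+
qed simp

lemma Ck_disc_add: "Ck_disc k f \<Longrightarrow> Ck_disc k g \<Longrightarrow> Ck_disc k (\<lambda>p. f p + g p)"
proof (induction k arbitrary: f g)
  case (Suc k)
  from Suc.prems(1) obtain fx fy where f:
    "\<And>p. p \<in> closed_disc \<Longrightarrow> has_partials f (fx p) (fy p) (at p within closed_disc)"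
    "Ck_disc k fx" "Ck_disc k fy"
    by (rule Ck_disc_SucE) (rule that)
  from Suc.prems(2) obtain gx gy where g:
    "\<And>p. p \<in> closed_disc \<Longrightarrow> has_partials g (gx p) (gy p) (at p within closed_disc)"
    "Ck_disc k gx" "Ck_disc k gy"
    by (rule Ck_disc_SucE) (rule that)
  show ?case
    by (rule Ck_disc_SucI[OF has_partials_add[OF f(1) g(1)]]) (simp_all add: Suc.IH f g)
qed (auto intro: continuous_intros)

lemma Ck_disc_mult: "Ck_disc k f \<Longrightarrow> Ck_disc k g \<Longrightarrow> Ck_disc k (\<lambda>p. f p * g p)"
proof (induction k arbitrary: f g)
  case (Suc k)
  from Suc.prems(1) obtain fx fy where f:
    "\<And>p. p \<in> closed_disc \<Longrightarrow> has_partials f (fx p) (fy p) (at p within closed_disc)"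
    "Ck_disc k fx" "Ck_disc k fy"
    by (rule Ck_disc_SucE) (rule that)
  from Suc.prems(2) obtain gx gy where g:
    "\<And>p. p \<in> closed_disc \<Longrightarrow> has_partials g (gx p) (gy p) (at p within closed_disc)"
    "Ck_disc k gx" "Ck_disc k gy"
    by (rule Ck_disc_SucE) (rule that)
  show ?case
    by (rule Ck_disc_SucI[OF has_partials_mult[OF f(1) g(1)]])
       (simp_all add: Ck_disc_add Suc.IH f g Suc.prems[THEN Ck_disc_Suc])
qed (auto intro: continuous_intros)

lemma Ck_disc_power: "Ck_disc k f \<Longrightarrow> Ck_disc k (\<lambda>p. f p ^ n)"
  by (induction n) (auto intro: Ck_disc_const Ck_disc_mult)

lemma Ck_disc_cnj: "Ck_disc k f \<Longrightarrow> Ck_disc k (\<lambda>p. cnj (f p))"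
proof (induction k arbitrary: f)
  case (Suc k)
  from Suc.prems obtain fx fy where f:
    "\<And>p. p \<in> closed_disc \<Longrightarrow> has_partials f (fx p) (fy p) (at p within closed_disc)"
    "Ck_disc k fx" "Ck_disc k fy"
    by (rule Ck_disc_SucE) (rule that)
  show ?case
    by (rule Ck_disc_SucI[OF has_partials_cnj[OF f(1)]]) (simp_all add: Suc.IH f)
qed (auto intro: continuous_intros)

lemma has_partials_fst: "has_partials (\<lambda>p. of_real (fst p)) 1 0 F"
  by (auto intro!: derivative_eq_intros simp: fun_eq_iff scaleR_conv_of_real)

lemma has_partials_snd: "has_partials (\<lambda>p. of_real (snd p)) 0 1 F"
  by (auto intro!: derivative_eq_intros simp: fun_eq_iff scaleR_conv_of_real)

lemma Ck_disc_fst: "Ck_disc k (\<lambda>p. of_real (fst p))"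
proof (cases k)
  case (Suc j)
  show ?thesis unfolding Suc by (rule Ck_disc_SucI[OF has_partials_fst]) (rule Ck_disc_const)+
qed (auto intro: continuous_intros)

lemma Ck_disc_snd: "Ck_disc k (\<lambda>p. of_real (snd p))"
proof (cases k)
  case (Suc j)
  show ?thesis unfolding Suc by (rule Ck_disc_SucI[OF has_partials_snd]) (rule Ck_disc_const)+
qed (auto intro: continuous_intros)

definition radial_clifford :: "nat \<Rightarrow> real \<Rightarrow> real \<times> real \<Rightarrow> complex" where
  "radial_clifford n s p = of_real (clifford n (s * ((fst p)\<^sup>2 + (snd p)\<^sup>2)))"

lemma has_partials_radial_clifford:
  "has_partials (radial_clifford n s)
     (of_real (2 * s) * of_real (fst p) * radial_clifford (Suc n) s p)
     (of_real (2 * s) * of_real (snd p) * radial_clifford (Suc n) s p) (at p within X)"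
proof -
  have "((\<lambda>p. clifford n (s * ((fst p)\<^sup>2 + (snd p)\<^sup>2))) has_derivative
      (\<lambda>h. (s * (2 * fst p * fst h + 2 * snd p * snd h)) * clifford (Suc n) (s * ((fst p)\<^sup>2 + (snd p)\<^sup>2))))
      (at p within X)"
    by (rule has_derivative_eq_rhs[OF DERIV_compose_FDERIV[OF clifford_has_derivative]])
       (auto intro!: derivative_eq_intros)
  hence "((\<lambda>p. complex_of_real (clifford n (s * ((fst p)\<^sup>2 + (snd p)\<^sup>2)))) has_derivative
      (\<lambda>h. of_real ((s * (2 * fst p * fst h + 2 * snd p * snd h)) * clifford (Suc n) (s * ((fst p)\<^sup>2 + (snd p)\<^sup>2)))))
      (at p within X)"
    by (rule bounded_linear.has_derivative[OF bounded_linear_of_real])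
  thus ?thesis unfolding radial_clifford_def
    by (rule has_derivative_eq_rhs) (simp add: fun_eq_iff scaleR_conv_of_real algebra_simps)
qed

text \<open>Differentiation raises the order by one and produces a coordinate as a factor, so all
orders are treated simultaneously.\<close>

lemma Ck_disc_radial_clifford: "Ck_disc k (radial_clifford n s)"
proof (induction k arbitrary: n)
  case 0
  show ?case unfolding radial_clifford_def by (auto intro!: continuous_intros)
next
  case (Suc k)
  show ?case
    by (rule Ck_disc_SucI[OF has_partials_radial_clifford])
       (intro Ck_disc_mult Ck_disc_const Ck_disc_fst Ck_disc_snd Suc)+
qed

section \<open>The Laplacian on the disc\<close>

lemma dir_deriv_eq:
  assumes "has_partials f a b (at p)"
  shows "dir_deriv v f p = fst v *\<^sub>R a + snd v *\<^sub>R b"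
proof -
  have "((\<lambda>t. f (p + t *\<^sub>R v)) has_derivative (\<lambda>h. fst (h *\<^sub>R v) *\<^sub>R a + snd (h *\<^sub>R v) *\<^sub>R b)) (at 0)"
    by (rule has_derivative_compose[of "\<lambda>t. p + t *\<^sub>R v" "\<lambda>h. h *\<^sub>R v"])
       (use assms in \<open>auto intro!: derivative_eq_intros\<close>)
  hence "((\<lambda>t. f (p + t *\<^sub>R v)) has_vector_derivative (fst v *\<^sub>R a + snd v *\<^sub>R b)) (at 0)"
    unfolding has_vector_derivative_def by (rule has_derivative_eq_rhs) (simp add: fun_eq_iff algebra_simps)
  thus ?thesis unfolding dir_deriv_def by (rule vector_derivative_at)
qed

lemma dir_deriv_cong:
  assumes "open S" "\<And>q. q \<in> S \<Longrightarrow> f q = g q" "p \<in> S"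
  shows "dir_deriv v f p = dir_deriv v g p"
proof -
  have "((\<lambda>t. p + t *\<^sub>R v) \<longlongrightarrow> p + 0 *\<^sub>R v) (nhds 0)"
    by (intro tendsto_intros filterlim_ident)
  hence "eventually (\<lambda>t. p + t *\<^sub>R v \<in> S) (nhds 0)"
    by (rule topological_tendstoD) (use assms(1,3) in auto)
  hence "eventually (\<lambda>t. f (p + t *\<^sub>R v) = g (p + t *\<^sub>R v)) (nhds 0)"
    by eventually_elim (rule assms(2))
  thus ?thesis unfolding dir_deriv_def
    by (intro vector_derivative_cong_eq) (auto elim: eventually_mono)
qed

lemma laplacian_unfold:
  "laplacian f p = dir_deriv (1, 0) (dir_deriv (1, 0) f) p + dir_deriv (0, 1) (dir_deriv (0, 1) f) p"
  by (simp add: laplacian_def Basis_prod_def)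

lemma laplacian_cong:
  assumes "\<And>q. q \<in> disc \<Longrightarrow> f q = g q" "p \<in> disc"
  shows "laplacian f p = laplacian g p"
proof -
  have "dir_deriv v f q = dir_deriv v g q" if "q \<in> disc" for v q
    by (rule dir_deriv_cong[OF open_ball assms(1) that])
  hence "dir_deriv v (dir_deriv v f) p = dir_deriv v (dir_deriv v g) p" for v
    by (rule dir_deriv_cong[OF open_ball _ assms(2)])
  thus ?thesis by (simp add: laplacian_unfold)
qed

lemma laplacian_eq:
  assumes "\<And>q. q \<in> disc \<Longrightarrow> has_partials f (fx q) (fy q) (at q)"
    and "has_partials fx fxx fxy (at p)" "has_partials fy fyx fyy (at p)" "p \<in> disc"
  shows "laplacian f p = fxx + fyy"
proof -
  have 1: "dir_deriv (1, 0) f q = fx q" "dir_deriv (0, 1) f q = fy q" if "q \<in> disc" for q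
    using dir_deriv_eq[OF assms(1)[OF that]] by auto
  have "dir_deriv (1, 0) (dir_deriv (1, 0) f) p = dir_deriv (1, 0) fx p"
    by (rule dir_deriv_cong[OF open_ball 1(1) assms(4)])
  moreover have "dir_deriv (0, 1) (dir_deriv (0, 1) f) p = dir_deriv (0, 1) fy p"
    by (rule dir_deriv_cong[OF open_ball 1(2) assms(4)])
  ultimately show ?thesis using dir_deriv_eq[OF assms(2)] dir_deriv_eq[OF assms(3)]
    by (simp add: laplacian_unfold)
qed

lemma at_within_closed_disc: "p \<in> disc \<Longrightarrow> at p within closed_disc = at p"
  by (rule at_within_interior) (simp add: interior_cball)

lemma Ck_disc_partials:
  assumes "Ck_disc (Suc (Suc k)) f"
  obtains fx fy fxx fxy fyx fyy where
    "\<And>p. p \<in> closed_disc \<Longrightarrow> has_partials f (fx p) (fy p) (at p within closed_disc)"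
    "\<And>p. p \<in> closed_disc \<Longrightarrow> has_partials fx (fxx p) (fxy p) (at p within closed_disc)"
    "\<And>p. p \<in> closed_disc \<Longrightarrow> has_partials fy (fyx p) (fyy p) (at p within closed_disc)"
    "Ck_disc k fxx" "Ck_disc k fyy"
    "\<And>p. p \<in> disc \<Longrightarrow> laplacian f p = fxx p + fyy p"
proof -
  from assms obtain fx fy where
    1: "\<And>p. p \<in> closed_disc \<Longrightarrow> has_partials f (fx p) (fy p) (at p within closed_disc)"
    and "Ck_disc (Suc k) fx" "Ck_disc (Suc k) fy" by (rule Ck_disc_SucE) (rule that)
  from this(2) obtain fxx fxy where
    2: "\<And>p. p \<in> closed_disc \<Longrightarrow> has_partials fx (fxx p) (fxy p) (at p within closed_disc)"
    and 3: "Ck_disc k fxx" "Ck_disc k fxy" by (rule Ck_disc_SucE) (rule that)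
  from \<open>Ck_disc (Suc k) fy\<close> obtain fyx fyy where
    4: "\<And>p. p \<in> closed_disc \<Longrightarrow> has_partials fy (fyx p) (fyy p) (at p within closed_disc)"
    and 5: "Ck_disc k fyx" "Ck_disc k fyy" by (rule Ck_disc_SucE) (rule that)
  have "laplacian f p = fxx p + fyy p" if p: "p \<in> disc" for p
  proof (rule laplacian_eq[of f fx fy])
    show "has_partials f (fx q) (fy q) (at q)" if "q \<in> disc" for q
      using 1[of q] that at_within_closed_disc[OF that] by simp
    show "has_partials fx (fxx p) (fxy p) (at p)" "has_partials fy (fyx p) (fyy p) (at p)"
      using 2[of p] 4[of p] p at_within_closed_disc[OF p] by simp_all
  qed fact
  with 1 2 4 3(1) 5(2) show thesis by (rule that)
qed

text \<open>At boundary points \<open>laplacian f\<close> depends on values outside the closed disc. The function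
\<open>L\<close> is its continuous extension from the open disc.\<close>

lemma Ck_disc_laplacian:
  assumes "Ck_disc (Suc (Suc k)) f"
  obtains L where "Ck_disc k L" "\<And>p. p \<in> disc \<Longrightarrow> laplacian f p = L p"
  using assms by (rule Ck_disc_partials) (rule that, erule (1) Ck_disc_add)

lemma laplacian_linear:
  assumes f: "Ck_disc 2 f" and g: "Ck_disc 2 g" and p: "p \<in> disc"
  shows "laplacian (\<lambda>p. a * f p + b * g p) p = a * laplacian f p + b * laplacian g p"
proof -
  obtain fx fy fxx fxy fyx fyy where F:
    "\<And>p. p \<in> closed_disc \<Longrightarrow> has_partials f (fx p) (fy p) (at p within closed_disc)"
    "\<And>p. p \<in> closed_disc \<Longrightarrow> has_partials fx (fxx p) (fxy p) (at p within closed_disc)"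
    "\<And>p. p \<in> closed_disc \<Longrightarrow> has_partials fy (fyx p) (fyy p) (at p within closed_disc)"
    "Ck_disc 0 fxx" "Ck_disc 0 fyy"
    "\<And>p. p \<in> disc \<Longrightarrow> laplacian f p = fxx p + fyy p"
    using f unfolding numeral_2_eq_2 by (rule Ck_disc_partials) (rule that)
  obtain gx gy gxx gxy gyx gyy where G:
    "\<And>p. p \<in> closed_disc \<Longrightarrow> has_partials g (gx p) (gy p) (at p within closed_disc)"
    "\<And>p. p \<in> closed_disc \<Longrightarrow> has_partials gx (gxx p) (gxy p) (at p within closed_disc)"
    "\<And>p. p \<in> closed_disc \<Longrightarrow> has_partials gy (gyx p) (gyy p) (at p within closed_disc)"
    "Ck_disc 0 gxx" "Ck_disc 0 gyy"
    "\<And>p. p \<in> disc \<Longrightarrow> laplacian g p = gxx p + gyy p"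
    using g unfolding numeral_2_eq_2 by (rule Ck_disc_partials) (rule that)
  have lin: "has_partials (\<lambda>p. a * u p + b * v p) (a * ux + b * vx) (a * uy + b * vy) (at q)"
    if "q \<in> disc" "has_partials u ux uy (at q within closed_disc)" "has_partials v vx vy (at q within closed_disc)"
    for u v ux uy vx vy q
    using has_partials_add[OF has_partials_mult[OF has_partials_const[of a] that(2)]
        has_partials_mult[OF has_partials_const[of b] that(3)]] at_within_closed_disc[OF that(1)] by simp
  have sub: "q \<in> disc \<Longrightarrow> q \<in> closed_disc" for q by simp
  have "laplacian (\<lambda>p. a * f p + b * g p) p = (a * fxx p + b * gxx p) + (a * fyy p + b * gyy p)"
    by (rule laplacian_eq[OF lin[OF _ F(1) G(1)] lin[OF p F(2) G(2)] lin[OF p F(3) G(3)] p])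
       (use p sub in auto)
  thus ?thesis using F(6)[OF p] G(6)[OF p] by (simp add: algebra_simps)
qed

lemma laplacian_cnj:
  assumes f: "Ck_disc 2 f" and p: "p \<in> disc"
  shows "laplacian (\<lambda>p. cnj (f p)) p = cnj (laplacian f p)"
proof -
  obtain fx fy fxx fxy fyx fyy where F:
    "\<And>p. p \<in> closed_disc \<Longrightarrow> has_partials f (fx p) (fy p) (at p within closed_disc)"
    "\<And>p. p \<in> closed_disc \<Longrightarrow> has_partials fx (fxx p) (fxy p) (at p within closed_disc)"
    "\<And>p. p \<in> closed_disc \<Longrightarrow> has_partials fy (fyx p) (fyy p) (at p within closed_disc)"
    "Ck_disc 0 fxx" "Ck_disc 0 fyy"
    "\<And>p. p \<in> disc \<Longrightarrow> laplacian f p = fxx p + fyy p"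
    using f unfolding numeral_2_eq_2 by (rule Ck_disc_partials) (rule that)
  have cj: "has_partials (\<lambda>p. cnj (u p)) (cnj ux) (cnj uy) (at q)"
    if "q \<in> disc" "has_partials u ux uy (at q within closed_disc)" for u ux uy q
    using has_partials_cnj[OF that(2)] at_within_closed_disc[OF that(1)] by simp
  have sub: "q \<in> disc \<Longrightarrow> q \<in> closed_disc" for q by simp
  have "laplacian (\<lambda>p. cnj (f p)) p = cnj (fxx p) + cnj (fyy p)"
    by (rule laplacian_eq[OF cj[OF _ F(1)] cj[OF p F(2)] cj[OF p F(3)] p])
       (use p sub in auto)
  thus ?thesis using F(6)[OF p] by simp
qed

section \<open>Explicit modes\<close>

definition zcoord :: "real \<times> real \<Rightarrow> complex" where
  "zcoord p = of_real (fst p) + \<i> * of_real (snd p)"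

text \<open>For \<open>s = - \<kappa>\<^sup>2 / 4\<close> this is a multiple of \<open>J\<^sub>n(\<kappa> r) e\<^sup>i\<^sup>n\<^sup>\<theta>\<close>, for \<open>s = \<kappa>\<^sup>2 / 4\<close> a multiple of
\<open>I\<^sub>n(\<kappa> r) e\<^sup>i\<^sup>n\<^sup>\<theta>\<close>, and for \<open>s = 0\<close> of \<open>z\<^sup>n\<close>. Written in this way it is visibly smooth at the centre.\<close>

definition mode :: "nat \<Rightarrow> real \<Rightarrow> real \<times> real \<Rightarrow> complex" where
  "mode n s p = zcoord p ^ n * radial_clifford n s p"

lemma Ck_disc_mode: "Ck_disc k (mode n s)"
  unfolding mode_def zcoord_def
  by (intro Ck_disc_mult Ck_disc_power Ck_disc_add Ck_disc_const Ck_disc_fst Ck_disc_snd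
      Ck_disc_radial_clifford)

lemma has_partials_zcoord_power:
  "has_partials (\<lambda>p. zcoord p ^ n) (of_nat n * zcoord p ^ (n - 1)) (\<i> * of_nat n * zcoord p ^ (n - 1))
     (at p within X)"
proof -
  have "has_partials zcoord 1 \<i> (at p within X)"
    unfolding zcoord_def[abs_def]
    using has_partials_add[OF has_partials_fst has_partials_mult[OF has_partials_const[of \<i>] has_partials_snd]]
    by simp
  from has_derivative_power[OF this, of n] show ?thesis
    by (rule has_derivative_eq_rhs) (simp add: fun_eq_iff scaleR_conv_of_real algebra_simps)
qed

text \<open>With \<open>\<rho> = |z|\<^sup>2\<close> one has \<open>\<Delta>(z\<^sup>n h(\<rho>)) = 4 z\<^sup>n (\<rho> h'' + (n + 1) h')\<close>; for \<open>h(\<rho>) = C\<^sub>n(s \<rho>)\<close>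
the bracket is \<open>s C\<^sub>n(s \<rho>)\<close> by the recurrence.\<close>

lemma laplacian_mode:
  assumes "p \<in> disc"
  shows "laplacian (mode n s) p = of_real (4 * s) * mode n s p"
proof -
  define z where "z = zcoord"
  define C where "C = (\<lambda>k. radial_clifford k s)"
  define x y where "x = (\<lambda>p :: real \<times> real. complex_of_real (fst p))" "y = (\<lambda>p :: real \<times> real. complex_of_real (snd p))"
  define S where "S = complex_of_real (2 * s)"
  note zp = has_partials_zcoord_power[of _ _ UNIV, folded z_def]
  have Cp: "has_partials (C k) (S * x p * C (Suc k) p) (S * y p * C (Suc k) p) (at p)" for k p
    using has_partials_radial_clifford[of k s p UNIV] by (simp add: C_def S_def x_y_def)
  have xp: "has_partials x 1 0 (at p)" "has_partials y 0 1 (at p)" for p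
    unfolding x_y_def by (rule has_partials_fst has_partials_snd)+
  have mode: "mode n s = (\<lambda>p. z p ^ n * C n p)"
    by (simp add: fun_eq_iff mode_def z_def zcoord_def C_def)
  have "has_partials (mode n s) (of_nat n * z p ^ (n - 1) * C n p + z p ^ n * (S * x p * C (Suc n) p))
     (\<i> * of_nat n * z p ^ (n - 1) * C n p + z p ^ n * (S * y p * C (Suc n) p)) (at p)" for p
    unfolding mode by (rule has_partials_mult[OF zp Cp])
  note 1 = this
  note cst = has_partials_const[of _ "at _"]
  note fx = has_partials_add[OF has_partials_mult[OF has_partials_mult[OF cst zp] Cp]
    has_partials_mult[OF zp has_partials_mult[OF has_partials_mult[OF cst xp(1)] Cp]]]
  note fy = has_partials_add[OF has_partials_mult[OF has_partials_mult[OF cst zp] Cp]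
    has_partials_mult[OF zp has_partials_mult[OF has_partials_mult[OF cst xp(2)] Cp]]]
  note L = laplacian_eq[OF 1 fx fy assms]
  have zx: "z p = x p + \<i> * y p" by (simp add: z_def zcoord_def x_y_def)
  have rec: "C n p = (of_nat n + 1) * C (Suc n) p + of_real s * ((x p)\<^sup>2 + (y p)\<^sup>2) * C (Suc (Suc n)) p"
    unfolding C_def radial_clifford_def x_y_def
    by (subst clifford_recurrence) simp
  have zn: "of_nat n * z p ^ (n - 1) * (x p + \<i> * y p) = of_nat n * z p ^ n"
    unfolding zx[symmetric] by (cases n) auto
  define a b N N' where "a = z p ^ (n - 1)" "b = z p ^ (n - 1 - 1)"
    "N = complex_of_nat n" "N' = complex_of_nat (n - 1)"
  have "laplacian (mode n s) p = 2 * S * (of_nat n * z p ^ (n - 1) * (x p + \<i> * y p)) * C (Suc n) p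
      + 2 * S * z p ^ n * C (Suc n) p + S * S * z p ^ n * ((x p)\<^sup>2 + (y p)\<^sup>2) * C (Suc (Suc n)) p"
    unfolding L a_b_N_N'_def[symmetric] by (simp add: algebra_simps power2_eq_square)
  also have "\<dots> = 2 * S * z p ^ n * C n p"
    unfolding zn rec by (simp add: S_def algebra_simps)
  finally show ?thesis by (simp add: mode S_def)
qed

section \<open>Polar coordinates\<close>

lemma polar_exists:
  obtains r \<theta> where "r \<ge> 0" "p = polar r \<theta>" "r = norm p"
proof -
  define z where "z = Complex (fst p) (snd p)"
  have z: "rcis (cmod z) (Arg z) = z" by (rule rcis_cmod_Arg)
  have "Re z = cmod z * cos (Arg z)"
    using Re_rcis[of "cmod z" "Arg z"] unfolding z .
  moreover have "Im z = cmod z * sin (Arg z)"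
    using Im_rcis[of "cmod z" "Arg z"] unfolding z .
  ultimately have "(Re z, Im z) = polar (cmod z) (Arg z)"
    unfolding polar_def by (rule arg_cong2)
  hence "p = polar (cmod z) (Arg z)" by (simp only: z_def complex.sel prod.collapse)
  moreover have "cmod z = norm p" by (simp add: z_def norm_prod_def complex_norm)
  ultimately show thesis by (intro that[OF norm_ge_zero])
qed

lemma zcoord_polar: "zcoord (polar r \<theta>) = of_real r * cis \<theta>"
  by (simp add: zcoord_def polar_def complex_eq_iff)

lemma mode_polar: "mode n s (polar r \<theta>) = of_real (r ^ n * clifford n (s * r\<^sup>2)) * cis (of_nat n * \<theta>)"
proof -
  have "(r * cos \<theta>)\<^sup>2 + (r * sin \<theta>)\<^sup>2 = r\<^sup>2"
    by (simp add: power_mult_distrib flip: distrib_left)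
  thus ?thesis using zcoord_polar[of r \<theta>] Complex.DeMoivre[of \<theta> n]
    by (simp add: mode_def radial_clifford_def polar_def zcoord_def power_mult_distrib)
qed

lemma norm_polar: "norm (polar r \<theta>) = \<bar>r\<bar>"
proof -
  have "(r * cos \<theta>)\<^sup>2 + (r * sin \<theta>)\<^sup>2 = r\<^sup>2"
    by (simp add: power_mult_distrib flip: distrib_left)
  thus ?thesis by (simp add: polar_def norm_Pair del: power_mult_distrib)
qed

lemma polar_0: "polar r 0 = (r, 0)"
  by (simp add: polar_def)

lemma azimuthal_iff:
  "azimuthal m f \<longleftrightarrow> (\<forall>r\<in>{0..1}. \<forall>\<theta>. f (polar r \<theta>) = cis (of_int m * \<theta>) * f (r, 0))"
proof
  assume "azimuthal m f"
  then obtain g where g: "\<And>r \<theta>. r \<in> {0..1} \<Longrightarrow> f (polar r \<theta>) = cis (of_int m * \<theta>) * g r"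
    unfolding azimuthal_def by blast
  have "f (r, 0) = g r" if "r \<in> {0..1}" for r
    using g[OF that, of 0] by (simp add: polar_0)
  thus "\<forall>r\<in>{0..1}. \<forall>\<theta>. f (polar r \<theta>) = cis (of_int m * \<theta>) * f (r, 0)"
    using g by simp
next
  assume "\<forall>r\<in>{0..1}. \<forall>\<theta>. f (polar r \<theta>) = cis (of_int m * \<theta>) * f (r, 0)"
  thus "azimuthal m f" unfolding azimuthal_def by (intro exI[of _ "\<lambda>r. f (r, 0)"])
qed

lemma theta_deriv_azimuthal:
  assumes "azimuthal m f" "p \<in> closed_disc"
  shows "theta_deriv f p = \<i> * of_int m * f p"
proof -
  obtain r \<theta> where p: "r \<ge> 0" "p = polar r \<theta>" "r = norm p" by (rule polar_exists) (rule that)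
  have "r \<le> 1" using p(3) assms(2) by simp
  hence f: "f (polar r t) = cis (of_int m * t) * f (r, 0)" for t
    using assms(1) p(1) unfolding azimuthal_iff by simp
  have "theta_deriv f p = vector_derivative (\<lambda>t. f (polar r (\<theta> + t))) (at 0)"
    by (simp add: theta_deriv_def p(2) polar_def cos_add sin_add algebra_simps)
  also have "\<dots> = vector_derivative (\<lambda>t. cis (of_int m * (\<theta> + t)) * f (r, 0)) (at 0)"
    by (simp add: f)
  also have "((\<lambda>t. cis (of_int m * (\<theta> + t)) * f (r, 0)) has_vector_derivative
      (of_int m *\<^sub>R (\<i> * cis (of_int m * (\<theta> + 0)))) * f (r, 0)) (at 0)"
    unfolding has_vector_derivative_def
    by (auto intro!: derivative_eq_intros simp: fun_eq_iff scaleR_conv_of_real)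
  hence "vector_derivative (\<lambda>t. cis (of_int m * (\<theta> + t)) * f (r, 0)) (at 0)
      = (of_int m *\<^sub>R (\<i> * cis (of_int m * (\<theta> + 0)))) * f (r, 0)"
    by (rule vector_derivative_at)
  finally show ?thesis unfolding p(2) f by (simp add: scaleR_conv_of_real)
qed

section \<open>The radial equation\<close>

text \<open>For \<open>F(r e\<^sup>i\<^sup>\<theta>) = e\<^sup>i\<^sup>n\<^sup>\<theta> f(r)\<close> this says \<open>\<Delta>F = e\<^sup>i\<^sup>n\<^sup>\<theta> h\<close> on the punctured open disc, where
\<open>f'\<close> is the derivative of \<open>f\<close>. The continuity of \<open>f\<close> and \<open>f'\<close> at \<open>0\<close> singles out
the solutions that are regular at the centre.\<close>

definition radial_laplacian ::
  "nat \<Rightarrow> (real \<Rightarrow> complex) \<Rightarrow> (real \<Rightarrow> complex) \<Rightarrow> (real \<Rightarrow> complex) \<Rightarrow> bool" where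
  "radial_laplacian n f f' h \<longleftrightarrow>
     continuous_on {0..1} f \<and> continuous_on {0..1} f' \<and>
     (\<forall>r\<in>{0<..<1}. (f has_vector_derivative f' r) (at r) \<and>
        (f' has_vector_derivative (h r - f' r / of_real r + of_nat n ^ 2 * f r / of_real r ^ 2)) (at r))"

lemma radial_laplacian_linear:
  assumes "radial_laplacian n f f' h" "radial_laplacian n g g' k"
  shows "radial_laplacian n (\<lambda>r. a * f r + b * g r) (\<lambda>r. a * f' r + b * g' r) (\<lambda>r. a * h r + b * k r)"
proof -
  have "((\<lambda>r. a * f r + b * g r) has_vector_derivative (a * f' r + b * g' r)) (at r)"
       "((\<lambda>r. a * f' r + b * g' r) has_vector_derivative
          (a * h r + b * k r) - (a * f' r + b * g' r) / of_real r
            + of_nat n ^ 2 * (a * f r + b * g r) / of_real r ^ 2) (at r)"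
    if r: "r \<in> {0<..<1}" for r
  proof -
    have *: "(f has_vector_derivative f' r) (at r)" "(g has_vector_derivative g' r) (at r)"
      "(f' has_vector_derivative (h r - f' r / of_real r + of_nat n ^ 2 * f r / of_real r ^ 2)) (at r)"
      "(g' has_vector_derivative (k r - g' r / of_real r + of_nat n ^ 2 * g r / of_real r ^ 2)) (at r)"
      using assms r by (auto simp: radial_laplacian_def)
    show "((\<lambda>r. a * f r + b * g r) has_vector_derivative (a * f' r + b * g' r)) (at r)"
      by (intro has_vector_derivative_add has_vector_derivative_mult_right *)
    have "((\<lambda>r. a * f' r + b * g' r) has_vector_derivative
        (a * (h r - f' r / of_real r + of_nat n ^ 2 * f r / of_real r ^ 2)
        + b * (k r - g' r / of_real r + of_nat n ^ 2 * g r / of_real r ^ 2))) (at r)"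
      by (intro has_vector_derivative_add has_vector_derivative_mult_right *)
    thus "((\<lambda>r. a * f' r + b * g' r) has_vector_derivative
          (a * h r + b * k r) - (a * f' r + b * g' r) / of_real r
            + of_nat n ^ 2 * (a * f r + b * g r) / of_real r ^ 2) (at r)"
      by (rule has_vector_derivative_eq_rhs) (simp add: algebra_simps add_divide_distrib)
  qed
  thus ?thesis
    using assms unfolding radial_laplacian_def by (auto intro!: continuous_intros)
qed

lemma radial_laplacian_cong:
  assumes "radial_laplacian n f f' h" "\<And>r. r \<in> {0<..<1} \<Longrightarrow> h r = k r"
  shows "radial_laplacian n f f' k"
  using assms by (simp add: radial_laplacian_def)

lemma vanishes_of_zero_deriv:
  fixes W :: "real \<Rightarrow> complex"
  assumes "continuous_on {0..1} W" "W 0 = 0"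
    and "\<And>r. r \<in> {0<..<1} \<Longrightarrow> (W has_vector_derivative 0) (at r)"
    and "r \<in> {0..1}"
  shows "W r = 0"
proof (rule has_derivative_zero_unique_strong_convex[of "{0..1}" "{0, 1}" W 0 0 r])
  fix x :: real assume "x \<in> {0..1} - {0, 1}"
  hence "(W has_vector_derivative 0) (at x within {0..1})"
    using assms(3)[of x] by (auto intro: has_vector_derivative_at_within)
  thus "(W has_derivative (\<lambda>h. 0)) (at x within {0..1})"
    by (simp add: has_vector_derivative_def)
qed (use assms in auto)

lemma eq_on_closed_unit_interval:
  fixes f g :: "real \<Rightarrow> complex"
  assumes "continuous_on {0..1} f" "continuous_on {0..1} g"
    and "\<And>r. r \<in> {0<..<1} \<Longrightarrow> f r = g r" and "r \<in> {0..1}"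
  shows "f r = g r"
proof -
  have cl: "closure {0<..<1} = {0..1::real}" by simp
  have "(\<lambda>r. f r - g r) r = 0"
  proof (rule continuous_constant_on_closure[of "{0<..<1}" "\<lambda>r. f r - g r" 0 r])
    show "continuous_on (closure {0<..<1}) (\<lambda>r. f r - g r)"
      unfolding cl using assms by (intro continuous_intros)
    show "r \<in> closure {0<..<1}" unfolding cl by fact
  qed (simp add: assms(3))
  thus ?thesis by simp
qed

lemma has_vector_derivative_quotient:
  fixes f g :: "real \<Rightarrow> complex"
  assumes "(f has_vector_derivative f') (at r within S)" "(g has_vector_derivative g') (at r within S)" "g r \<noteq> 0"
  shows "((\<lambda>r. f r / g r) has_vector_derivative (f' * g r - f r * g') / (g r * g r)) (at r within S)"
  unfolding has_vector_derivative_def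
  by (rule has_derivative_eq_rhs[OF has_derivative_divide'[OF assms(1,2)[unfolded has_vector_derivative_def] assms(3)]])
     (simp add: fun_eq_iff scaleR_conv_of_real algebra_simps diff_divide_distrib)

text \<open>This is \<open>r (r\<^sup>n f' - (r\<^sup>n)' f)\<close>, the boundary term in Green's identity for \<open>f\<close> and the harmonic
function \<open>r\<^sup>n\<close>.\<close>

definition flux :: "nat \<Rightarrow> (real \<Rightarrow> complex) \<Rightarrow> (real \<Rightarrow> complex) \<Rightarrow> real \<Rightarrow> complex" where
  "flux n f f' r = of_real r ^ (n + 1) * f' r - of_nat n * of_real r ^ n * f r"

lemma has_vector_derivative_of_real_power:
  "((\<lambda>r. complex_of_real r ^ k) has_vector_derivative of_nat k * of_real r ^ (k - 1)) (at r within S)"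
proof -
  have "((\<lambda>r. complex_of_real r ^ k) has_vector_derivative of_nat k * (of_real r ^ (k - 1) * 1)) (at r within S)"
    unfolding has_vector_derivative_def
    by (rule has_derivative_eq_rhs[OF has_derivative_power[OF has_derivative_of_real[OF has_derivative_ident]]])
       (simp add: fun_eq_iff scaleR_conv_of_real algebra_simps)
  thus ?thesis by simp
qed

lemma flux_deriv:
  assumes "radial_laplacian n f f' h" "r \<in> {0<..<1}"
  shows "(flux n f f' has_vector_derivative of_real r ^ (n + 1) * h r) (at r)"
proof -
  have f: "(f has_vector_derivative f' r) (at r)"
    "(f' has_vector_derivative (h r - f' r / of_real r + of_nat n ^ 2 * f r / of_real r ^ 2)) (at r)"
    using assms by (auto simp: radial_laplacian_def)
  note pw = has_vector_derivative_of_real_power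
  have "(flux n f f' has_vector_derivative
      (of_real r ^ (n + 1) * (h r - f' r / of_real r + of_nat n ^ 2 * f r / of_real r ^ 2)
        + of_nat (n + 1) * of_real r ^ (n + 1 - 1) * f' r)
      - (of_nat n * of_real r ^ n * f' r + of_nat n * (of_nat n * of_real r ^ (n - 1)) * f r)) (at r)"
    unfolding flux_def[abs_def]
    by (intro has_vector_derivative_diff has_vector_derivative_mult pw f has_vector_derivative_mult_right)
  also have "(of_real r ^ (n + 1) * (h r - f' r / of_real r + of_nat n ^ 2 * f r / of_real r ^ 2)
        + of_nat (n + 1) * of_real r ^ (n + 1 - 1) * f' r)
      - (of_nat n * of_real r ^ n * f' r + of_nat n * (of_nat n * of_real r ^ (n - 1)) * f r)
      = of_real r ^ (n + 1) * h r"
    using assms(2) by (cases n) (auto simp: field_simps power2_eq_square)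
  finally show ?thesis .
qed

lemma flux_continuous:
  assumes "radial_laplacian n f f' h"
  shows "continuous_on {0..1} (flux n f f')"
  using assms unfolding flux_def[abs_def] radial_laplacian_def by (auto intro!: continuous_intros)

lemma flux_0: "flux n f f' 0 = 0"
  by (cases n) (auto simp: flux_def)

text \<open>An antiderivative of \<open>2 r\<^sup>n\<^sup>+\<^sup>1\<close> times the radial profile of \<open>U\<^sub>s\<close>. For \<open>s \<noteq> 0\<close> it is, up to
the factor \<open>2 s\<close>, the flux of that profile, but it makes sense for \<open>s = 0\<close> as well.\<close>

definition clifford_flux :: "nat \<Rightarrow> real \<Rightarrow> real \<Rightarrow> complex" where
  "clifford_flux n s r = of_real (r ^ (2 * n + 2) * clifford (Suc n) (s * r\<^sup>2))"

lemma clifford_radial_deriv: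
  "((\<lambda>r. complex_of_real (clifford n (s * r\<^sup>2))) has_vector_derivative
      of_real (2 * s * r * clifford (Suc n) (s * r\<^sup>2))) (at r within S)"
proof -
  have "((\<lambda>r. clifford n (s * r\<^sup>2)) has_real_derivative clifford (Suc n) (s * r\<^sup>2) * (s * (2 * r))) (at r within S)"
    by (rule DERIV_chain2[OF clifford_has_derivative]) (auto intro!: derivative_eq_intros)
  hence "((\<lambda>r. clifford n (s * r\<^sup>2)) has_vector_derivative 2 * s * r * clifford (Suc n) (s * r\<^sup>2)) (at r within S)"
    by (simp add: has_real_derivative_iff_has_vector_derivative mult_ac)
  thus ?thesis by (rule bounded_linear.has_vector_derivative[OF bounded_linear_of_real])
qed

lemma clifford_flux_deriv:
  "(clifford_flux n s has_vector_derivative of_real (2 * r ^ (2 * n + 1) * clifford n (s * r\<^sup>2))) (at r within S)"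
proof -
  have "((\<lambda>r. complex_of_real r ^ (2 * n + 2) * of_real (clifford (Suc n) (s * r\<^sup>2))) has_vector_derivative
      of_real r ^ (2 * n + 2) * of_real (2 * s * r * clifford (Suc (Suc n)) (s * r\<^sup>2))
      + of_nat (2 * n + 2) * of_real r ^ (2 * n + 2 - 1) * of_real (clifford (Suc n) (s * r\<^sup>2))) (at r within S)"
    by (intro has_vector_derivative_mult has_vector_derivative_of_real_power clifford_radial_deriv)
  also have "of_real r ^ (2 * n + 2) * of_real (2 * s * r * clifford (Suc (Suc n)) (s * r\<^sup>2))
      + of_nat (2 * n + 2) * of_real r ^ (2 * n + 2 - 1) * of_real (clifford (Suc n) (s * r\<^sup>2))
      = complex_of_real (2 * r ^ (2 * n + 1) * ((real n + 1) * clifford (Suc n) (s * r\<^sup>2)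
         + s * r\<^sup>2 * clifford (Suc (Suc n)) (s * r\<^sup>2)))"
    by (simp add: algebra_simps power2_eq_square)
  also have "(real n + 1) * clifford (Suc n) (s * r\<^sup>2) + s * r\<^sup>2 * clifford (Suc (Suc n)) (s * r\<^sup>2)
      = clifford n (s * r\<^sup>2)"
    using clifford_recurrence[of n "s * r\<^sup>2"] by simp
  finally show ?thesis unfolding clifford_flux_def[abs_def] by simp
qed

lemma continuous_on_clifford_flux [continuous_intros]: "continuous_on S (clifford_flux n s)"
  unfolding clifford_flux_def[abs_def] by (intro continuous_intros)

lemma clifford_flux_0: "clifford_flux n s 0 = 0"
  by (simp add: clifford_flux_def)

text \<open>The Wronskian of \<open>f\<close> and the profile of \<open>U\<^sub>s\<close> is constant and vanishes at the centre. Where the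
profile vanishes this does not yet give proportionality of the functions themselves; but
\<open>C\<^sub>n\<^sub>+\<^sub>1\<close>, which gives the flux of the profile, has no zero by assumption, and so for \<open>s \<noteq> 0\<close> it is
the quotient of the fluxes that is shown to be constant.\<close>

lemma radial_eigenfunction:
  assumes f: "radial_laplacian n f f' (\<lambda>r. of_real (4 * s) * f r)"
    and pos: "\<And>r. r \<in> {0<..<1} \<Longrightarrow> clifford (Suc n) (s * r\<^sup>2) \<noteq> 0"
  obtains B where "\<And>r. r \<in> {0..1} \<Longrightarrow> f r = B * of_real (r ^ n * clifford n (s * r\<^sup>2))"
proof -
  define G where "G = flux n f f'"
  define H where "H = clifford_flux n s"
  define y where "y = (\<lambda>r. complex_of_real (clifford n (s * r\<^sup>2)))"
  define x where "x = (\<lambda>r. f r / of_real r ^ n)"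
  \<comment> \<open>The Wronskian, in a form that is continuous at \<open>r = 0\<close>; for \<open>r > 0\<close> it is \<open>G y - 2 s H x\<close>.\<close>
  define W where "W = (\<lambda>r. G r * y r - of_real (2 * s * r\<^sup>2) * of_real (r ^ n * clifford (Suc n) (s * r\<^sup>2)) * f r)"
  have fcont: "continuous_on {0..1} f" using f by (simp add: radial_laplacian_def)
  have G': "(G has_vector_derivative of_real r ^ (2 * n + 1) * of_real (4 * s) * x r) (at r)"
    if "r \<in> {0<..<1}" for r
  proof -
    have "of_real r ^ (n + 1) * (of_real (4 * s) * f r) = of_real r ^ (2 * n + 1) * of_real (4 * s) * x r"
      using that by (simp add: x_def power_add mult_2)
    thus ?thesis using flux_deriv[OF f that] by (simp only: G_def)
  qed
  have H': "(H has_vector_derivative 2 * of_real r ^ (2 * n + 1) * y r) (at r)" for r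
    using clifford_flux_deriv[of n s r UNIV] by (simp add: H_def y_def)
  have x': "(x has_vector_derivative G r / of_real r ^ (2 * n + 1)) (at r)" if r: "r \<in> {0<..<1}" for r
  proof -
    have "(f has_vector_derivative f' r) (at r)" using f r by (auto simp: radial_laplacian_def)
    hence "((\<lambda>r. f r / of_real r ^ n) has_vector_derivative
        (f' r * of_real r ^ n - f r * (of_nat n * of_real r ^ (n - 1))) / (of_real r ^ n * of_real r ^ n)) (at r)"
      using r by (intro has_vector_derivative_quotient has_vector_derivative_of_real_power) auto
    also have "(f' r * of_real r ^ n - f r * (of_nat n * of_real r ^ (n - 1))) / (of_real r ^ n * of_real r ^ n)
        = G r / of_real r ^ (2 * n + 1)"
      using r by (cases n) (auto simp: G_def flux_def power_add mult_2 field_simps power_mult power2_eq_square)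
    finally show ?thesis by (simp add: x_def[abs_def])
  qed
  have y': "(y has_vector_derivative of_real (2 * s) * H r / of_real r ^ (2 * n + 1)) (at r)"
    if "r \<in> {0<..<1}" for r
  proof -
    have "complex_of_real (2 * s * r * clifford (Suc n) (s * r\<^sup>2)) = of_real (2 * s) * H r / of_real r ^ (2 * n + 1)"
      using that by (simp add: H_def clifford_flux_def)
    thus ?thesis using clifford_radial_deriv[of n s r UNIV] by (simp add: y_def)
  qed
  have eq: "W t = G t * y t - of_real (2 * s) * (H t * x t)" if "t \<in> {0<..<1}" for t
  proof -
    have "H t * x t = of_real (t\<^sup>2) * of_real (t ^ n * clifford (Suc n) (s * t\<^sup>2)) * f t"
      using that by (simp add: H_def clifford_flux_def x_def power_add mult_2 power2_eq_square)
    thus ?thesis by (simp add: W_def)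
  qed
  have W: "W r = 0" if "r \<in> {0..1}" for r
  proof (rule vanishes_of_zero_deriv[OF _ _ _ that])
    show "continuous_on {0..1} W"
      unfolding W_def G_def y_def by (intro continuous_intros fcont flux_continuous[OF f])
    show "W 0 = 0" by (simp add: W_def G_def flux_0)
    fix r :: real assume r: "r \<in> {0<..<1}"
    have "((\<lambda>t. G t * y t - of_real (2 * s) * (H t * x t)) has_vector_derivative
       (G r * (of_real (2 * s) * H r / of_real r ^ (2 * n + 1)) + of_real r ^ (2 * n + 1) * of_real (4 * s) * x r * y r)
       - of_real (2 * s) * (H r * (G r / of_real r ^ (2 * n + 1)) + 2 * of_real r ^ (2 * n + 1) * y r * x r)) (at r)"
      by (intro has_vector_derivative_diff has_vector_derivative_mult has_vector_derivative_mult_right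
          G'[OF r] H' x'[OF r] y'[OF r])
    also have "(G r * (of_real (2 * s) * H r / of_real r ^ (2 * n + 1)) + of_real r ^ (2 * n + 1) * of_real (4 * s) * x r * y r)
       - of_real (2 * s) * (H r * (G r / of_real r ^ (2 * n + 1)) + 2 * of_real r ^ (2 * n + 1) * y r * x r) = 0"
      by (simp add: algebra_simps)
    finally show "(W has_vector_derivative 0) (at r)"
      by (rule has_vector_derivative_transform_within_open[of _ _ _ "{0<..<1}"]) (use r eq in auto)
  qed
  have GH: "G r * y r = of_real (2 * s) * (H r * x r)" if "r \<in> {0<..<1}" for r
    using W[of r] eq[OF that] that by simp
  have "\<exists>B. \<forall>r\<in>{0<..<1}. x r = B * y r"
  proof (cases "s = 0")
    case True
    have "G r = 0" if "r \<in> {0<..<1}" for r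
      using GH[OF that] True by (simp add: y_def)
    hence "(x has_vector_derivative 0) (at r within {0<..<1})" if "r \<in> {0<..<1}" for r
      using x'[OF that] that by (auto intro: has_vector_derivative_at_within)
    then obtain c where "\<And>r. r \<in> {0<..<1} \<Longrightarrow> x r = c"
      using has_vector_derivative_zero_constant[of "{0<..<1}" x, OF convex_real_interval(8)] by blast
    thus ?thesis using True by (intro exI[of _ "c * fact n"]) (simp add: y_def)
  next
    case False
    have H0: "H r \<noteq> 0" if "r \<in> {0<..<1}" for r
      using pos[OF that] that by (simp add: H_def clifford_flux_def)
    have "((\<lambda>r. G r / H r) has_vector_derivative 0) (at r within {0<..<1})" if r: "r \<in> {0<..<1}" for r
    proof -
      have "((\<lambda>r. G r / H r) has_vector_derivative
        (of_real r ^ (2 * n + 1) * of_real (4 * s) * x r * H r - G r * (2 * of_real r ^ (2 * n + 1) * y r)) / (H r * H r)) (at r)"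
        by (rule has_vector_derivative_quotient[OF G'[OF r] H' H0[OF r]])
      also have "of_real r ^ (2 * n + 1) * of_real (4 * s) * x r * H r - G r * (2 * of_real r ^ (2 * n + 1) * y r)
          = 2 * of_real r ^ (2 * n + 1) * (of_real (2 * s) * (H r * x r) - G r * y r)"
        by (simp add: algebra_simps)
      also have "\<dots> = 0" using GH[OF r] by simp
      finally show ?thesis by (simp add: has_vector_derivative_at_within)
    qed
    then obtain c where c: "\<And>r. r \<in> {0<..<1} \<Longrightarrow> G r / H r = c"
      using has_vector_derivative_zero_constant[of "{0<..<1}" "\<lambda>r. G r / H r", OF convex_real_interval(8)] by blast
    have "x r = c / of_real (2 * s) * y r" if "r \<in> {0<..<1}" for r
    proof -
      have "G r = c * H r" using c[OF that] H0[OF that] by (simp add: field_simps)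
      hence "H r * (c * y r) = H r * (of_real (2 * s) * x r)" using GH[OF that] by (simp add: mult_ac)
      hence "c * y r = of_real (2 * s) * x r" using H0[OF that] by simp
      thus ?thesis using False by (simp add: field_simps)
    qed
    thus ?thesis by blast
  qed
  then obtain B where B: "\<And>r. r \<in> {0<..<1} \<Longrightarrow> x r = B * y r" by blast
  have "f r = B * of_real (r ^ n * clifford n (s * r\<^sup>2))" if "r \<in> {0..1}" for r
  proof (rule eq_on_closed_unit_interval[OF fcont _ _ that])
    show "f r = B * of_real (r ^ n * clifford n (s * r\<^sup>2))" if "r \<in> {0<..<1}" for r
      using B[OF that] that by (simp add: x_def y_def field_simps)
  qed (intro continuous_intros)
  thus thesis by (rule that)
qed

text \<open>The flux of a clamped function vanishes at the centre and on the circle, so \<open>h\<close> is orthogonal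
to \<open>r\<^sup>n\<close>; the integrals are explicit.\<close>

lemma radial_clamped_condition:
  assumes f: "radial_laplacian n f f' h" and "f 1 = 0" "f' 1 = 0"
    and h: "\<And>r. r \<in> {0<..<1} \<Longrightarrow> h r = of_real (r ^ n) * (A * of_real (clifford n (s * r\<^sup>2)) + B * of_real (clifford n (t * r\<^sup>2)))"
  shows "A * of_real (clifford (Suc n) s) + B * of_real (clifford (Suc n) t) = 0"
proof -
  define K where "K = (\<lambda>r. 2 * flux n f f' r - (A * clifford_flux n s r + B * clifford_flux n t r))"
  have "K 1 = 0"
  proof (rule vanishes_of_zero_deriv[of K 1])
    show "continuous_on {0..1} K" unfolding K_def by (intro continuous_intros flux_continuous[OF f])
    show "K 0 = 0" by (simp add: K_def flux_0 clifford_flux_0)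
    fix r :: real assume r: "r \<in> {0<..<1}"
    have "(K has_vector_derivative 2 * (of_real r ^ (n + 1) * h r)
       - (A * of_real (2 * r ^ (2 * n + 1) * clifford n (s * r\<^sup>2))
          + B * of_real (2 * r ^ (2 * n + 1) * clifford n (t * r\<^sup>2)))) (at r)"
      unfolding K_def
      by (intro has_vector_derivative_diff has_vector_derivative_add has_vector_derivative_mult_right
          flux_deriv[OF f r] clifford_flux_deriv)
    also have "r ^ (2 * n + 1) = r ^ (n + 1) * r ^ n"
      by (simp only: power_add[symmetric]) (simp add: mult_2)
    also have "2 * (of_real r ^ (n + 1) * h r)
       - (A * of_real (2 * (r ^ (n + 1) * r ^ n) * clifford n (s * r\<^sup>2))
          + B * of_real (2 * (r ^ (n + 1) * r ^ n) * clifford n (t * r\<^sup>2))) = 0"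
      by (simp add: h[OF r] algebra_simps)
    finally show "(K has_vector_derivative 0) (at r)" .
  qed simp
  moreover have "K 1 = - (A * of_real (clifford (Suc n) s) + B * of_real (clifford (Suc n) t))"
    using \<open>f 1 = 0\<close> \<open>f' 1 = 0\<close> by (simp add: K_def flux_def clifford_flux_def)
  ultimately show ?thesis by (metis neg_equal_0_iff_equal)
qed

text \<open>The case \<open>s = 0\<close> of \<open>radial_eigenfunction\<close>: \<open>f\<close> is a multiple of \<open>r\<^sup>n\<close>.\<close>

lemma radial_harmonic_trivial:
  assumes f: "radial_laplacian n f f' h" and "f 1 = 0" and "\<And>r. r \<in> {0<..<1} \<Longrightarrow> h r = 0"
    and r: "r \<in> {0..1}"
  shows "f r = 0"
proof -
  have "radial_laplacian n f f' (\<lambda>r. of_real (4 * 0) * f r)"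
    using radial_laplacian_cong[OF f] assms(3) by simp
  then obtain B where B: "\<And>r. r \<in> {0..1} \<Longrightarrow> f r = B * of_real (r ^ n * clifford n (0 * r\<^sup>2))"
    by (rule radial_eigenfunction) auto
  from B[of 1] \<open>f 1 = 0\<close> have "B = 0" by simp
  thus ?thesis using B[OF r] by simp
qed

section \<open>Radial profiles of functions on the disc\<close>

lemma has_partials_curve:
  assumes f: "has_partials f a b (at (x t, y t))"
    and x: "(x has_real_derivative x') (at t)" and y: "(y has_real_derivative y') (at t)"
  shows "((\<lambda>t. f (x t, y t)) has_vector_derivative x' *\<^sub>R a + y' *\<^sub>R b) (at t)"
proof -
  have "((\<lambda>t. (x t, y t)) has_derivative (\<lambda>h. (x' * h, y' * h))) (at t)"
    using x y by (intro has_derivative_Pair) (simp_all add: has_field_derivative_def)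
  from has_derivative_compose[OF this f]
  show ?thesis unfolding has_vector_derivative_def
    by (rule has_derivative_eq_rhs) (simp add: fun_eq_iff scaleR_right_distrib mult_ac)
qed

lemma has_vector_derivative_unique_open:
  fixes f g :: "real \<Rightarrow> complex"
  assumes "(f has_vector_derivative a) (at r)" "(g has_vector_derivative b) (at r)"
    and "open S" "r \<in> S" "\<And>t. t \<in> S \<Longrightarrow> f t = g t"
  shows "a = b"
  using vector_derivative_unique_at[OF has_vector_derivative_transform_within_open[OF assms(1,3,4,5)] assms(2)] .

text \<open>The polar form of the Laplacian. Comparing the radial and the angular derivatives of both sides of
\<open>f(r e\<^sup>i\<^sup>\<theta>) = e\<^sup>i\<^sup>n\<^sup>\<theta> f(r)\<close>, twice each, expresses all terms by derivatives along the ray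
\<open>\<theta> = 0\<close>. The mixed derivatives cancel in the sum, in whichever order they were taken.\<close>

lemma polar_laplacian:
  assumes f: "Ck_disc 2 f"
    and az: "\<And>r \<theta>. r \<in> {0<..<1} \<Longrightarrow> f (polar r \<theta>) = cis (real n * \<theta>) * f (r, 0)"
  obtains f' where "radial_laplacian n (\<lambda>r. f (r, 0)) f' (\<lambda>r. laplacian f (r, 0))"
    and "((\<lambda>r. f (r, 0)) has_vector_derivative f' 1) (at 1 within {0..1})"
    and "\<And>r \<theta>. r \<in> {0<..<1} \<Longrightarrow> laplacian f (polar r \<theta>) = cis (real n * \<theta>) * laplacian f (r, 0)"
proof -
  obtain fx fy fxx fxy fyx fyy where F:
    "\<And>p. p \<in> closed_disc \<Longrightarrow> has_partials f (fx p) (fy p) (at p within closed_disc)"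
    "\<And>p. p \<in> closed_disc \<Longrightarrow> has_partials fx (fxx p) (fxy p) (at p within closed_disc)"
    "\<And>p. p \<in> closed_disc \<Longrightarrow> has_partials fy (fyx p) (fyy p) (at p within closed_disc)"
    "Ck_disc 0 fxx" "Ck_disc 0 fyy"
    "\<And>p. p \<in> disc \<Longrightarrow> laplacian f p = fxx p + fyy p"
    using f unfolding numeral_2_eq_2 by (rule Ck_disc_partials) (rule that)
  have Fd: "has_partials f (fx p) (fy p) (at p)" "has_partials fx (fxx p) (fxy p) (at p)"
    "has_partials fy (fyx p) (fyy p) (at p)" if "p \<in> disc" for p
    using F(1-3)[of p] that at_within_closed_disc[OF that] by simp_all
  have in_disc: "polar r \<theta> \<in> disc" if "r \<in> {0<..<1}" for r \<theta>
    using that by (simp add: norm_polar)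
  have radial: "((\<lambda>r. g (polar r \<theta>)) has_vector_derivative cos \<theta> *\<^sub>R a + sin \<theta> *\<^sub>R b) (at r)"
    if "has_partials g a b (at (polar r \<theta>))" for g a b r \<theta>
    using that unfolding polar_def
    by (intro has_partials_curve) (auto intro!: derivative_eq_intros)
  have angular: "((\<lambda>\<theta>. g (polar r \<theta>)) has_vector_derivative (- r * sin \<theta>) *\<^sub>R a + (r * cos \<theta>) *\<^sub>R b) (at \<theta>)"
    if "has_partials g a b (at (polar r \<theta>))" for g a b r \<theta>
    using that unfolding polar_def
    by (intro has_partials_curve) (auto intro!: derivative_eq_intros)
  have f': "((\<lambda>r. f (r, 0)) has_vector_derivative fx (r, 0)) (at r)"
    and f'': "((\<lambda>r. fx (r, 0)) has_vector_derivative fxx (r, 0)) (at r)" if "r \<in> {0<..<1}" for r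
    using radial[OF Fd(1)[OF in_disc[OF that]], of 0] radial[OF Fd(2)[OF in_disc[OF that]], of 0]
    by (simp_all add: polar_0)
  have cis': "((\<lambda>\<theta>. cis (real n * \<theta>) * c) has_vector_derivative \<i> * of_nat n * (cis (real n * \<theta>) * c)) (at \<theta>)" for c \<theta>
    unfolding has_vector_derivative_def
    by (auto intro!: derivative_eq_intros simp: fun_eq_iff scaleR_conv_of_real)
  have key: "laplacian f (polar r \<theta>)
      = cis (real n * \<theta>) * (fxx (r, 0) + fx (r, 0) / of_real r - of_nat n ^ 2 * f (r, 0) / of_real r ^ 2)"
    if r: "r \<in> {0<..<1}" for r \<theta>
  proof -
    define E where "E = cis (real n * \<theta>)"
    define p where "p = polar r \<theta>"
    \<comment> \<open>Both sides of the polar form of \<open>f\<close> are the same function of \<open>r\<close>, so their derivatives agree.\<close>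
    have r1: "cos \<theta> *\<^sub>R fx (polar t \<theta>) + sin \<theta> *\<^sub>R fy (polar t \<theta>) = E * fx (t, 0)"
      if t: "t \<in> {0<..<1}" for t
      by (rule has_vector_derivative_unique_open[OF radial[OF Fd(1)[OF in_disc[OF t]]]
            has_vector_derivative_mult_right[OF f'[OF t]] open_greaterThanLessThan t])
         (simp add: az E_def)
    have r2: "cos \<theta> *\<^sub>R (cos \<theta> *\<^sub>R fxx p + sin \<theta> *\<^sub>R fxy p) + sin \<theta> *\<^sub>R (cos \<theta> *\<^sub>R fyx p + sin \<theta> *\<^sub>R fyy p)
        = E * fxx (r, 0)"
    proof (rule has_vector_derivative_unique_open[OF _ has_vector_derivative_mult_right[OF f''[OF r]]
          open_greaterThanLessThan r r1])
      show "((\<lambda>t. cos \<theta> *\<^sub>R fx (polar t \<theta>) + sin \<theta> *\<^sub>R fy (polar t \<theta>)) has_vector_derivative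
          cos \<theta> *\<^sub>R (cos \<theta> *\<^sub>R fxx p + sin \<theta> *\<^sub>R fxy p) + sin \<theta> *\<^sub>R (cos \<theta> *\<^sub>R fyx p + sin \<theta> *\<^sub>R fyy p)) (at r)"
        unfolding p_def
        by (intro has_vector_derivative_add bounded_linear.has_vector_derivative[OF bounded_linear_scaleR_right]
            radial Fd in_disc r)
    qed
    \<comment> \<open>The same comparison for functions of the angle, on a fixed circle.\<close>
    have a1: "(- r * sin t) *\<^sub>R fx (polar r t) + (r * cos t) *\<^sub>R fy (polar r t)
        = \<i> * of_nat n * (cis (real n * t) * f (r, 0))" for t
      by (rule has_vector_derivative_unique_open[OF angular[OF Fd(1)[OF in_disc[OF r]]] cis' open_UNIV])
         (simp_all add: az[OF r])
    have a2: "((- r * sin \<theta>) *\<^sub>R ((- r * sin \<theta>) *\<^sub>R fxx p + (r * cos \<theta>) *\<^sub>R fxy p) + (- r * cos \<theta>) *\<^sub>R fx p)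
        + ((r * cos \<theta>) *\<^sub>R ((- r * sin \<theta>) *\<^sub>R fyx p + (r * cos \<theta>) *\<^sub>R fyy p) + (- r * sin \<theta>) *\<^sub>R fy p)
        = \<i> * of_nat n * (\<i> * of_nat n * (E * f (r, 0)))"
      unfolding E_def
    proof (rule has_vector_derivative_unique_open[OF _ has_vector_derivative_mult_right[OF cis'] open_UNIV UNIV_I a1])
      show "((\<lambda>t. (- r * sin t) *\<^sub>R fx (polar r t) + (r * cos t) *\<^sub>R fy (polar r t)) has_vector_derivative
        ((- r * sin \<theta>) *\<^sub>R ((- r * sin \<theta>) *\<^sub>R fxx p + (r * cos \<theta>) *\<^sub>R fxy p) + (- r * cos \<theta>) *\<^sub>R fx p)
        + ((r * cos \<theta>) *\<^sub>R ((- r * sin \<theta>) *\<^sub>R fyx p + (r * cos \<theta>) *\<^sub>R fyy p) + (- r * sin \<theta>) *\<^sub>R fy p)) (at \<theta>)"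
        unfolding p_def
        by (intro has_vector_derivative_add has_vector_derivative_scaleR angular Fd in_disc r)
           (auto intro!: derivative_eq_intros)
    qed
    define c s where "c = complex_of_real (cos \<theta>)" "s = complex_of_real (sin \<theta>)"
    define X where "X = complex_of_real r"
    have cs: "c\<^sup>2 + s\<^sup>2 = 1" unfolding c_s_def
      by (metis of_real_add of_real_power of_real_1 sin_cos_squared_add2)
    have X: "X \<noteq> 0" using r by (simp add: X_def)
    have "X\<^sup>2 * (fxx p + fyy p) = X\<^sup>2 * ((c\<^sup>2 + s\<^sup>2) * (fxx p + fyy p))" by (simp add: cs)
    also have "\<dots> = X\<^sup>2 * (c * (c * fxx p + s * fxy p) + s * (c * fyx p + s * fyy p))
        + ((- X * s) * ((- X * s) * fxx p + (X * c) * fxy p) + (- X * c) * fx p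
        + ((X * c) * ((- X * s) * fyx p + (X * c) * fyy p) + (- X * s) * fy p))
        + X * (c * fx p + s * fy p)"
      by (simp add: algebra_simps power2_eq_square)
    also have "c * (c * fxx p + s * fxy p) + s * (c * fyx p + s * fyy p) = E * fxx (r, 0)"
      using r2 by (simp add: scaleR_conv_of_real c_s_def)
    also have "c * fx p + s * fy p = E * fx (r, 0)"
      using r1[OF r] by (simp add: scaleR_conv_of_real c_s_def p_def)
    also have "(- X * s) * ((- X * s) * fxx p + (X * c) * fxy p) + (- X * c) * fx p
        + ((X * c) * ((- X * s) * fyx p + (X * c) * fyy p) + (- X * s) * fy p)
        = \<i> * of_nat n * (\<i> * of_nat n * (E * f (r, 0)))"
      using a2 by (simp add: scaleR_conv_of_real c_s_def X_def)
    finally have "X\<^sup>2 * (fxx p + fyy p) = E * (X\<^sup>2 * fxx (r, 0) + X * fx (r, 0) - of_nat n ^ 2 * f (r, 0))"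
      by (simp add: algebra_simps power2_eq_square)
    also have "\<dots> = X\<^sup>2 * (E * (fxx (r, 0) + fx (r, 0) / X - of_nat n ^ 2 * f (r, 0) / X ^ 2))"
      using X by (simp add: field_simps power2_eq_square)
    finally have "fxx p + fyy p = E * (fxx (r, 0) + fx (r, 0) / X - of_nat n ^ 2 * f (r, 0) / X ^ 2)"
      using X by simp
    thus ?thesis using F(6)[OF in_disc[OF r]] by (simp add: p_def E_def X_def)
  qed
  have key0: "laplacian f (r, 0) = fxx (r, 0) + fx (r, 0) / of_real r - of_nat n ^ 2 * f (r, 0) / of_real r ^ 2"
    if "r \<in> {0<..<1}" for r
    using key[OF that, of 0] by (simp add: polar_0)
  have seg: "(r, 0) \<in> closed_disc" if "r \<in> {0..1}" for r :: real
    using that by (simp add: norm_Pair)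
  have cont: "continuous_on {0..1} (\<lambda>r. g (r, 0))" if "continuous_on closed_disc g" for g :: "real \<times> real \<Rightarrow> complex"
    by (rule continuous_on_compose2[OF that]) (use seg in \<open>auto intro!: continuous_intros\<close>)
  have "continuous_on closed_disc fx"
    unfolding continuous_on_eq_continuous_within using F(2) by (blast intro: has_derivative_continuous)
  show thesis
  proof (rule that[of "\<lambda>r. fx (r, 0)"])
    show "radial_laplacian n (\<lambda>r. f (r, 0)) (\<lambda>r. fx (r, 0)) (\<lambda>r. laplacian f (r, 0))"
      unfolding radial_laplacian_def
      using cont[OF Ck_disc_continuous[OF f]] cont[OF \<open>continuous_on closed_disc fx\<close>] f' f'' key0
      by simp
    show "laplacian f (polar r \<theta>) = cis (real n * \<theta>) * laplacian f (r, 0)" if "r \<in> {0<..<1}" for r \<theta>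
      using key[OF that] key0[OF that] by simp
    have "((\<lambda>r. f (r, 0)) has_derivative (\<lambda>h. fst (h, 0 :: real) *\<^sub>R fx (1, 0) + snd (h, 0 :: real) *\<^sub>R fy (1, 0))) (at 1 within {0..1})"
      by (rule has_derivative_in_compose2[OF F(1), of "\<lambda>r. (r, 0)" "{0..1}" 1 "\<lambda>h. (h, 0)"])
         (use seg in \<open>auto intro!: derivative_eq_intros\<close>)
    thus "((\<lambda>r. f (r, 0)) has_vector_derivative fx (1, 0)) (at 1 within {0..1})"
      by (simp add: has_vector_derivative_def)
  qed
qed

lemma zero_of_profile_zero:
  assumes "azimuthal m f" "\<And>r. r \<in> {0..1} \<Longrightarrow> f (r, 0) = 0" "p \<in> closed_disc"
  shows "f p = 0"
proof -
  obtain r \<theta> where p: "r \<ge> 0" "p = polar r \<theta>" "r = norm p" by (rule polar_exists) (rule that)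
  have "r \<le> 1" using p(3) assms(3) by simp
  hence "f (polar r \<theta>) = cis (of_int m * \<theta>) * f (r, 0)"
    using assms(1) p(1) unfolding azimuthal_iff by simp
  thus ?thesis using assms(2)[of r] p(1) \<open>r \<le> 1\<close> unfolding p(2) by simp
qed

section \<open>The eigenvalue problem in one wavenumber\<close>

text \<open>The eigenvalue problem in one wavenumber: \<open>\<partial>\<^sub>\<theta>\<close> has become multiplication by \<open>i m\<close>, and the zero
solution is admitted, so that the solutions form a linear space.\<close>

definition mode_solution ::
  "real \<Rightarrow> real \<Rightarrow> int \<Rightarrow> real \<Rightarrow> (real \<times> real \<Rightarrow> complex) \<Rightarrow> (real \<times> real \<Rightarrow> complex) \<Rightarrow> bool" where
  "mode_solution \<epsilon> R m \<beta> w \<psi> \<longleftrightarrow>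
     Ck_disc 3 w \<and> Ck_disc 4 \<psi> \<and> azimuthal m w \<and> azimuthal m \<psi> \<and>
     (\<forall>p\<in>disc. of_real (1 / R) * laplacian w p + \<i> * of_int m * of_real R * \<psi> p
          = of_real \<beta> * (w p - of_real \<epsilon> * laplacian w p)) \<and>
     (\<forall>p\<in>disc. of_real (1 / R) * laplacian (laplacian \<psi>) p
            - \<i> * of_int m * of_real (\<epsilon> * R) * laplacian w p
          = of_real \<beta> * (laplacian \<psi> p - of_real \<epsilon> * laplacian (laplacian \<psi>) p)) \<and>
     (\<forall>\<theta>. w (polar 1 \<theta>) = 0 \<and> \<psi> (polar 1 \<theta>) = 0 \<and>
        ((\<lambda>r. \<psi> (polar r \<theta>)) has_vector_derivative 0) (at 1 within {0..1}))"

lemma laplacian_cmult: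
  assumes "Ck_disc 2 f" "p \<in> disc"
  shows "laplacian (\<lambda>p. a * f p) p = a * laplacian f p"
  using laplacian_linear[OF assms(1) assms(1) assms(2), of a 0] by simp

lemma mode_eigenvector_iff:
  "mode_eigenvector \<epsilon> R m (of_real \<beta>) w \<psi> \<longleftrightarrow>
     mode_solution \<epsilon> R m \<beta> w \<psi> \<and> (\<exists>p\<in>disc. w p \<noteq> 0 \<or> \<psi> p \<noteq> 0)"
proof (cases "Ck_disc 3 w \<and> azimuthal m w \<and> azimuthal m \<psi>")
  case True
  have th: "theta_deriv w p = \<i> * of_int m * w p" "theta_deriv \<psi> p = \<i> * of_int m * \<psi> p" if "p \<in> disc" for p
    using theta_deriv_azimuthal[of m _ p] True that by auto
  have w2: "Ck_disc 2 w" by (rule Ck_disc_le[of 3]) (use True in auto)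
  have "laplacian (theta_deriv w) p = \<i> * of_int m * laplacian w p" if "p \<in> disc" for p
    using laplacian_cong[OF th(1) that] laplacian_cmult[OF w2 that] by simp
  hence eq: "((1 / R) *\<^sub>R laplacian w p + R *\<^sub>R theta_deriv \<psi> p = \<beta> * (w p - \<epsilon> *\<^sub>R laplacian w p))
      \<longleftrightarrow> (of_real (1 / R) * laplacian w p + \<i> * of_int m * of_real R * \<psi> p
          = of_real \<beta> * (w p - of_real \<epsilon> * laplacian w p))"
    "((1 / R) *\<^sub>R laplacian (laplacian \<psi>) p - (\<epsilon> * R) *\<^sub>R laplacian (theta_deriv w) p
          = \<beta> * (laplacian \<psi> p - \<epsilon> *\<^sub>R laplacian (laplacian \<psi>) p))
      \<longleftrightarrow> (of_real (1 / R) * laplacian (laplacian \<psi>) p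
            - \<i> * of_int m * of_real (\<epsilon> * R) * laplacian w p
          = of_real \<beta> * (laplacian \<psi> p - of_real \<epsilon> * laplacian (laplacian \<psi>) p))"
    if "p \<in> disc" for p
    using th[OF that] that by (simp_all add: scaleR_conv_of_real mult_ac)
  show ?thesis
    unfolding mode_eigenvector_def eigenvector_def mode_solution_def using True eq by blast
next
  case False
  thus ?thesis by (auto simp: mode_eigenvector_def eigenvector_def mode_solution_def)
qed

lemma Ck_disc_laplacian_4:
  assumes "Ck_disc 4 f"
  obtains L where "Ck_disc 2 L" "\<And>p. p \<in> disc \<Longrightarrow> laplacian f p = L p"
    "\<And>p. p \<in> disc \<Longrightarrow> laplacian (laplacian f) p = laplacian L p"
proof -
  have "Ck_disc (Suc (Suc 2)) f" using assms by (simp add: eval_nat_numeral)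
  then obtain L where L: "Ck_disc 2 L" "\<And>p. p \<in> disc \<Longrightarrow> laplacian f p = L p"
    by (rule Ck_disc_laplacian) (rule that)
  thus thesis using that[of L] laplacian_cong[of "laplacian f" L] by blast
qed

lemma azimuthal_linear:
  assumes "azimuthal m f" "azimuthal m g"
  shows "azimuthal m (\<lambda>p. a * f p + b * g p)"
  using assms by (auto simp: azimuthal_iff algebra_simps)

lemma mode_solution_linear:
  assumes 1: "mode_solution \<epsilon> R m \<beta> w \<psi>" and 2: "mode_solution \<epsilon> R m \<beta> v \<xi>"
  shows "mode_solution \<epsilon> R m \<beta> (\<lambda>p. a * w p + b * v p) (\<lambda>p. a * \<psi> p + b * \<xi> p)"
proof -
  note D = mode_solution_def
  have C: "Ck_disc 3 w" "Ck_disc 3 v" "Ck_disc 4 \<psi>" "Ck_disc 4 \<xi>"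
    using 1 2 unfolding D by blast+
  have C2: "Ck_disc 2 w" "Ck_disc 2 v" "Ck_disc 2 \<psi>" "Ck_disc 2 \<xi>"
    using C by (auto intro: Ck_disc_le)
  note lw = laplacian_linear[OF C2(1,2), of _ a b] and l\<psi> = laplacian_linear[OF C2(3,4), of _ a b]
  obtain L where L: "Ck_disc 2 L" "\<And>p. p \<in> disc \<Longrightarrow> laplacian \<psi> p = L p"
    "\<And>p. p \<in> disc \<Longrightarrow> laplacian (laplacian \<psi>) p = laplacian L p"
    using C(3) by (rule Ck_disc_laplacian_4) (rule that)
  obtain K where K: "Ck_disc 2 K" "\<And>p. p \<in> disc \<Longrightarrow> laplacian \<xi> p = K p"
    "\<And>p. p \<in> disc \<Longrightarrow> laplacian (laplacian \<xi>) p = laplacian K p"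
    using C(4) by (rule Ck_disc_laplacian_4) (rule that)
  have ll: "laplacian (laplacian (\<lambda>p. a * \<psi> p + b * \<xi> p)) p
      = a * laplacian (laplacian \<psi>) p + b * laplacian (laplacian \<xi>) p" if p: "p \<in> disc" for p
  proof -
    have "laplacian (laplacian (\<lambda>p. a * \<psi> p + b * \<xi> p)) p = laplacian (\<lambda>p. a * L p + b * K p) p"
      by (rule laplacian_cong[OF _ p]) (simp only: l\<psi> L(2) K(2))
    also have "\<dots> = a * laplacian L p + b * laplacian K p"
      by (rule laplacian_linear[OF L(1) K(1) p])
    finally show ?thesis by (simp only: L(3)[OF p] K(3)[OF p])
  qed
  show ?thesis unfolding D
  proof (intro conjI ballI allI)
    show "Ck_disc 3 (\<lambda>p. a * w p + b * v p)" "Ck_disc 4 (\<lambda>p. a * \<psi> p + b * \<xi> p)"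
      using C by (auto intro!: Ck_disc_add Ck_disc_mult Ck_disc_const)
    show "azimuthal m (\<lambda>p. a * w p + b * v p)" "azimuthal m (\<lambda>p. a * \<psi> p + b * \<xi> p)"
      using 1 2 unfolding D by (blast intro: azimuthal_linear)+
  next
    fix p assume p: "p \<in> disc"
    have e: "of_real (1 / R) * laplacian w p + \<i> * of_int m * of_real R * \<psi> p
          = of_real \<beta> * (w p - of_real \<epsilon> * laplacian w p)"
      "of_real (1 / R) * laplacian v p + \<i> * of_int m * of_real R * \<xi> p
          = of_real \<beta> * (v p - of_real \<epsilon> * laplacian v p)"
      using 1 2 p unfolding D by blast+
    show "of_real (1 / R) * laplacian (\<lambda>p. a * w p + b * v p) p + \<i> * of_int m * of_real R * (a * \<psi> p + b * \<xi> p)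
          = of_real \<beta> * (a * w p + b * v p - of_real \<epsilon> * laplacian (\<lambda>p. a * w p + b * v p) p)"
      using arg_cong2[OF arg_cong[OF e(1), of "(*) a"] arg_cong[OF e(2), of "(*) b"], of "(+)"]
      unfolding lw[OF p] by (simp add: algebra_simps)
    have e: "of_real (1 / R) * laplacian (laplacian \<psi>) p
            - \<i> * of_int m * of_real (\<epsilon> * R) * laplacian w p
          = of_real \<beta> * (laplacian \<psi> p - of_real \<epsilon> * laplacian (laplacian \<psi>) p)"
      "of_real (1 / R) * laplacian (laplacian \<xi>) p
            - \<i> * of_int m * of_real (\<epsilon> * R) * laplacian v p
          = of_real \<beta> * (laplacian \<xi> p - of_real \<epsilon> * laplacian (laplacian \<xi>) p)"
      using 1 2 p unfolding D by blast+
    show "of_real (1 / R) * laplacian (laplacian (\<lambda>p. a * \<psi> p + b * \<xi> p)) p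
            - \<i> * of_int m * of_real (\<epsilon> * R) * laplacian (\<lambda>p. a * w p + b * v p) p
          = of_real \<beta> * (laplacian (\<lambda>p. a * \<psi> p + b * \<xi> p) p
              - of_real \<epsilon> * laplacian (laplacian (\<lambda>p. a * \<psi> p + b * \<xi> p)) p)"
      using arg_cong2[OF arg_cong[OF e(1), of "(*) a"] arg_cong[OF e(2), of "(*) b"], of "(+)"]
      unfolding lw[OF p] ll[OF p] l\<psi>[OF p] by (simp add: algebra_simps)
  next
    fix \<theta>
    have b: "w (polar 1 \<theta>) = 0" "v (polar 1 \<theta>) = 0" "\<psi> (polar 1 \<theta>) = 0" "\<xi> (polar 1 \<theta>) = 0"
      "((\<lambda>r. \<psi> (polar r \<theta>)) has_vector_derivative 0) (at 1 within {0..1})"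
      "((\<lambda>r. \<xi> (polar r \<theta>)) has_vector_derivative 0) (at 1 within {0..1})"
      using 1 2 unfolding D by blast+
    show "a * w (polar 1 \<theta>) + b * v (polar 1 \<theta>) = 0" "a * \<psi> (polar 1 \<theta>) + b * \<xi> (polar 1 \<theta>) = 0"
      using b by simp_all
    have "((\<lambda>r. a * \<psi> (polar r \<theta>) + b * \<xi> (polar r \<theta>)) has_vector_derivative a * 0 + b * 0) (at 1 within {0..1})"
      by (intro has_vector_derivative_add has_vector_derivative_mult_right b)
    thus "((\<lambda>r. a * \<psi> (polar r \<theta>) + b * \<xi> (polar r \<theta>)) has_vector_derivative 0) (at 1 within {0..1})"
      by simp
  qed
qed

text \<open>Conjugating the equations changes \<open>i m\<close> into \<open>- i m\<close> and nothing else, as \<open>\<beta>\<close> is real.\<close>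

lemma mode_solution_cnj:
  assumes 1: "mode_solution \<epsilon> R m \<beta> w \<psi>"
  shows "mode_solution \<epsilon> R (- m) \<beta> (\<lambda>p. cnj (w p)) (\<lambda>p. cnj (\<psi> p))"
proof -
  note D = mode_solution_def
  have C: "Ck_disc 3 w" "Ck_disc 4 \<psi>"
    using 1 unfolding D by blast+
  have C2: "Ck_disc 2 w" "Ck_disc 2 \<psi>"
    using C by (auto intro: Ck_disc_le)
  note lw = laplacian_cnj[OF C2(1)] and l\<psi> = laplacian_cnj[OF C2(2)]
  obtain L where L: "Ck_disc 2 L" "\<And>p. p \<in> disc \<Longrightarrow> laplacian \<psi> p = L p"
    "\<And>p. p \<in> disc \<Longrightarrow> laplacian (laplacian \<psi>) p = laplacian L p"
    using C(2) by (rule Ck_disc_laplacian_4) (rule that)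
  have ll: "laplacian (laplacian (\<lambda>p. cnj (\<psi> p))) p = cnj (laplacian (laplacian \<psi>) p)" if p: "p \<in> disc" for p
  proof -
    have "laplacian (laplacian (\<lambda>p. cnj (\<psi> p))) p = laplacian (\<lambda>p. cnj (L p)) p"
      by (rule laplacian_cong[OF _ p]) (simp only: l\<psi> L(2))
    also have "\<dots> = cnj (laplacian L p)"
      by (rule laplacian_cnj[OF L(1) p])
    finally show ?thesis by (simp only: L(3)[OF p])
  qed
  have az: "azimuthal (- m) (\<lambda>p. cnj (f p))" if "azimuthal m f" for f
    using that by (simp add: azimuthal_iff cis_cnj)
  show ?thesis unfolding D
  proof (intro conjI ballI allI)
    show "Ck_disc 3 (\<lambda>p. cnj (w p))" "Ck_disc 4 (\<lambda>p. cnj (\<psi> p))"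
      using C by (auto intro!: Ck_disc_cnj)
    show "azimuthal (- m) (\<lambda>p. cnj (w p))" "azimuthal (- m) (\<lambda>p. cnj (\<psi> p))"
      using 1 unfolding D by (blast intro: az)+
  next
    fix p assume p: "p \<in> disc"
    have e: "of_real (1 / R) * laplacian w p + \<i> * of_int m * of_real R * \<psi> p
          = of_real \<beta> * (w p - of_real \<epsilon> * laplacian w p)"
      "of_real (1 / R) * laplacian (laplacian \<psi>) p
            - \<i> * of_int m * of_real (\<epsilon> * R) * laplacian w p
          = of_real \<beta> * (laplacian \<psi> p - of_real \<epsilon> * laplacian (laplacian \<psi>) p)"
      using 1 p unfolding D by blast+
    show "of_real (1 / R) * laplacian (\<lambda>p. cnj (w p)) p + \<i> * of_int (- m) * of_real R * cnj (\<psi> p)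
          = of_real \<beta> * (cnj (w p) - of_real \<epsilon> * laplacian (\<lambda>p. cnj (w p)) p)"
      using arg_cong[OF e(1), of cnj] unfolding lw[OF p] by simp
    show "of_real (1 / R) * laplacian (laplacian (\<lambda>p. cnj (\<psi> p))) p
            - \<i> * of_int (- m) * of_real (\<epsilon> * R) * laplacian (\<lambda>p. cnj (w p)) p
          = of_real \<beta> * (laplacian (\<lambda>p. cnj (\<psi> p)) p - of_real \<epsilon> * laplacian (laplacian (\<lambda>p. cnj (\<psi> p))) p)"
      using arg_cong[OF e(2), of cnj] unfolding lw[OF p] ll[OF p] l\<psi>[OF p] by simp
  next
    fix \<theta>
    have b: "w (polar 1 \<theta>) = 0" "\<psi> (polar 1 \<theta>) = 0"
      "((\<lambda>r. \<psi> (polar r \<theta>)) has_vector_derivative 0) (at 1 within {0..1})"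
      using 1 unfolding D by blast+
    show "cnj (w (polar 1 \<theta>)) = 0" "cnj (\<psi> (polar 1 \<theta>)) = 0"
      using b by simp_all
    show "((\<lambda>r. cnj (\<psi> (polar r \<theta>))) has_vector_derivative 0) (at 1 within {0..1})"
      using bounded_linear.has_vector_derivative[OF bounded_linear_cnj b(3)] by simp
  qed
qed

section \<open>Rigidity when the determinant does not vanish\<close>

text \<open>With \<open>b = \<beta> / a\<close>, \<open>c = n R / a\<close>, \<open>e = \<surd>\<epsilon>\<close>, the Laplacian acts on the pair \<open>(L, h) = (\<Delta>\<psi>, \<Delta>w)\<close> by
the matrix with rows \<open>(b, i e\<^sup>2 c)\<close> and \<open>(- i c, b)\<close>; \<open>L \<plusminus> i e h\<close> diagonalise it.\<close>

lemma coupling_eigenvector_plus: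
  fixes b c e L h :: complex
  shows "1 * (b * L + \<i> * (e * e * c) * h) + \<i> * e * (b * h + - \<i> * c * L) = (b + c * e) * (1 * L + \<i> * e * h)"
  by (simp add: algebra_simps)

lemma coupling_eigenvector_minus:
  fixes b c e L h :: complex
  shows "1 * (b * L + \<i> * (e * e * c) * h) + - \<i> * e * (b * h + - \<i> * c * L) = (b - c * e) * (1 * L + - \<i> * e * h)"
  by (simp add: algebra_simps)

text \<open>The main computation. The alternative to a nonvanishing determinant, the vanishing of
\<open>\<Delta>\<psi> + i \<surd>\<epsilon> \<Delta>w\<close> at one point of the ray, is one linear condition on \<open>(w, \<psi>)\<close>. It shows
that the space of solutions is at most one-dimensional when the determinant is zero. The value
\<open>1 / 2\<close> of the radius is arbitrary.\<close>

lemma mode_solution_trivial: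
  assumes sol: "mode_solution \<epsilon> R (int n) \<beta> w \<psi>" and "\<epsilon> > 0" "R > 0" "\<beta> \<ge> 0"
    and a: "a = 1 / R + \<beta> * \<epsilon>"
    and p: "p = (n * R * sqrt \<epsilon> - \<beta>) / (4 * a)" and q: "q = (n * R * sqrt \<epsilon> + \<beta>) / (4 * a)"
    and pos: "\<And>r. r \<in> {0<..1} \<Longrightarrow> clifford (Suc n) (- p * r\<^sup>2) > 0"
    and alt: "freq n p q \<noteq> 0 \<or> laplacian \<psi> (1 / 2, 0) + \<i> * of_real (sqrt \<epsilon>) * laplacian w (1 / 2, 0) = 0"
    and z: "z \<in> closed_disc"
  shows "w z = 0 \<and> \<psi> z = 0"
proof -
  note D = mode_solution_def
  have C: "Ck_disc 3 w" "Ck_disc 4 \<psi>" "azimuthal (int n) w" "azimuthal (int n) \<psi>"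
    using sol unfolding D by blast+
  have C2: "Ck_disc 2 w" "Ck_disc 2 \<psi>"
    using C by (auto intro: Ck_disc_le)
  obtain L where L: "Ck_disc 2 L" "\<And>p. p \<in> disc \<Longrightarrow> laplacian \<psi> p = L p"
    "\<And>p. p \<in> disc \<Longrightarrow> laplacian (laplacian \<psi>) p = laplacian L p"
    using C(2) by (rule Ck_disc_laplacian_4) (rule that)
  have az: "w (polar r \<theta>) = cis (real n * \<theta>) * w (r, 0)" "\<psi> (polar r \<theta>) = cis (real n * \<theta>) * \<psi> (r, 0)"
    if "r \<in> {0<..<1}" for r \<theta>
    using C(3,4) that by (auto simp: azimuthal_iff)
  obtain w' where w': "radial_laplacian n (\<lambda>r. w (r, 0)) w' (\<lambda>r. laplacian w (r, 0))"
    by (rule polar_laplacian[OF C2(1) az(1)])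
  obtain \<psi>' where \<psi>': "radial_laplacian n (\<lambda>r. \<psi> (r, 0)) \<psi>' (\<lambda>r. laplacian \<psi> (r, 0))"
    "((\<lambda>r. \<psi> (r, 0)) has_vector_derivative \<psi>' 1) (at 1 within {0..1})"
    "\<And>r \<theta>. r \<in> {0<..<1} \<Longrightarrow> laplacian \<psi> (polar r \<theta>) = cis (real n * \<theta>) * laplacian \<psi> (r, 0)"
    by (rule polar_laplacian[OF C2(2) az(2)], assumption, rule that)
  have disc0: "(r, 0) \<in> disc" "polar r \<theta> \<in> disc" if "r \<in> {0<..<1}" for r \<theta> :: real
    using that by (simp_all add: norm_polar norm_Pair)
  have "L (polar r \<theta>) = cis (real n * \<theta>) * L (r, 0)" if "r \<in> {0<..<1}" for r \<theta>
    using \<psi>'(3)[OF that] unfolding L(2)[OF disc0(1)[OF that]] L(2)[OF disc0(2)[OF that]] .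
  then obtain \<phi>' where \<phi>': "radial_laplacian n (\<lambda>r. L (r, 0)) \<phi>' (\<lambda>r. laplacian L (r, 0))"
    by (rule polar_laplacian[OF L(1)])
  define k where "k = real n * R"
  define e where "e = sqrt \<epsilon>"
  have e: "e > 0" "\<epsilon> = e\<^sup>2" using \<open>\<epsilon> > 0\<close> by (simp_all add: e_def)
  have "a > 0" using \<open>R > 0\<close> \<open>\<beta> \<ge> 0\<close> \<open>\<epsilon> > 0\<close> unfolding a by (simp add: add_pos_nonneg)
  \<comment> \<open>The first equation turns \<open>\<Delta>w\<close> into a combination of \<open>w\<close> and \<open>\<psi>\<close>: this makes it twice differentiable, although \<open>w\<close> is only of class \<open>C\<^sup>3\<close>, and zero on the circle.\<close>
  define \<eta> where "\<eta> = (\<lambda>r. of_real (\<beta> / a) * w (r, 0) + (- \<i> * of_real (k / a)) * \<psi> (r, 0))"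
  have lw: "laplacian w (r, 0) = \<eta> r" if r: "r \<in> {0<..<1}" for r
  proof -
    have "of_real (1 / R) * laplacian w (r, 0) + \<i> * of_int n * of_real R * \<psi> (r, 0)
          = of_real \<beta> * (w (r, 0) - of_real \<epsilon> * laplacian w (r, 0))"
      using sol disc0(1)[OF r] unfolding D by blast
    hence "of_real a * laplacian w (r, 0) = of_real \<beta> * w (r, 0) - \<i> * of_real k * \<psi> (r, 0)"
      by (simp add: a k_def algebra_simps)
    thus ?thesis using \<open>a > 0\<close> by (simp add: \<eta>_def field_simps)
  qed
  have lL: "laplacian L (r, 0) = of_real (\<beta> / a) * L (r, 0) + (\<i> * of_real (\<epsilon> * k / a)) * \<eta> r"
    if r: "r \<in> {0<..<1}" for r
  proof -
    have "of_real (1 / R) * laplacian (laplacian \<psi>) (r, 0)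
            - \<i> * of_int n * of_real (\<epsilon> * R) * laplacian w (r, 0)
          = of_real \<beta> * (laplacian \<psi> (r, 0) - of_real \<epsilon> * laplacian (laplacian \<psi>) (r, 0))"
      using sol disc0(1)[OF r] unfolding D by blast
    hence "of_real a * laplacian L (r, 0) = of_real \<beta> * L (r, 0) + \<i> * of_real (\<epsilon> * k) * \<eta> r"
      unfolding lw[OF r] L(2)[OF disc0(1)[OF r]] L(3)[OF disc0(1)[OF r]]
      by (simp add: a k_def algebra_simps)
    thus ?thesis using \<open>a > 0\<close> by (simp add: field_simps)
  qed
  have rw: "radial_laplacian n (\<lambda>r. w (r, 0)) w' \<eta>"
    by (rule radial_laplacian_cong[OF w' lw])
  have r\<psi>: "radial_laplacian n (\<lambda>r. \<psi> (r, 0)) \<psi>' (\<lambda>r. L (r, 0))"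
    by (rule radial_laplacian_cong[OF \<psi>'(1) L(2)[OF disc0(1)]])
  have r\<phi>: "radial_laplacian n (\<lambda>r. L (r, 0)) \<phi>'
      (\<lambda>r. of_real (\<beta> / a) * L (r, 0) + (\<i> * of_real (\<epsilon> * k / a)) * \<eta> r)"
    by (rule radial_laplacian_cong[OF \<phi>' lL])
  note r\<eta> = radial_laplacian_linear[OF rw r\<psi>, of "of_real (\<beta> / a)" "- \<i> * of_real (k / a)", folded \<eta>_def]
  have qa: "(\<beta> + k * e) / a = 4 * q" and pa: "(\<beta> - k * e) / a = 4 * - p"
    using \<open>a > 0\<close> unfolding p q e_def k_def by (simp_all add: field_simps)
  define u where "u = (\<lambda>r. 1 * L (r, 0) + (\<i> * of_real e) * \<eta> r)"
  define v where "v = (\<lambda>r. 1 * L (r, 0) + (- \<i> * of_real e) * \<eta> r)"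
  define b c where "b = complex_of_real (\<beta> / a)" "c = complex_of_real (k / a)"
  have ratios: "complex_of_real (\<beta> / a) = b" "complex_of_real (k / a) = c"
    "complex_of_real (\<epsilon> * k / a) = of_real e * of_real e * c"
    "complex_of_real ((\<beta> + k * e) / a) = b + c * of_real e"
    "complex_of_real ((\<beta> - k * e) / a) = b - c * of_real e"
    by (simp_all add: b_c_def e(2) add_divide_distrib diff_divide_distrib power2_eq_square)
  have "\<exists>u'. radial_laplacian n u u' (\<lambda>r. of_real (4 * q) * u r)"
    unfolding u_def qa[symmetric]
    by (rule exI, rule radial_laplacian_cong[OF radial_laplacian_linear[OF r\<phi> r\<eta>]])
       (unfold ratios, rule coupling_eigenvector_plus)
  then obtain u' where u: "radial_laplacian n u u' (\<lambda>r. of_real (4 * q) * u r)" by blast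
  have "\<exists>v'. radial_laplacian n v v' (\<lambda>r. of_real (4 * - p) * v r)"
    unfolding v_def pa[symmetric]
    by (rule exI, rule radial_laplacian_cong[OF radial_laplacian_linear[OF r\<phi> r\<eta>]])
       (unfold ratios, rule coupling_eigenvector_minus)
  then obtain v' where v: "radial_laplacian n v v' (\<lambda>r. of_real (4 * - p) * v r)" by blast
  have "q \<ge> 0" using \<open>R > 0\<close> \<open>\<beta> \<ge> 0\<close> \<open>\<epsilon> > 0\<close> \<open>a > 0\<close> unfolding q by simp
  hence qpos: "clifford j (q * r\<^sup>2) > 0" for j r by (intro clifford_pos_of_nonneg) simp
  obtain A where A: "\<And>r. r \<in> {0..1} \<Longrightarrow> u r = A * of_real (r ^ n * clifford n (q * r\<^sup>2))"
    using radial_eigenfunction[OF u] qpos by (metis less_irrefl)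
  obtain B where B: "\<And>r. r \<in> {0..1} \<Longrightarrow> v r = B * of_real (r ^ n * clifford n (- p * r\<^sup>2))"
    using radial_eigenfunction[OF v] pos
    by (metis greaterThanLessThan_iff greaterThanAtMost_iff less_imp_le less_irrefl)
  have bd: "w (1, 0) = 0" "\<psi> (1, 0) = 0" "((\<lambda>r. \<psi> (r, 0)) has_vector_derivative 0) (at 1 within {0..1})"
    using sol unfolding D polar_0[symmetric] by blast+
  have "\<psi>' 1 = 0"
    using vector_derivative_unique_within[OF _ \<psi>'(2) bd(3)] by (simp add: trivial_limit_within islimpt_Icc)
  have "\<eta> 1 = 0" using bd by (simp add: \<eta>_def)
  hence "A * of_real (clifford n q) = B * of_real (clifford n (- p))"
    using A[of 1] B[of 1] by (simp add: u_def v_def)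
  moreover have "A * of_real (clifford (Suc n) q) + B * of_real (clifford (Suc n) (- p)) = 0"
  proof -
    have "A / 2 * of_real (clifford (Suc n) q) + B / 2 * of_real (clifford (Suc n) (- p)) = 0"
    proof (rule radial_clamped_condition[OF r\<psi> _ \<open>\<psi>' 1 = 0\<close>])
      fix r :: real assume r: "r \<in> {0<..<1}"
      have "L (r, 0) = (u r + v r) / 2" by (simp add: u_def v_def)
      also have "\<dots> = of_real (r ^ n) * (A / 2 * of_real (clifford n (q * r\<^sup>2)) + B / 2 * of_real (clifford n (- p * r\<^sup>2)))"
        using A[of r] B[of r] r by (simp add: field_simps)
      finally show "L (r, 0) = \<dots>" .
    qed (use bd in simp)
    thus ?thesis by (simp add: field_simps)
  qed
  ultimately have AB: "A * of_real (clifford n q) = B * of_real (clifford n (- p))"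
    "A * of_real (clifford (Suc n) q) = - B * of_real (clifford (Suc n) (- p))"
    by (simp_all add: eq_neg_iff_add_eq_0)
  have A0: "A = 0"
  proof (cases "freq n p q = 0")
    case False
    have "A * of_real (freq n p q) = of_real (clifford (Suc n) (- p)) * (A * of_real (clifford n q))
        + of_real (clifford n (- p)) * (A * of_real (clifford (Suc n) q))"
      by (simp add: freq_def algebra_simps)
    also have "\<dots> = 0" unfolding AB by (simp add: algebra_simps)
    finally show ?thesis using False by simp
  next
    case True
    have "1 / 2 \<in> {0<..<1::real}" by simp
    hence "u (1 / 2) = 0"
      using alt True lw[of "1 / 2"] L(2)[OF disc0(1), of "1 / 2"] by (simp add: u_def e_def)
    thus ?thesis using A[of "1 / 2"] qpos[of n "1 / 2"] by simp
  qed
  have "clifford (Suc n) (- p) > 0" using pos[of 1] by simp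
  hence B0: "B = 0" using AB(2) A0 by simp
  have uv: "u r = 0" "v r = 0" if "r \<in> {0<..<1}" for r
    using A[of r] B[of r] that by (simp_all add: A0 B0)
  have L0: "L (r, 0) = 0" and \<eta>0: "\<eta> r = 0" if "r \<in> {0<..<1}" for r
  proof -
    have "L (r, 0) = (u r + v r) / 2" by (simp add: u_def v_def)
    thus "L (r, 0) = 0" using uv[OF that] by simp
    moreover have "u r = 0" by (rule uv(1)[OF that])
    ultimately show "\<eta> r = 0" using e(1) by (simp add: u_def)
  qed
  have "w (r, 0) = 0" "\<psi> (r, 0) = 0" if "r \<in> {0..1}" for r
    using radial_harmonic_trivial[OF rw bd(1) \<eta>0 that] radial_harmonic_trivial[OF r\<psi> bd(2) L0 that] by auto
  thus ?thesis using zero_of_profile_zero C(3,4) z by blast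
qed

section \<open>Construction of eigenvectors\<close>

definition mode_sum :: "nat \<Rightarrow> real \<Rightarrow> real \<Rightarrow> complex \<Rightarrow> complex \<Rightarrow> complex \<Rightarrow> real \<times> real \<Rightarrow> complex" where
  "mode_sum n s t c0 c1 c2 = (\<lambda>p. c0 * mode n 0 p + (c1 * mode n s p + c2 * mode n t p))"

lemma Ck_disc_mode_sum: "Ck_disc k (mode_sum n s t c0 c1 c2)"
  unfolding mode_sum_def by (intro Ck_disc_add Ck_disc_mult Ck_disc_const Ck_disc_mode)

lemma laplacian_mode_sum:
  assumes "p \<in> disc"
  shows "laplacian (mode_sum n s t c0 c1 c2) p = mode_sum n s t 0 (of_real (4 * s) * c1) (of_real (4 * t) * c2) p"
proof -
  have C: "Ck_disc 2 (\<lambda>p. c1 * mode n s p + c2 * mode n t p)"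
    by (intro Ck_disc_add Ck_disc_mult Ck_disc_const Ck_disc_mode)
  have "laplacian (mode_sum n s t c0 c1 c2) p
      = c0 * laplacian (mode n 0) p + 1 * laplacian (\<lambda>p. c1 * mode n s p + c2 * mode n t p) p"
    unfolding mode_sum_def using laplacian_linear[OF Ck_disc_mode C assms, of c0 n 0 1] by simp
  also have "laplacian (\<lambda>p. c1 * mode n s p + c2 * mode n t p) p
      = c1 * laplacian (mode n s) p + c2 * laplacian (mode n t) p"
    by (rule laplacian_linear[OF Ck_disc_mode Ck_disc_mode assms])
  finally show ?thesis by (simp add: laplacian_mode[OF assms] mode_sum_def algebra_simps)
qed

lemma laplacian_laplacian_mode_sum:
  assumes "p \<in> disc"
  shows "laplacian (laplacian (mode_sum n s t c0 c1 c2)) p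
    = mode_sum n s t 0 (of_real (4 * s) * (of_real (4 * s) * c1)) (of_real (4 * t) * (of_real (4 * t) * c2)) p"
  using laplacian_cong[OF laplacian_mode_sum assms] laplacian_mode_sum[OF assms] by simp

lemma mode_sum_polar:
  "mode_sum n s t c0 c1 c2 (polar r \<theta>) = cis (real n * \<theta>) * (of_real (r ^ n) *
    (c0 / fact n + (c1 * of_real (clifford n (s * r\<^sup>2)) + c2 * of_real (clifford n (t * r\<^sup>2)))))"
  by (simp add: mode_sum_def mode_polar algebra_simps)

lemma azimuthal_mode_sum: "azimuthal (int n) (mode_sum n s t c0 c1 c2)"
  unfolding azimuthal_iff polar_0[symmetric] mode_sum_polar by simp

lemma mode_sum_radial_deriv:
  assumes bc: "c0 / fact n + (c1 * of_real (clifford n s) + c2 * of_real (clifford n t)) = 0"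
  shows "((\<lambda>r. mode_sum n s t c0 c1 c2 (polar r \<theta>)) has_vector_derivative
     cis (real n * \<theta>) * (2 * (of_real s * c1 * of_real (clifford (Suc n) s) + of_real t * c2 * of_real (clifford (Suc n) t))))
     (at 1 within S)"
proof -
  have "((\<lambda>r. cis (real n * \<theta>) * (of_real r ^ n *
      (c0 / fact n + (c1 * of_real (clifford n (s * r\<^sup>2)) + c2 * of_real (clifford n (t * r\<^sup>2))))))
    has_vector_derivative cis (real n * \<theta>) *
      (of_real 1 ^ n * (0 + (c1 * of_real (2 * s * 1 * clifford (Suc n) (s * 1\<^sup>2))
          + c2 * of_real (2 * t * 1 * clifford (Suc n) (t * 1\<^sup>2))))
       + of_nat n * of_real 1 ^ (n - 1) *
          (c0 / fact n + (c1 * of_real (clifford n (s * 1\<^sup>2)) + c2 * of_real (clifford n (t * 1\<^sup>2)))))) (at 1 within S)"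
    by (intro has_vector_derivative_mult_right has_vector_derivative_mult has_vector_derivative_add
        has_vector_derivative_const has_vector_derivative_of_real_power clifford_radial_deriv)
  thus ?thesis unfolding mode_sum_polar by (simp add: bc algebra_simps)
qed

text \<open>Reversing the argument: \<open>\<Delta>\<psi> \<plusminus> i \<surd>\<epsilon> \<Delta>w\<close> are taken as the multiples of \<open>U\<^sub>q\<close> and
\<open>U\<^sub>-\<^sub>p\<close> given by a null vector of the determinant. Dividing by the eigenvalues \<open>4 q\<close> and \<open>- 4 p\<close> inverts
the Laplacian up to multiples of \<open>z\<^sup>n\<close>, which are adjusted to make \<open>w\<close> and \<open>\<psi>\<close> vanish on the circle. That the
two adjustments are compatible with the first equation is the identity \<open>n R c0 = \<beta> d\<close>.\<close>

lemma mode_eigenvector_exists: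
  assumes "\<epsilon> > 0" "R > 0" "\<beta> \<ge> 0" and a: "a = 1 / R + \<beta> * \<epsilon>"
    and p: "p = (n * R * sqrt \<epsilon> - \<beta>) / (4 * a)" and q: "q = (n * R * sqrt \<epsilon> + \<beta>) / (4 * a)"
    and "p > 0" and freq: "freq n p q = 0"
  shows "\<exists>w \<psi>. mode_eigenvector \<epsilon> R (int n) (of_real \<beta>) w \<psi>"
proof -
  define k where "k = real n * R"
  define e where "e = sqrt \<epsilon>"
  have e: "e > 0" "\<epsilon> = e\<^sup>2" using \<open>\<epsilon> > 0\<close> by (simp_all add: e_def)
  have "a > 0" using \<open>R > 0\<close> \<open>\<beta> \<ge> 0\<close> \<open>\<epsilon> > 0\<close> unfolding a by (simp add: add_pos_nonneg)
  have "p \<le> q" unfolding p q using \<open>a > 0\<close> \<open>\<beta> \<ge> 0\<close> by (intro divide_right_mono) auto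
  hence "q > 0" using \<open>p > 0\<close> by linarith
  have pa: "4 * p / R = k * e - \<beta> - \<beta> * \<epsilon> * (4 * p)" and qa: "4 * q / R = k * e + \<beta> - \<beta> * \<epsilon> * (4 * q)"
  proof -
    have "4 * p * a = k * e - \<beta>" "4 * q * a = k * e + \<beta>"
      unfolding p q k_def e_def using \<open>a > 0\<close> by simp_all
    thus "4 * p / R = k * e - \<beta> - \<beta> * \<epsilon> * (4 * p)" "4 * q / R = k * e + \<beta> - \<beta> * \<epsilon> * (4 * q)"
      unfolding a by (simp_all add: algebra_simps)
  qed
  define P Q where "P = clifford n (- p)" "Q = clifford n q"
  \<comment> \<open>The coefficients of \<open>U\<^sub>q\<close> and \<open>U\<^sub>-\<^sub>p\<close> in \<open>\<Delta>\<psi> \<plusminus> i \<surd>\<epsilon> \<Delta>w\<close> are proportional to \<open>P\<close> and \<open>Q\<close>: so both have the value \<open>P Q\<close>, up to a common factor, at radius \<open>1\<close>.\<close>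
  define c0 c1 c2 d where "c0 = fact n * (P * Q * (1 / p - 1 / q))" "c1 = - Q / p" "c2 = P / q"
    "d = fact n * (P * Q * (1 / p + 1 / q) / e)"
  note c_def = this
  define \<psi> where "\<psi> = mode_sum n (- p) q (of_real c0) (of_real c1) (of_real c2)"
  define w where "w = mode_sum n (- p) q (\<i> * of_real d) (\<i> * of_real (c1 / e)) (- \<i> * of_real (c2 / e))"
  have "Q > 0" unfolding P_Q_def using \<open>q > 0\<close> by (intro clifford_pos_of_nonneg) simp
  have bc: "c0 / fact n + (c1 * P + c2 * Q) = 0"
  proof -
    have "c0 / fact n = P * Q * (1 / p - 1 / q)" by (simp add: c_def)
    thus ?thesis by (simp add: c_def algebra_simps)
  qed
  have bcw: "d / fact n + (c1 / e * P - c2 / e * Q) = 0"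
  proof -
    have "d / fact n = P * Q * (1 / p + 1 / q) / e" by (simp add: c_def)
    thus ?thesis using e(1) by (simp add: c_def add_divide_distrib algebra_simps)
  qed
  have bcd: "- p * c1 * clifford (Suc n) (- p) + q * c2 * clifford (Suc n) q = 0"
    using freq \<open>p > 0\<close> \<open>q > 0\<close> by (simp add: c_def P_Q_def freq_def algebra_simps)
  have dc: "k * c0 = \<beta> * d"
  proof -
    have "(p + q) * \<beta> = k * e * (q - p)"
      unfolding p q k_def e_def using \<open>a > 0\<close> by (simp add: field_simps)
    hence "k * (q - p) = \<beta> * ((p + q) / e)"
      using e(1) by (simp add: field_simps)
    hence "k * (q - p) / (p * q) = \<beta> * ((p + q) / e) / (p * q)" by simp
    moreover have "1 / p - 1 / q = (q - p) / (p * q)" "1 / p + 1 / q = (p + q) / (p * q)"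
      using \<open>p > 0\<close> \<open>q > 0\<close> by (simp_all add: field_simps)
    ultimately have *: "k * (1 / p - 1 / q) = \<beta> * ((1 / p + 1 / q) / e)" by simp
    have "k * c0 = fact n * P * Q * (k * (1 / p - 1 / q))" by (simp only: c_def mult_ac)
    also have "\<dots> = \<beta> * d" unfolding * by (simp add: c_def)
    finally show ?thesis .
  qed
  have sol: "mode_solution \<epsilon> R (int n) \<beta> w \<psi>"
    unfolding mode_solution_def
  proof (intro conjI ballI allI)
    show "Ck_disc 3 w" "Ck_disc 4 \<psi>" unfolding w_def \<psi>_def by (rule Ck_disc_mode_sum)+
    show "azimuthal (int n) w" "azimuthal (int n) \<psi>"
      unfolding w_def \<psi>_def by (rule azimuthal_mode_sum)+
  next
    fix z assume z: "z \<in> disc"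
    define X Y Z where "X = mode n 0 z" "Y = mode n (- p) z" "Z = mode n q z"
    note XYZ = this
    have w: "w z = \<i> * (of_real d * X + of_real (c1 / e) * Y - of_real (c2 / e) * Z)"
      by (simp add: w_def mode_sum_def XYZ algebra_simps)
    have lw: "laplacian w z = \<i> * (- of_real (4 * p * c1 / e) * Y - of_real (4 * q * c2 / e) * Z)"
      unfolding w_def laplacian_mode_sum[OF z] by (simp add: mode_sum_def XYZ algebra_simps)
    have \<psi>: "\<psi> z = of_real c0 * X + of_real c1 * Y + of_real c2 * Z"
      by (simp add: \<psi>_def mode_sum_def XYZ algebra_simps)
    have l\<psi>: "laplacian \<psi> z = - of_real (4 * p * c1) * Y + of_real (4 * q * c2) * Z"
      unfolding \<psi>_def laplacian_mode_sum[OF z] by (simp add: mode_sum_def XYZ algebra_simps)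
    have ll\<psi>: "laplacian (laplacian \<psi>) z = of_real (16 * p\<^sup>2 * c1) * Y + of_real (16 * q\<^sup>2 * c2) * Z"
      unfolding \<psi>_def laplacian_laplacian_mode_sum[OF z] by (simp add: mode_sum_def XYZ algebra_simps power2_eq_square)
    have Y: "- (4 * p / R) * (c1 / e) + k * c1 = \<beta> * (c1 / e + \<epsilon> * (4 * p * c1 / e))"
      unfolding pa using e(1) by (simp add: field_simps)
    have Z: "- (4 * q / R) * (c2 / e) + k * c2 = \<beta> * (- (c2 / e) + \<epsilon> * (4 * q * c2 / e))"
      unfolding qa using e(1) by (simp add: field_simps)
    have "of_real (1 / R) * laplacian w z + \<i> * of_int (int n) * of_real R * \<psi> z
      = \<i> * (of_real (k * c0) * X + of_real (- (4 * p / R) * (c1 / e) + k * c1) * Y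
            + of_real (- (4 * q / R) * (c2 / e) + k * c2) * Z)"
      unfolding lw \<psi> by (simp add: k_def algebra_simps)
    also have "\<dots> = \<i> * (of_real (\<beta> * d) * X + of_real (\<beta> * (c1 / e + \<epsilon> * (4 * p * c1 / e))) * Y
            + of_real (\<beta> * (- (c2 / e) + \<epsilon> * (4 * q * c2 / e))) * Z)"
      by (simp only: dc Y Z)
    also have "\<dots> = of_real \<beta> * (w z - of_real \<epsilon> * laplacian w z)"
      unfolding lw w by (simp add: algebra_simps)
    finally show "of_real (1 / R) * laplacian w z + \<i> * of_int (int n) * of_real R * \<psi> z
      = of_real \<beta> * (w z - of_real \<epsilon> * laplacian w z)" .
    have Y: "4 * p / R * (4 * p * c1) - k * \<epsilon> * (4 * p * c1 / e)
        = \<beta> * (- (4 * p * c1) - \<epsilon> * (16 * p\<^sup>2 * c1))"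
      unfolding pa using e(1) by (simp add: e(2) field_simps power2_eq_square)
    have Z: "4 * q / R * (4 * q * c2) - k * \<epsilon> * (4 * q * c2 / e)
        = \<beta> * (4 * q * c2 - \<epsilon> * (16 * q\<^sup>2 * c2))"
      unfolding qa using e(1) by (simp add: e(2) field_simps power2_eq_square)
    have "of_real (1 / R) * laplacian (laplacian \<psi>) z - \<i> * of_int (int n) * of_real (\<epsilon> * R) * laplacian w z
       = of_real (4 * p / R * (4 * p * c1) - k * \<epsilon> * (4 * p * c1 / e)) * Y
         + of_real (4 * q / R * (4 * q * c2) - k * \<epsilon> * (4 * q * c2 / e)) * Z"
      unfolding lw ll\<psi> by (simp add: k_def algebra_simps power2_eq_square)
    also have "\<dots> = of_real (\<beta> * (- (4 * p * c1) - \<epsilon> * (16 * p\<^sup>2 * c1))) * Y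
         + of_real (\<beta> * (4 * q * c2 - \<epsilon> * (16 * q\<^sup>2 * c2))) * Z"
      by (simp only: Y Z)
    also have "\<dots> = of_real \<beta> * (laplacian \<psi> z - of_real \<epsilon> * laplacian (laplacian \<psi>) z)"
      unfolding l\<psi> ll\<psi> by (simp add: algebra_simps)
    finally show "of_real (1 / R) * laplacian (laplacian \<psi>) z - \<i> * of_int (int n) * of_real (\<epsilon> * R) * laplacian w z
       = of_real \<beta> * (laplacian \<psi> z - of_real \<epsilon> * laplacian (laplacian \<psi>) z)" .
  next
    fix \<theta>
    have bc': "of_real c0 / fact n + (of_real c1 * of_real P + of_real c2 * of_real Q) = (0 :: complex)"
      using arg_cong[OF bc, of complex_of_real] by simp
    have "\<i> * of_real d / fact n + (\<i> * of_real (c1 / e) * of_real P + - \<i> * of_real (c2 / e) * of_real Q)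
        = \<i> * of_real (d / fact n + (c1 / e * P - c2 / e * Q))"
      by (simp add: algebra_simps)
    also have "\<dots> = 0" unfolding bcw by simp
    finally show "w (polar 1 \<theta>) = 0"
      by (simp only: w_def mode_sum_polar power_one mult_1_right P_Q_def mult_zero_right)
    show "\<psi> (polar 1 \<theta>) = 0"
      using bc' by (simp only: \<psi>_def mode_sum_polar power_one mult_1_right P_Q_def mult_zero_right)
    have "of_real (- p) * of_real c1 * of_real (clifford (Suc n) (- p)) + of_real q * of_real c2 * of_real (clifford (Suc n) q) = (0 :: complex)"
      using arg_cong[OF bcd, of complex_of_real] by simp
    thus "((\<lambda>r. \<psi> (polar r \<theta>)) has_vector_derivative 0) (at 1 within {0..1})"
      using mode_sum_radial_deriv[of "of_real c0" n "of_real c1" "- p" "of_real c2" q \<theta> "{0..1}"] bc'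
      by (simp only: \<psi>_def P_Q_def mult_zero_right)
  qed
  have "\<exists>z\<in>disc. w z \<noteq> 0 \<or> \<psi> z \<noteq> 0"
  proof (rule ccontr)
    assume "\<not> ?thesis"
    hence 0: "w z = 0" "\<psi> z = 0" if "z \<in> disc" for z using that by auto
    \<comment> \<open>So close to the centre that \<open>4 p r\<^sup>2 \<le> 1\<close>, hence \<open>U\<^sub>-\<^sub>p\<close> does not vanish there.\<close>
    define r where "r = 1 / (2 * (1 + p))"
    have r: "0 < r" "r < 1" using \<open>p > 0\<close> by (simp_all add: r_def)
    define z where "z = polar r 0"
    have z: "z \<in> disc" using r by (simp add: z_def norm_polar)
    have "laplacian w z = 0"
      using laplacian_cong[OF 0(1) z] laplacian_cmult[OF Ck_disc_const[of 2 0] z, of 0] by simp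
    moreover have "laplacian \<psi> z = 0"
      using laplacian_cong[OF 0(2) z] laplacian_cmult[OF Ck_disc_const[of 2 0] z, of 0] by simp
    moreover have "laplacian \<psi> z - \<i> * of_real e * laplacian w z = of_real (- 8 * p * c1) * mode n (- p) z"
      unfolding w_def \<psi>_def laplacian_mode_sum[OF z] using e(1) by (simp add: mode_sum_def algebra_simps)
    ultimately have "of_real (- 8 * p * c1) * mode n (- p) z = 0" by simp
    hence "mode n (- p) z = 0" using \<open>p > 0\<close> \<open>Q > 0\<close> by (simp add: c_def)
    hence "clifford n (- (p * r\<^sup>2)) = 0" using r by (simp add: z_def mode_polar)
    moreover have "clifford n (- (p * r\<^sup>2)) > 0"
    proof (rule clifford_pos_ratio[THEN conjunct1])
      define s where "s = 1 + p"
      have "s > 0" "p \<le> s * s" using \<open>p > 0\<close> unfolding s_def by (simp_all add: algebra_simps)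
      moreover have "4 * (p * r\<^sup>2) = p / (s * s)"
        unfolding r_def s_def[symmetric] by (simp add: power2_eq_square)
      ultimately have "4 * (p * r\<^sup>2) \<le> 1" by (simp add: divide_le_eq)
      also have "(1::real) \<le> (real n + 1)\<^sup>2" using power_mono[of 1 "real n + 1" 2] by simp
      finally show "4 * (p * r\<^sup>2) \<le> (real n + 1)\<^sup>2" .
    qed (use \<open>p > 0\<close> in simp)
    ultimately show False by simp
  qed
  thus ?thesis using sol mode_eigenvector_iff by blast
qed

section \<open>The critical Reynolds number\<close>

lemma critical_R_pos: "\<epsilon> > 0 \<Longrightarrow> critical_R \<epsilon> > 0"
  using tcrit_bounds by (simp add: critical_R_def lambda_31_eq)

lemma critical_R_square:
  assumes "\<epsilon> > 0"
  shows "3 * (critical_R \<epsilon>)\<^sup>2 * sqrt \<epsilon> / 4 = tcrit"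
proof -
  have "(\<epsilon> powr (- 1 / 4))\<^sup>2 * sqrt \<epsilon> = \<epsilon> powr (- 1 / 2) * \<epsilon> powr (1 / 2)"
    using assms by (simp add: powr_half_sqrt power2_eq_square flip: powr_add)
  also have "\<dots> = 1" using assms by (simp flip: powr_add)
  finally have *: "(\<epsilon> powr (- 1 / 4))\<^sup>2 * sqrt \<epsilon> = 1" .
  have "3 * (critical_R \<epsilon>)\<^sup>2 * sqrt \<epsilon> / 4 = 3 / 4 * (4 * tcrit / 3) * ((\<epsilon> powr (- 1 / 4))\<^sup>2 * sqrt \<epsilon>)"
    using tcrit_bounds by (simp add: critical_R_def lambda_31_eq power_mult_distrib)
  thus ?thesis unfolding * by simp
qed

lemma critical_R_compare:
  assumes "\<epsilon> > 0" "R > 0"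
  shows "R < critical_R \<epsilon> \<longleftrightarrow> 3 * R\<^sup>2 * sqrt \<epsilon> / 4 < tcrit"
    "critical_R \<epsilon> < R \<longleftrightarrow> tcrit < 3 * R\<^sup>2 * sqrt \<epsilon> / 4"
proof -
  have sq: "x < y \<longleftrightarrow> 3 * x\<^sup>2 * sqrt \<epsilon> / 4 < 3 * y\<^sup>2 * sqrt \<epsilon> / 4" if "x > 0" "y > 0" for x y :: real
    using that power_strict_mono[of x y 2] power_less_imp_less_base[of x 2 y] assms(1) by auto
  show "R < critical_R \<epsilon> \<longleftrightarrow> 3 * R\<^sup>2 * sqrt \<epsilon> / 4 < tcrit"
    using sq[OF assms(2) critical_R_pos[OF assms(1)]] unfolding critical_R_square[OF assms(1)] .
  show "critical_R \<epsilon> < R \<longleftrightarrow> tcrit < 3 * R\<^sup>2 * sqrt \<epsilon> / 4"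
    using sq[OF critical_R_pos[OF assms(1)] assms(2)] unfolding critical_R_square[OF assms(1)] .
qed

lemma critical_R_approx:
  assumes "\<epsilon> > 0"
  shows "\<bar>critical_R \<epsilon> - 4.124 * \<epsilon> powr (- 1 / 4)\<bar> \<le> 0.0005 * \<epsilon> powr (- 1 / 4)"
proof -
  have "sqrt (4 * tcrit / 3) \<ge> 4.1235"
    using tcrit_bounds by (intro real_le_rsqrt) (simp add: power2_eq_square)
  moreover have "sqrt (4 * tcrit / 3) \<le> 4.1245"
    using tcrit_bounds by (intro real_le_lsqrt) (simp_all add: power2_eq_square)
  ultimately have "sqrt (4 * tcrit / 3) - 4.124 \<le> 0.0005" "- (sqrt (4 * tcrit / 3) - 4.124) \<le> 0.0005"
    by simp_all
  hence "\<bar>sqrt (4 * tcrit / 3) - 4.124\<bar> \<le> 0.0005" by (rule abs_leI)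
  hence "\<bar>sqrt (4 * tcrit / 3) - 4.124\<bar> * \<epsilon> powr (- 1 / 4) \<le> 0.0005 * \<epsilon> powr (- 1 / 4)"
    by (intro mult_right_mono) auto
  moreover have "\<bar>critical_R \<epsilon> - 4.124 * \<epsilon> powr (- 1 / 4)\<bar> = \<bar>(sqrt (4 * tcrit / 3) - 4.124) * \<epsilon> powr (- 1 / 4)\<bar>"
    by (simp add: critical_R_def lambda_31_eq algebra_simps)
  ultimately show ?thesis by (simp add: abs_mult)
qed

text \<open>Since \<open>a R \<ge> 1\<close> and \<open>\<beta> \<ge> 0\<close>, one has \<open>p \<le> n R\<^sup>2 \<surd>\<epsilon> / 4\<close>, which at or below the
threshold does not exceed the first positive zero of \<open>freq n p p\<close>.\<close>

lemma subcritical_trivial_nat: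
  assumes sol: "mode_solution \<epsilon> R (int n) \<beta> w \<psi>" and pos: "\<epsilon> > 0" "R > 0" "\<beta> \<ge> 0"
    and le: "3 * R\<^sup>2 * sqrt \<epsilon> / 4 \<le> tcrit"
    and strict: "n = 3 \<Longrightarrow> \<beta> > 0 \<or> 3 * R\<^sup>2 * sqrt \<epsilon> / 4 < tcrit"
    and z: "z \<in> closed_disc"
  shows "w z = 0 \<and> \<psi> z = 0"
proof -
  define a where "a = 1 / R + \<beta> * \<epsilon>"
  define M where "M = real n * R * sqrt \<epsilon>"
  define p q where "p = (M - \<beta>) / (4 * a)" "q = (M + \<beta>) / (4 * a)"
  note pq = this
  have a: "a > 0" "1 / a \<le> R"
  proof -
    show "a > 0" using pos unfolding a_def by (simp add: add_pos_nonneg)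
    have "R * a \<ge> 1" using pos by (simp add: a_def algebra_simps)
    thus "1 / a \<le> R" using \<open>a > 0\<close> by (simp add: field_simps)
  qed
  have "M \<ge> 0" using pos by (simp add: M_def)
  have "M / (4 * a) = M / 4 * (1 / a)" by simp
  also have "\<dots> \<le> M / 4 * R" using a \<open>M \<ge> 0\<close> by (intro mult_left_mono) auto
  also have "\<dots> = real n / 3 * (3 * R\<^sup>2 * sqrt \<epsilon> / 4)" by (simp add: M_def power2_eq_square)
  finally have Ma: "M / (4 * a) \<le> real n / 3 * (3 * R\<^sup>2 * sqrt \<epsilon> / 4)" .
  have pM: "p \<le> M / (4 * a)" using pos a unfolding pq by (intro divide_right_mono) auto
  have "p \<le> real n / 3 * tcrit"
    using pM Ma mult_left_mono[OF le, of "real n / 3"] by simp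
  also have "\<dots> \<le> real n / 3 * 12.7585" using tcrit_bounds by (intro mult_left_mono) auto
  also have "\<dots> \<le> 4.253 * real n" by simp
  finally have p_le: "p \<le> 4.253 * real n" .
  have p3: "p < tcrit" if n: "n = 3"
  proof (cases "\<beta> > 0")
    case True
    hence "p < M / (4 * a)" using a unfolding pq by (intro divide_strict_right_mono) auto
    thus ?thesis using Ma le n by simp
  next
    case False
    thus ?thesis using pM Ma strict n by simp
  qed
  have "p \<le> q" "q \<ge> 0" using pos a \<open>M \<ge> 0\<close> unfolding pq by (auto intro!: divide_right_mono)
  have cpos: "clifford (Suc n) (- t) > 0" if "t \<le> p" for t
  proof (cases "t \<le> 0")
    case True
    thus ?thesis by (intro clifford_pos_of_nonneg) simp
  next
    case False
    thus ?thesis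
      using clifford_gap_other[of n t] clifford4_pos[of "- t" 4] that p_le p3 tcrit_bounds
      by (cases "n = 3") auto
  qed
  have "freq n p q > 0"
  proof (cases "p \<le> 0")
    case True
    thus ?thesis using \<open>q \<ge> 0\<close> by (rule freq_pos_of_nonpos)
  next
    case False
    show ?thesis
    proof (cases "n = 3")
      case True
      thus ?thesis using False p3 \<open>p \<le> q\<close> freq3_pos by simp
    next
      case n: False
      thus ?thesis using False clifford_gap_other[OF n, of p] p_le \<open>p \<le> q\<close>
        by (intro freq_pos) auto
    qed
  qed
  show ?thesis
  proof (rule mode_solution_trivial[OF sol pos a_def _ _ _ _ z])
    show "p = (real n * R * sqrt \<epsilon> - \<beta>) / (4 * a)" "q = (real n * R * sqrt \<epsilon> + \<beta>) / (4 * a)"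
      by (simp_all add: pq M_def)
    show "freq n p q \<noteq> 0 \<or> laplacian \<psi> (1 / 2, 0) + \<i> * of_real (sqrt \<epsilon>) * laplacian w (1 / 2, 0) = 0"
      using \<open>freq n p q > 0\<close> by simp
    show "clifford (Suc n) (- p * r\<^sup>2) > 0" if "r \<in> {0<..1}" for r
    proof (cases "p \<ge> 0")
      case True
      have "r\<^sup>2 \<le> 1" using that by (simp add: power_le_one)
      hence "p * r\<^sup>2 \<le> p" using True mult_left_mono[of "r\<^sup>2" 1 p] by simp
      thus ?thesis using cpos[of "p * r\<^sup>2"] by simp
    next
      case False
      thus ?thesis by (intro clifford_pos_of_nonneg) (simp add: mult_nonpos_nonneg)
    qed
  qed
qed

lemma subcritical_trivial:
  assumes sol: "mode_solution \<epsilon> R m \<beta> w \<psi>" and "\<epsilon> > 0" "R > 0" "\<beta> \<ge> 0"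
    and "3 * R\<^sup>2 * sqrt \<epsilon> / 4 \<le> tcrit"
    and "\<bar>m\<bar> = 3 \<Longrightarrow> \<beta> > 0 \<or> 3 * R\<^sup>2 * sqrt \<epsilon> / 4 < tcrit"
    and "z \<in> closed_disc"
  shows "w z = 0 \<and> \<psi> z = 0"
proof (cases "m \<ge> 0")
  case True
  define n where "n = nat m"
  have n: "m = int n" using True by (simp add: n_def)
  show ?thesis
  proof (rule subcritical_trivial_nat[OF sol[unfolded n] assms(2-5) _ assms(7)])
    assume "n = 3"
    thus "\<beta> > 0 \<or> 3 * R\<^sup>2 * sqrt \<epsilon> / 4 < tcrit" using n by (intro assms(6)) simp
  qed
next
  case False
  define n where "n = nat (- m)"
  have n: "- m = int n" using False by (simp add: n_def)
  have "cnj (w z) = 0 \<and> cnj (\<psi> z) = 0"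
  proof (rule subcritical_trivial_nat[OF mode_solution_cnj[OF sol, unfolded n] assms(2-5) _ assms(7)])
    assume "n = 3"
    thus "\<beta> > 0 \<or> 3 * R\<^sup>2 * sqrt \<epsilon> / 4 < tcrit" using n by (intro assms(6)) simp
  qed
  thus ?thesis by simp
qed

text \<open>The solutions at the threshold form at most a line: a suitable combination of two
solutions satisfies the linear condition in \<open>mode_solution_trivial\<close>.\<close>

lemma critical_dependent:
  assumes 1: "mode_solution \<epsilon> R m 0 w \<psi>" and 2: "mode_solution \<epsilon> R m 0 v \<xi>"
    and "\<epsilon> > 0" "R > 0" "3 * R\<^sup>2 * sqrt \<epsilon> / 4 = tcrit" "\<bar>m\<bar> = 3"
  shows "\<exists>c d. (c \<noteq> 0 \<or> d \<noteq> 0) \<and> (\<forall>z\<in>closed_disc. c * w z + d * v z = 0 \<and> c * \<psi> z + d * \<xi> z = 0)"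
proof -
  have trivial: "w z = 0 \<and> \<psi> z = 0"
    if "mode_solution \<epsilon> R (int 3) 0 w \<psi>" "z \<in> closed_disc"
      "laplacian \<psi> (1 / 2, 0) + \<i> * of_real (sqrt \<epsilon>) * laplacian w (1 / 2, 0) = 0" for w \<psi> z
  proof (rule mode_solution_trivial[OF that(1) \<open>\<epsilon> > 0\<close> \<open>R > 0\<close> order_refl refl refl refl _ disjI2[OF that(3)] that(2)])
    fix r :: real assume r: "r \<in> {0<..1}"
    have "(real 3 * R * sqrt \<epsilon> - 0) / (4 * (1 / R + 0 * \<epsilon>)) = tcrit"
      unfolding assms(5)[symmetric] using \<open>R > 0\<close> by (simp add: power2_eq_square)
    moreover have "r\<^sup>2 \<le> 1" using r by (simp add: power_le_one)
    hence "tcrit * r\<^sup>2 \<le> tcrit * 1"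
      using tcrit_bounds by (intro mult_left_mono) auto
    hence "tcrit * r\<^sup>2 \<le> 12.7585"
      using tcrit_bounds by linarith
    hence "clifford (Suc 3) (- tcrit * r\<^sup>2) > 0"
      using clifford4_pos[of "- tcrit * r\<^sup>2" 4] by simp
    ultimately show "clifford (Suc 3) (- ((real 3 * R * sqrt \<epsilon> - 0) / (4 * (1 / R + 0 * \<epsilon>))) * r\<^sup>2) > 0"
      by (simp only:)
  qed
  have dep: "\<exists>c d. (c \<noteq> 0 \<or> d \<noteq> 0) \<and> (\<forall>z\<in>closed_disc. c * w z + d * v z = 0 \<and> c * \<psi> z + d * \<xi> z = 0)"
    if 1: "mode_solution \<epsilon> R (int 3) 0 w \<psi>" and 2: "mode_solution \<epsilon> R (int 3) 0 v \<xi>" for w v \<psi> \<xi>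
  proof -
    \<comment> \<open>The linear functional whose kernel contains only the zero solution.\<close>
    define l where "l = (\<lambda>w \<psi>. laplacian \<psi> (1 / 2, 0) + \<i> * of_real (sqrt \<epsilon>) * laplacian w (1 / 2, 0))"
    have C: "Ck_disc 2 w" "Ck_disc 2 v" "Ck_disc 2 \<psi>" "Ck_disc 2 \<xi>"
      using 1 2 unfolding mode_solution_def by (auto intro: Ck_disc_le)
    have h: "(1 / 2, 0) \<in> disc" by (simp add: norm_Pair)
    have lin: "l (\<lambda>p. c * w p + d * v p) (\<lambda>p. c * \<psi> p + d * \<xi> p) = c * l w \<psi> + d * l v \<xi>" for c d
      unfolding l_def laplacian_linear[OF C(1,2) h] laplacian_linear[OF C(3,4) h]
      by (simp add: algebra_simps)
    have triv: "c * w z + d * v z = 0 \<and> c * \<psi> z + d * \<xi> z = 0"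
      if "c * l w \<psi> + d * l v \<xi> = 0" "z \<in> closed_disc" for c d z
      using trivial[OF mode_solution_linear[OF 1 2] that(2)] lin[of c d] that(1) unfolding l_def by simp
    show ?thesis
    proof (cases "l w \<psi> = 0")
      case True
      thus ?thesis using triv[of 1 0] by (intro exI[of _ 1] exI[of _ 0]) auto
    next
      case False
      thus ?thesis using triv[of "- l v \<xi>" "l w \<psi>"]
        by (intro exI[of _ "- l v \<xi>"] exI[of _ "l w \<psi>"]) auto
    qed
  qed
  show ?thesis
  proof (cases "m = int 3")
    case True
    thus ?thesis using dep 1 2 by simp
  next
    case False
    hence m: "- m = int 3" using \<open>\<bar>m\<bar> = 3\<close> by auto
    obtain c d where cd: "c \<noteq> 0 \<or> d \<noteq> 0"
      "\<And>z. z \<in> closed_disc \<Longrightarrow> c * cnj (w z) + d * cnj (v z) = 0 \<and> c * cnj (\<psi> z) + d * cnj (\<xi> z) = 0"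
      using dep[OF mode_solution_cnj[OF 1, unfolded m] mode_solution_cnj[OF 2, unfolded m]] by blast
    have "cnj c * w z + cnj d * v z = 0 \<and> cnj c * \<psi> z + cnj d * \<xi> z = 0" if "z \<in> closed_disc" for z
      using arg_cong[OF cd(2)[OF that, THEN conjunct1], of cnj]
        arg_cong[OF cd(2)[OF that, THEN conjunct2], of cnj] by simp
    thus ?thesis using cd(1) by (intro exI[of _ "cnj c"] exI[of _ "cnj d"]) auto
  qed
qed

text \<open>As \<open>\<beta>\<close> runs from \<open>0\<close> to \<open>M\<close>, \<open>p\<close> runs from \<open>3 R\<^sup>2 \<surd>\<epsilon> / 4 > tcrit\<close> to \<open>0\<close>. The determinant is
positive at \<open>p = 0\<close>. It is negative at \<open>\<beta> = 0\<close> if \<open>p \<le> 15\<close> there; otherwise \<open>p\<close> passes through \<open>15\<close>,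
where it is negative for every \<open>q\<close>. The detour is necessary because \<open>freq 3 p p\<close> oscillates for large \<open>p\<close>.\<close>

lemma supercritical_root:
  assumes "\<epsilon> > 0" "R > 0" "tcrit < 3 * R\<^sup>2 * sqrt \<epsilon> / 4"
  shows "\<exists>\<beta>>0. \<exists>p q. p = (real 3 * R * sqrt \<epsilon> - \<beta>) / (4 * (1 / R + \<beta> * \<epsilon>)) \<and>
     q = (real 3 * R * sqrt \<epsilon> + \<beta>) / (4 * (1 / R + \<beta> * \<epsilon>)) \<and> p > 0 \<and> freq 3 p q = 0"
proof -
  define M where "M = real 3 * R * sqrt \<epsilon>"
  define p where "p = (\<lambda>\<beta>. (M - \<beta>) / (4 * (1 / R + \<beta> * \<epsilon>)))"
  define q where "q = (\<lambda>\<beta>. (M + \<beta>) / (4 * (1 / R + \<beta> * \<epsilon>)))"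
  define F where "F = (\<lambda>\<beta>. freq 3 (p \<beta>) (q \<beta>))"
  have "M > 0" using assms by (simp add: M_def)
  have a: "1 / R + \<beta> * \<epsilon> > 0" if "\<beta> \<ge> 0" for \<beta>
    using that assms by (simp add: add_pos_nonneg)
  have contp: "continuous_on {0..M} p" and contq: "continuous_on {0..M} q"
  proof -
    have ne: "4 * (1 / R + x * \<epsilon>) \<noteq> 0" if "x \<in> {0..M}" for x
    proof -
      have "4 * (1 / R + x * \<epsilon>) > 0" using that by (intro mult_pos_pos a) simp_all
      thus ?thesis by (rule less_imp_neq[THEN not_sym])
    qed
    show "continuous_on {0..M} p" unfolding p_def by (intro continuous_intros ballI ne)
    show "continuous_on {0..M} q" unfolding q_def by (intro continuous_intros ballI ne)
  qed
  have contF: "continuous_on {b..M} F" if "0 \<le> b" for b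
    unfolding F_def freq_def using that
    by (intro continuous_intros continuous_on_subset[OF contp] continuous_on_subset[OF contq]) auto
  have q0: "q \<beta> \<ge> 0" if "\<beta> \<ge> 0" for \<beta>
    using that a[OF that] \<open>M > 0\<close> by (simp add: q_def)
  have pq0: "p 0 = 3 * R\<^sup>2 * sqrt \<epsilon> / 4" "q 0 = p 0"
    using \<open>R > 0\<close> by (simp_all add: p_def q_def M_def power2_eq_square)
  obtain b where b: "0 \<le> b" "b \<le> M" "F b < 0"
  proof (cases "p 0 \<le> 15")
    case True
    have "F 0 < 0" unfolding F_def pq0(2)
      by (rule freq3_diagonal_neg[OF _ True]) (unfold pq0(1), rule assms(3))
    thus ?thesis using that[of 0] \<open>M > 0\<close> by simp
  next
    case False
    have "\<exists>b\<ge>0. b \<le> M \<and> p b = 15"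
      using False \<open>M > 0\<close> contp by (intro IVT2') (auto simp: p_def)
    then obtain b where "b \<ge> 0" "b \<le> M" "p b = 15" by blast
    thus ?thesis using that[of b] freq3_15_neg[OF q0] by (simp add: F_def)
  qed
  have FM: "F M > 0" unfolding F_def
    by (intro freq_pos_of_nonpos q0) (use \<open>M > 0\<close> in \<open>simp_all add: p_def\<close>)
  have "\<exists>\<beta>\<ge>b. \<beta> \<le> M \<and> F \<beta> = 0"
    using b FM contF[OF b(1)] by (intro IVT') auto
  then obtain \<beta> where \<beta>: "b \<le> \<beta>" "\<beta> \<le> M" "F \<beta> = 0" by blast
  have "\<beta> \<noteq> b" "\<beta> \<noteq> M" using \<beta>(3) b(3) FM by auto
  hence "\<beta> > 0" "\<beta> < M" using \<beta> b by auto
  moreover have "p \<beta> > 0" using \<open>\<beta> < M\<close> a[of \<beta>] \<open>\<beta> > 0\<close> by (simp add: p_def)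
  ultimately show ?thesis
    using \<beta>(3) unfolding F_def
    by (intro exI[of _ \<beta>] conjI exI[of _ "p \<beta>"] exI[of _ "q \<beta>"]) (simp_all add: p_def q_def M_def)
qed

lemma supercritical_eigenvalue:
  assumes "\<epsilon> > 0" "R > 0" "tcrit < 3 * R\<^sup>2 * sqrt \<epsilon> / 4"
  shows "\<exists>\<beta>>0. \<exists>w \<psi>. mode_eigenvector \<epsilon> R 3 (of_real \<beta>) w \<psi>"
proof -
  obtain \<beta> p q where *: "\<beta> > 0" "p = (real 3 * R * sqrt \<epsilon> - \<beta>) / (4 * (1 / R + \<beta> * \<epsilon>))"
     "q = (real 3 * R * sqrt \<epsilon> + \<beta>) / (4 * (1 / R + \<beta> * \<epsilon>))" "p > 0" "freq 3 p q = 0"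
    using supercritical_root[OF assms] by blast
  show ?thesis
    using mode_eigenvector_exists[OF assms(1,2) less_imp_le[OF *(1)] refl *(2-5)] *(1) by auto
qed

lemma critical_eigenvalue:
  assumes "\<epsilon> > 0" "R > 0" "3 * R\<^sup>2 * sqrt \<epsilon> / 4 = tcrit"
  shows "\<exists>w \<psi>. mode_eigenvector \<epsilon> R 3 (of_real 0) w \<psi>"
proof -
  have "tcrit = (real 3 * R * sqrt \<epsilon> - 0) / (4 * (1 / R + 0 * \<epsilon>))"
    "tcrit = (real 3 * R * sqrt \<epsilon> + 0) / (4 * (1 / R + 0 * \<epsilon>))"
    unfolding assms(3)[symmetric] using \<open>R > 0\<close> by (simp_all add: power2_eq_square)
  from mode_eigenvector_exists[OF assms(1,2) order_refl refl this _ freq3_tcrit] tcrit_bounds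
  show ?thesis by simp
qed

section \<open>The ordered eigenvalues\<close>

lemma mode_eigenvector_cnj:
  assumes "mode_eigenvector \<epsilon> R m (of_real \<beta>) w \<psi>"
  shows "mode_eigenvector \<epsilon> R (- m) (of_real \<beta>) (\<lambda>p. cnj (w p)) (\<lambda>p. cnj (\<psi> p))"
  using assms mode_solution_cnj unfolding mode_eigenvector_iff by simp

lemma ordered_eigenvaluesD:
  assumes "ordered_eigenvalues \<epsilon> R m b"
  obtains W \<Psi> where "\<And>j. j \<ge> 1 \<Longrightarrow> mode_eigenvector \<epsilon> R m (of_real (b j)) (W j) (\<Psi> j)"
    "\<And>S (c :: nat \<Rightarrow> complex). finite S \<and> S \<subseteq> {1..} \<and>
           (\<forall>p\<in>closed_disc. (\<Sum>j\<in>S. c j * W j p) = 0 \<and> (\<Sum>j\<in>S. c j * \<Psi> j p) = 0)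
           \<Longrightarrow> (\<forall>j\<in>S. c j = 0)"
    "\<And>\<mu> w \<psi>. mode_eigenvector \<epsilon> R m \<mu> w \<psi> \<Longrightarrow>
           (\<exists>S (c :: nat \<Rightarrow> complex). finite S \<and> S \<subseteq> {j. 1 \<le> j \<and> of_real (b j) = \<mu>} \<and>
              (\<forall>p\<in>closed_disc. w p = (\<Sum>j\<in>S. c j * W j p) \<and> \<psi> p = (\<Sum>j\<in>S. c j * \<Psi> j p))) \<or>
           (\<mu> \<in> \<real> \<and> (\<forall>j\<ge>1. Re \<mu> < b j))"
proof -
  from assms have "\<exists>W \<Psi>.
        (\<forall>j\<ge>1. mode_eigenvector \<epsilon> R m (of_real (b j)) (W j) (\<Psi> j)) \<and>
        (\<forall>S (c :: nat \<Rightarrow> complex). finite S \<and> S \<subseteq> {1..} \<and>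
           (\<forall>p\<in>closed_disc. (\<Sum>j\<in>S. c j * W j p) = 0 \<and> (\<Sum>j\<in>S. c j * \<Psi> j p) = 0)
           \<longrightarrow> (\<forall>j\<in>S. c j = 0)) \<and>
        (\<forall>\<mu> w \<psi>. mode_eigenvector \<epsilon> R m \<mu> w \<psi> \<longrightarrow>
           (\<exists>S (c :: nat \<Rightarrow> complex). finite S \<and> S \<subseteq> {j. 1 \<le> j \<and> of_real (b j) = \<mu>} \<and>
              (\<forall>p\<in>closed_disc. w p = (\<Sum>j\<in>S. c j * W j p) \<and> \<psi> p = (\<Sum>j\<in>S. c j * \<Psi> j p))) \<or>
           (\<mu> \<in> \<real> \<and> (\<forall>j\<ge>1. Re \<mu> < b j)))"
    unfolding ordered_eigenvalues_def by (rule conjunct2)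
  then obtain W \<Psi> where *: "\<forall>j\<ge>1. mode_eigenvector \<epsilon> R m (of_real (b j)) (W j) (\<Psi> j)"
    "\<forall>S (c :: nat \<Rightarrow> complex). finite S \<and> S \<subseteq> {1..} \<and>
           (\<forall>p\<in>closed_disc. (\<Sum>j\<in>S. c j * W j p) = 0 \<and> (\<Sum>j\<in>S. c j * \<Psi> j p) = 0)
           \<longrightarrow> (\<forall>j\<in>S. c j = 0)"
    "\<forall>\<mu> w \<psi>. mode_eigenvector \<epsilon> R m \<mu> w \<psi> \<longrightarrow>
           (\<exists>S (c :: nat \<Rightarrow> complex). finite S \<and> S \<subseteq> {j. 1 \<le> j \<and> of_real (b j) = \<mu>} \<and>
              (\<forall>p\<in>closed_disc. w p = (\<Sum>j\<in>S. c j * W j p) \<and> \<psi> p = (\<Sum>j\<in>S. c j * \<Psi> j p))) \<or>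
           (\<mu> \<in> \<real> \<and> (\<forall>j\<ge>1. Re \<mu> < b j))"
    by (elim exE conjE) (rule that)
  show thesis
    by (rule that[of W \<Psi>, OF *(1)[THEN spec, THEN mp] *(2)[THEN spec, THEN spec, THEN mp]
        *(3)[THEN spec, THEN spec, THEN spec, THEN mp]])
qed

lemma ordered_eigenvalues_decreasing:
  assumes "ordered_eigenvalues \<epsilon> R m b" "1 \<le> i" "i \<le> j"
  shows "b j \<le> b i"
  using assms(1)[unfolded ordered_eigenvalues_def, THEN conjunct1] assms(2,3) by blast

text \<open>An eigenvalue that is not listed lies below all listed ones; one whose eigenvector is in the
span of listed eigenvectors is listed, since the empty span contains only \<open>0\<close>.\<close>

lemma eigenvalue_le_first:
  assumes ord: "ordered_eigenvalues \<epsilon> R m b" and ev: "mode_eigenvector \<epsilon> R m (of_real \<mu>) w \<psi>"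
  shows "\<mu> \<le> b 1"
proof -
  obtain W \<Psi> where *: "(\<exists>S (c :: nat \<Rightarrow> complex). finite S \<and> S \<subseteq> {j. 1 \<le> j \<and> of_real (b j) = complex_of_real \<mu>} \<and>
              (\<forall>p\<in>closed_disc. w p = (\<Sum>j\<in>S. c j * W j p) \<and> \<psi> p = (\<Sum>j\<in>S. c j * \<Psi> j p))) \<or>
           (complex_of_real \<mu> \<in> \<real> \<and> (\<forall>j\<ge>1. Re (complex_of_real \<mu>) < b j))"
    by (rule ordered_eigenvaluesD[OF ord]) (rule that, drule meta_spec, drule meta_spec, drule meta_spec, erule meta_mp, rule ev)
  obtain p where p: "p \<in> disc" "w p \<noteq> 0 \<or> \<psi> p \<noteq> 0"
    using ev unfolding mode_eigenvector_iff by blast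
  from * show ?thesis
  proof
    assume "complex_of_real \<mu> \<in> \<real> \<and> (\<forall>j\<ge>1. Re (complex_of_real \<mu>) < b j)"
    hence "\<mu> < b 1" by simp
    thus ?thesis by simp
  next
    assume "\<exists>S (c :: nat \<Rightarrow> complex). finite S \<and> S \<subseteq> {j. 1 \<le> j \<and> of_real (b j) = complex_of_real \<mu>} \<and>
              (\<forall>p\<in>closed_disc. w p = (\<Sum>j\<in>S. c j * W j p) \<and> \<psi> p = (\<Sum>j\<in>S. c j * \<Psi> j p))"
    then obtain S c where S: "S \<subseteq> {j. 1 \<le> j \<and> of_real (b j) = complex_of_real \<mu>}"
      "\<forall>p\<in>closed_disc. w p = (\<Sum>j\<in>S. c j * W j p) \<and> \<psi> p = (\<Sum>j\<in>S. c j * \<Psi> j p)" by blast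
    have "p \<in> closed_disc" using p(1) by simp
    hence "S \<noteq> {}" using p(2) S(2) by auto
    then obtain j where "j \<ge> 1" "b j = \<mu>" using S(1) by auto
    thus ?thesis using ordered_eigenvalues_decreasing[OF ord order_refl] by blast
  qed
qed

lemma ordered_eigenvector:
  assumes "ordered_eigenvalues \<epsilon> R m b" "j \<ge> 1"
  obtains w \<psi> where "mode_eigenvector \<epsilon> R m (of_real (b j)) w \<psi>"
  by (rule ordered_eigenvaluesD[OF assms(1)]) (use assms(2) that in blast)

lemma subcritical_eigenvalue_bound:
  assumes ev: "mode_eigenvector \<epsilon> R m (of_real \<mu>) w \<psi>" and pos: "\<epsilon> > 0" "R > 0"
    and le: "3 * R\<^sup>2 * sqrt \<epsilon> / 4 \<le> tcrit"
  shows "\<mu> \<le> 0" "\<bar>m\<bar> \<noteq> 3 \<or> 3 * R\<^sup>2 * sqrt \<epsilon> / 4 < tcrit \<Longrightarrow> \<mu> < 0"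
proof -
  have sol: "mode_solution \<epsilon> R m \<mu> w \<psi>" and "\<exists>p\<in>disc. w p \<noteq> 0 \<or> \<psi> p \<noteq> 0"
    using ev unfolding mode_eigenvector_iff by blast+
  then obtain p where p: "p \<in> disc" "w p \<noteq> 0 \<or> \<psi> p \<noteq> 0" by blast
  hence "p \<in> closed_disc" by simp
  note trivial = subcritical_trivial[OF sol pos _ le _ this]
  show "\<mu> \<le> 0"
  proof (rule ccontr)
    assume "\<not> \<mu> \<le> 0"
    with trivial p(2) show False by simp
  qed
  show "\<mu> < 0" if "\<bar>m\<bar> \<noteq> 3 \<or> 3 * R\<^sup>2 * sqrt \<epsilon> / 4 < tcrit"
  proof (rule ccontr)
    assume "\<not> \<mu> < 0"
    hence "\<mu> \<ge> 0" by simp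
    from trivial[OF this] that p(2) show False by blast
  qed
qed

text \<open>If \<open>b j\<close> were nonnegative, \<open>b 1\<close> and \<open>b j\<close> would both be \<open>0\<close>, and the listed eigenvectors for
them would be dependent.\<close>

lemma critical_second_eigenvalue_neg:
  assumes ord: "ordered_eigenvalues \<epsilon> R m b" and pos: "\<epsilon> > 0" "R > 0"
    and crit: "3 * R\<^sup>2 * sqrt \<epsilon> / 4 = tcrit" and m: "\<bar>m\<bar> = 3" and j: "j \<ge> 2"
  shows "b j < 0"
proof (rule ccontr)
  assume "\<not> b j < 0"
  obtain W \<Psi> where W: "\<And>j. j \<ge> 1 \<Longrightarrow> mode_eigenvector \<epsilon> R m (of_real (b j)) (W j) (\<Psi> j)"
    and indep: "\<And>S (c :: nat \<Rightarrow> complex). finite S \<and> S \<subseteq> {1..} \<and>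
           (\<forall>p\<in>closed_disc. (\<Sum>j\<in>S. c j * W j p) = 0 \<and> (\<Sum>j\<in>S. c j * \<Psi> j p) = 0)
           \<Longrightarrow> (\<forall>j\<in>S. c j = 0)"
    by (rule ordered_eigenvaluesD[OF ord]) (rule that)
  have "b j \<le> b 1" using ordered_eigenvalues_decreasing[OF ord order_refl] j by simp
  moreover have "b 1 \<le> 0" using subcritical_eigenvalue_bound(1)[OF W[of 1] pos eq_refl[OF crit]] by simp
  ultimately have b0: "b 1 = 0" "b j = 0" using \<open>\<not> b j < 0\<close> by auto
  have "mode_solution \<epsilon> R m 0 (W 1) (\<Psi> 1)" "mode_solution \<epsilon> R m 0 (W j) (\<Psi> j)"
    using W[of 1] W[of j] j unfolding mode_eigenvector_iff b0 by auto
  from critical_dependent[OF this pos crit m] obtain c d where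
    cd: "c \<noteq> 0 \<or> d \<noteq> 0" "\<And>z. z \<in> closed_disc \<Longrightarrow> c * W 1 z + d * W j z = 0 \<and> c * \<Psi> 1 z + d * \<Psi> j z = 0"
    by blast
  define e where "e = (\<lambda>i::nat. if i = 1 then c else d)"
  have e: "e 1 = c" "e j = d" "1 \<noteq> j" using j by (auto simp: e_def)
  have "\<forall>i\<in>{1, j}. e i = 0"
    by (rule indep) (use cd(2) e j in auto)
  thus False using cd(1) e by auto
qed

theorem theorem1:
  fixes \<epsilon> :: real and \<beta> :: "real \<Rightarrow> int \<Rightarrow> nat \<Rightarrow> real"
  assumes "\<epsilon> \<ge> 0" and "\<epsilon> \<noteq> 0"
    and "\<And>R. R > 0 \<Longrightarrow> eigenvalue_family \<epsilon> R (\<beta> R)"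
  shows "\<bar>critical_R \<epsilon> - 4.124 * \<epsilon> powr (- 1 / 4)\<bar> \<le> 0.0005 * \<epsilon> powr (- 1 / 4) \<and>
    (\<forall>R>0. \<beta> R 3 1 = \<beta> R (- 3) 1 \<and>
       (R < critical_R \<epsilon> \<longrightarrow> \<beta> R 3 1 < 0) \<and>
       (R = critical_R \<epsilon> \<longrightarrow> \<beta> R 3 1 = 0) \<and>
       (R > critical_R \<epsilon> \<longrightarrow> \<beta> R 3 1 > 0)) \<and>
    (\<forall>m. \<forall>j\<ge>1. (m, j) \<noteq> (3, 1) \<and> (m, j) \<noteq> (- 3, 1) \<longrightarrow> \<beta> (critical_R \<epsilon>) m j < 0)"
proof (intro conjI allI impI)
  have eps: "\<epsilon> > 0" using assms by simp
  show "\<bar>critical_R \<epsilon> - 4.124 * \<epsilon> powr (- 1 / 4)\<bar> \<le> 0.0005 * \<epsilon> powr (- 1 / 4)"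
    using eps by (rule critical_R_approx)
  have ord: "ordered_eigenvalues \<epsilon> R m (\<beta> R m)" if "R > 0" "m \<noteq> 0" for R m
    using assms(3)[OF that(1)] that(2) by (simp add: eigenvalue_family_def)
  note crit = critical_R_pos[OF eps] critical_R_square[OF eps]
  fix R :: real assume R: "R > 0"
  have le: "\<beta> R m 1 \<le> \<beta> R (- m) 1" if nz: "m \<noteq> 0" for m
  proof -
    obtain w \<psi> where "mode_eigenvector \<epsilon> R m (of_real (\<beta> R m 1)) w \<psi>"
      by (rule ordered_eigenvector[OF ord[OF R nz] order_refl])
    from eigenvalue_le_first[OF ord[OF R] mode_eigenvector_cnj[OF this]] nz show ?thesis by simp
  qed
  show "\<beta> R 3 1 = \<beta> R (- 3) 1" using le[of 3] le[of "- 3"] by simp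
  have ord3: "ordered_eigenvalues \<epsilon> R 3 (\<beta> R 3)" by (rule ord[OF R]) simp
  obtain w \<psi> where ev: "mode_eigenvector \<epsilon> R 3 (of_real (\<beta> R 3 1)) w \<psi>"
    by (rule ordered_eigenvector[OF ord3 order_refl])
  show "\<beta> R 3 1 < 0" if "R < critical_R \<epsilon>"
    using that unfolding critical_R_compare(1)[OF eps R]
    by (intro subcritical_eigenvalue_bound(2)[OF ev eps R]) simp_all
  show "\<beta> R 3 1 = 0" if "R = critical_R \<epsilon>"
  proof -
    have c: "3 * R\<^sup>2 * sqrt \<epsilon> / 4 = tcrit" using that crit(2) by simp
    obtain v \<xi> where "mode_eigenvector \<epsilon> R 3 (of_real 0) v \<xi>"
      using critical_eigenvalue[OF eps R c] by blast
    hence "0 \<le> \<beta> R 3 1" by (rule eigenvalue_le_first[OF ord3])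
    thus ?thesis using subcritical_eigenvalue_bound(1)[OF ev eps R eq_refl[OF c]] by simp
  qed
  show "\<beta> R 3 1 > 0" if gt: "R > critical_R \<epsilon>"
  proof -
    have "tcrit < 3 * R\<^sup>2 * sqrt \<epsilon> / 4"
      using gt critical_R_compare(2)[OF eps R] by blast
    then obtain \<mu> v \<xi> where "\<mu> > 0" "mode_eigenvector \<epsilon> R 3 (of_real \<mu>) v \<xi>"
      using supercritical_eigenvalue[OF eps R] by blast
    from this(2) have "\<mu> \<le> \<beta> R 3 1" by (rule eigenvalue_le_first[OF ord3])
    thus ?thesis using \<open>\<mu> > 0\<close> by simp
  qed
next
  have eps: "\<epsilon> > 0" using assms by simp
  note crit = critical_R_pos[OF eps] critical_R_square[OF eps]
  fix m :: int and j :: nat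
  assume j: "j \<ge> 1" and mj: "(m, j) \<noteq> (3, 1) \<and> (m, j) \<noteq> (- 3, 1)"
  have fam: "eigenvalue_family \<epsilon> (critical_R \<epsilon>) (\<beta> (critical_R \<epsilon>))" by (rule assms(3)[OF crit(1)])
  show "\<beta> (critical_R \<epsilon>) m j < 0"
  proof (cases "\<bar>m\<bar> = 3")
    case True
    hence "j \<ge> 2" "m \<noteq> 0" using j mj by auto
    thus ?thesis
      using fam critical_second_eigenvalue_neg[OF _ eps crit True, of "\<beta> (critical_R \<epsilon>) m" j]
      by (simp add: eigenvalue_family_def)
  next
    case False
    have "\<exists>w \<psi>. mode_eigenvector \<epsilon> (critical_R \<epsilon>) m (of_real (\<beta> (critical_R \<epsilon>) m j)) w \<psi>"
    proof (cases "m = 0")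
      case True
      have "complex_of_real (\<beta> (critical_R \<epsilon>) 0 j) \<in> of_real ` \<beta> (critical_R \<epsilon>) 0 ` {1..}"
        using j by blast
      also have "\<dots> = {\<mu>. \<exists>w \<psi>. mode_eigenvector \<epsilon> (critical_R \<epsilon>) 0 \<mu> w \<psi>}"
        using fam unfolding eigenvalue_family_def by (rule conjunct2)
      finally show ?thesis using True by simp
    next
      case False
      hence "ordered_eigenvalues \<epsilon> (critical_R \<epsilon>) m (\<beta> (critical_R \<epsilon>) m)"
        using fam unfolding eigenvalue_family_def by blast
      thus ?thesis by (rule ordered_eigenvector[OF _ j]) blast
    qed
    then obtain w \<psi> where
      "mode_eigenvector \<epsilon> (critical_R \<epsilon>) m (of_real (\<beta> (critical_R \<epsilon>) m j)) w \<psi>" by blast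
    from subcritical_eigenvalue_bound(2)[OF this eps crit(1) eq_refl[OF crit(2)]] False
    show ?thesis by blast
  qed
qed

end
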